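(* Let $\Omega\subset\mathbb{R}^n$ and let $S:\Omega\to\mathbb{R}$ be a smooth function such that $\|S\|_\infty\le\gamma$, where $\gamma>0$. Assume that one of the following holds: (1) $n=3$, $\Omega$ is a bounded convex domain with smooth boundary and slab diameter $\delta$, and (a) either $$\mathrm{Vol}(\Omega)\le\left(\frac{8}{4.76\,\pi^{2/3}(1+\gamma)}\right)^3\quad\text{and}\quad\delta\le\min\left\{1,\ 1.25\,\mathrm{Vol}(\Omega)^{1/3}\right\},$$ (b) or $$\mathrm{diam}(\Omega)\le\min\left\{1,\ \frac{4}{4.76\,\pi^{2/3}(0.625+\gamma)}\right\}.$$ (2) $n\ge4$ and $\Omega$ is a ball of radius $d$ with $$d\le\min\left\{\frac12,\ \frac{n-1}{C_n(0.625+\gamma)}\right\}.$$ Then for any $c\in(-\infty,\infty)$ there exists a $\lambda\in\mathbb{R}$ such that the Dirichlet problem $$\Delta f=-\frac{1}{2(n-1)}\left[\lambda e^{2f}+(n-1)(n-2)|\nabla f|^2\right]+S(x)\ \text{ in }\Omega,\qquad f=c\ \text{ on }\partial\Omega,$$ has a smooth solution $f$.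
   Context: $\Delta$ and $\nabla$ are the Euclidean Laplacian (sum of second derivatives) and gradient. $\|f\|_\infty=\sup_\Omega|f|$. $\mathrm{Vol}(\Omega)$ is the Lebesgue measure of $\Omega$ and $\mathrm{diam}(\Omega)$ its diameter. The slab diameter $\delta$ of $\Omega$ is the smallest distance between two parallel hyperplanes such that $\Omega$ is contained in the region between them. The constant $C_n$, depending only on the dimension $n$, is $$C_n=\sup_{x\in B_1^n}\int_{B_1^n}|\nabla G_1(x,x')|\,dx',$$ where $B_1^n$ is the unit ball of $\mathbb{R}^n$ centered at the origin, $G_1$ is the Green's function of the Dirichlet Laplacian on $B_1^n$, and the gradient is taken in $x$. *)

theory Defs
  imports "HOL-Analysis.Analysis"
begin

definition partial :: "'n \<Rightarrow> (real^'n \<Rightarrow> real) \<Rightarrow> real^'n \<Rightarrow> real" where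
  "partial i f x = frechet_derivative f (at x) (axis i 1)"

text \<open>The next two notions are meant for open sets \<open>U\<close> only; values of \<open>f\<close> outside \<open>U\<close> are
  then irrelevant, because all derivatives at points of \<open>U\<close> are local.\<close>

fun C_k_on :: "nat \<Rightarrow> (real^'n) set \<Rightarrow> (real^'n \<Rightarrow> real) \<Rightarrow> bool" where
  "C_k_on 0 U f = continuous_on U f"
| "C_k_on (Suc k) U f =
    ((\<forall>x\<in>U. f differentiable (at x)) \<and> (\<forall>i. C_k_on k U (partial i f)))"

definition smooth_on :: "(real^'n) set \<Rightarrow> (real^'n \<Rightarrow> real) \<Rightarrow> bool" where
  "smooth_on U f \<longleftrightarrow> (\<forall>k. C_k_on k U f)"

definition grad :: "(real^'n \<Rightarrow> real) \<Rightarrow> real^'n \<Rightarrow> real^'n" where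
  "grad f x = (\<chi> i. partial i f x)"

definition laplacian :: "(real^'n \<Rightarrow> real) \<Rightarrow> real^'n \<Rightarrow> real" where
  "laplacian f x = (\<Sum>i\<in>UNIV. partial i (partial i f) x)"

text \<open>The supremum is taken in the extended reals, so that it is meaningful (and infinite) for
  unbounded functions.\<close>

definition sup_norm_on :: "(real^'n) set \<Rightarrow> (real^'n \<Rightarrow> real) \<Rightarrow> ereal" where
  "sup_norm_on \<Omega> f = (SUP x\<in>\<Omega>. ereal \<bar>f x\<bar>)"

text \<open>Smoothness of the boundary of an open set: near each boundary point the set is a strict
  sublevel set of a smooth function without critical points.\<close>

definition smooth_boundary :: "(real^'n) set \<Rightarrow> bool" where
  "smooth_boundary \<Omega> \<longleftrightarrow>
    (\<forall>p\<in>frontier \<Omega>. \<exists>U \<rho>. open U \<and> p \<in> U \<and> smooth_on U \<rho> \<and>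
       (\<forall>x\<in>U. grad \<rho> x \<noteq> 0) \<and> \<Omega> \<inter> U = {x\<in>U. \<rho> x < 0})"

text \<open>The hyperplanes with unit normal \<open>u\<close> and offsets \<open>a \<le> b\<close> have distance \<open>b - a\<close>.
  For bounded \<open>\<Omega>\<close> the infimum is attained.\<close>

definition slab_diameter :: "(real^'n) set \<Rightarrow> real" where
  "slab_diameter \<Omega> =
    Inf {b - a | a b. a \<le> b \<and> (\<exists>u. norm u = 1 \<and> (\<forall>x\<in>\<Omega>. a \<le> u \<bullet> x \<and> u \<bullet> x \<le> b))}"

text \<open>Fundamental solution of the negative Laplacian; \<open>unit_ball_vol n\<close> is the volume of the unit
  ball in dimension \<open>n\<close>.\<close>

definition fundamental_solution :: "real^'n \<Rightarrow> real" where
  "fundamental_solution x =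
    (let n = real CARD('n) in
     if CARD('n) = 2 then - ln (norm x) / (2 * pi)
     else norm x powr (2 - n) / (n * (n - 2) * unit_ball_vol n))"

definition harmonic_on :: "(real^'n) set \<Rightarrow> (real^'n \<Rightarrow> real) \<Rightarrow> bool" where
  "harmonic_on U h \<longleftrightarrow> C_k_on 2 U h \<and> (\<forall>x\<in>U. laplacian h x = 0)"

text \<open>Harmonic function in \<open>\<Omega>\<close> with the boundary values of the fundamental solution with pole \<open>y\<close>.
  On the closure of a bounded open \<open>\<Omega>\<close> it is unique by the maximum principle, and it exists if
  \<open>\<Omega>\<close> is a ball.\<close>

definition green_corrector :: "(real^'n) set \<Rightarrow> real^'n \<Rightarrow> real^'n \<Rightarrow> real" where
  "green_corrector \<Omega> y =
    (SOME h. continuous_on (closure \<Omega>) h \<and> harmonic_on \<Omega> h \<and>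
       (\<forall>x\<in>frontier \<Omega>. h x = fundamental_solution (x - y)))"

text \<open>Green's function of the Dirichlet Laplacian with pole \<open>y\<close>, normalized such that the negative
  Laplacian in \<open>x\<close> is the Dirac measure at \<open>y\<close>.  Reversing this sign does not affect
  \<open>green_const\<close> below.\<close>

definition green :: "(real^'n) set \<Rightarrow> real^'n \<Rightarrow> real^'n \<Rightarrow> real" where
  "green \<Omega> x y = fundamental_solution (x - y) - green_corrector \<Omega> y x"

text \<open>The constant \<open>C\<^sub>n\<close>, with the dimension \<open>n\<close> given by the index type.  The gradient acts on the
  first argument of \<open>green\<close>; the supremum is finite and positive.\<close>

definition green_const :: "'n::finite itself \<Rightarrow> real" where
  "green_const _ =
    enn2real (SUP x\<in>ball (0::real^'n) 1.
      \<integral>\<^sup>+y\<in>ball (0::real^'n) 1. ennreal (norm (grad (\<lambda>z. green (ball 0 1) z y) x)) \<partial>lborel)"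

end

theory Submission
  imports Defs "HOL-Complex_Analysis.Great_Picard"
begin

text \<open>
  Put \<open>a = (n - 2) / 2\<close>.  The substitution \<open>v = exp (a (f - c))\<close> turns the problem into
  \<open>\<Delta>v = a S v + m v\<^sup>p\<close> in \<open>\<Omega>\<close> and \<open>v = 1\<close> on the boundary, where \<open>p = 1 + 2 / a\<close> and \<open>m\<close> is a
  negative multiple of \<open>\<lambda>\<close>.  Choose \<open>\<lambda>\<close> so negative that \<open>m \<ge> \<bar>a S\<bar>\<close>.  Then \<open>1\<close> is a supersolution,
  \<open>exp (b (x\<^sub>1 - t))\<close> with \<open>b\<^sup>2 = 2 m\<close> and large \<open>t\<close> is a positive subsolution, and monotone iteration
  gives a solution between them.

  The linear problems \<open>A w - \<Delta>w = h\<close> of the iteration are solved by a difference scheme of step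
  \<open>e\<close> in which the point ranges over the whole space instead of a lattice.  The scheme commutes with
  all translations, so comparing a discrete solution with its translates, and near the boundary with
  quadratic barriers at supporting hyperplanes, gives equicontinuity up to an error \<open>O(e)\<close>.  The
  limits for \<open>e \<rightarrow> 0\<close> are weak solutions.  Smoothness follows from \<open>\<kappa> w = \<omega> * w - P * \<Delta>w\<close>, where \<open>P\<close>
  is a truncated fundamental solution and \<open>\<omega>\<close> the regular part of its Laplacian: both convolutions
  gain one derivative.
\<close>

section \<open>The difference scheme\<close>

text \<open>The barriers are ordered thanks to the size of \<open>m\<close>: at \<open>v = 1\<close>
  the Laplacian is \<open>0\<close> and the right side \<open>a S + m\<close> is nonnegative; for
  \<open>0 < v \<le> 1\<close> the right side is at most \<open>2 m v\<close>, which for the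
  exponential is its Laplacian. The lower barrier also keeps \<open>v\<close> positive, which the
  real power and the final logarithm require.

  Discrete solutions need not be continuous, so equicontinuity is only asymptotic; convergence on a
  countable dense set still forces convergence everywhere. Letting the point range over the whole
  space permits translation by arbitrary vectors. Convexity enters through the barriers: each point
  outside the domain is separated from it by a hyperplane, and second differences of quadratics are
  exact.

  All test functions are translates of regularized, truncated fundamental solutions, and their
  Laplacians are obtained as limits of difference quotients. They serve twice: for \<open>e\<close>
  tending to \<open>0\<close> they yield the representation formula, and for fixed \<open>e\<close>,
  being nonnegative, they turn the weak equation into the pointwise one.\<close>

definition nb_sum :: "real \<Rightarrow> (real^'n \<Rightarrow> real) \<Rightarrow> real^'n \<Rightarrow> real" where
  "nb_sum e W x = (\<Sum>i\<in>UNIV. W (x + e *\<^sub>R axis i 1) + W (x - e *\<^sub>R axis i 1))"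

definition dlap :: "real \<Rightarrow> (real^'n \<Rightarrow> real) \<Rightarrow> real^'n \<Rightarrow> real" where
  "dlap e W x = (nb_sum e W x - 2 * real CARD('n) * W x) / e\<^sup>2"

text \<open>The equation \<open>A W - dlap e W = h\<close>, multiplied by \<open>e\<^sup>2\<close>.
  Prescribing \<open>W = 0\<close> on the whole complement, rather than on the frontier, supplies a
  value at every neighbour that leaves \<Omega>.\<close>

definition disc_sol :: "(real^'n) set \<Rightarrow> real \<Rightarrow> real \<Rightarrow> (real^'n \<Rightarrow> real) \<Rightarrow> (real^'n \<Rightarrow> real) \<Rightarrow> bool" where
  "disc_sol \<Omega> A e h W \<longleftrightarrow> W \<in> borel_measurable borel \<and> bounded (range W) \<and> (\<forall>x. x \<notin> \<Omega> \<longrightarrow> W x = 0) \<and>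
     (\<forall>x\<in>\<Omega>. (2 * real CARD('n) + A * e\<^sup>2) * W x = nb_sum e W x + e\<^sup>2 * h x)"

lemma nb_sum_mono:
  assumes "\<And>y. dist y x = \<bar>e\<bar> \<Longrightarrow> W y \<le> W' y"
  shows "nb_sum e W x \<le> nb_sum e W' x"
  unfolding nb_sum_def
  by (intro sum_mono add_mono assms) (auto simp: dist_norm)

lemma nb_sum_cong:
  assumes "\<And>y. dist y x = \<bar>e\<bar> \<Longrightarrow> W y = W' y"
  shows "nb_sum e W x = nb_sum e W' x"
  by (intro antisym nb_sum_mono) (auto simp: assms)

lemma nb_sum_const [simp]: "nb_sum e (\<lambda>_. c) (x::real^'n) = 2 * real CARD('n) * c"
  by (simp add: nb_sum_def)

lemma nb_sum_diff: "nb_sum e (\<lambda>y. f y - g y) x = nb_sum e f x - nb_sum e g x"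
  by (simp add: nb_sum_def sum_subtractf[symmetric] algebra_simps)

lemma nb_sum_cmult: "nb_sum e (\<lambda>y. c * f y) x = c * nb_sum e f x"
  by (simp add: nb_sum_def sum_distrib_left algebra_simps)

lemma nb_sum_shift: "nb_sum e (\<lambda>y. f (y + z)) x = nb_sum e f (x + z)"
  by (simp add: nb_sum_def algebra_simps)

lemma nb_sum_measurable [measurable]:
  assumes [measurable]: "W \<in> borel_measurable borel"
  shows "nb_sum e W \<in> borel_measurable (borel :: (real^'n) measure)"
proof -
  have "(\<lambda>x. nb_sum e W x) \<in> borel_measurable borel"
    unfolding nb_sum_def by measurable
  then show ?thesis by simp
qed

text \<open>The supremum \<open>s\<close> need not be attained. Instead the surplus
  \<open>A * e\<^sup>2\<close> makes the averaging a strict contraction: wherever \<open>Z\<close>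
  is positive it is at most \<open>N * s / D\<close> with \<open>N < D\<close>, so a positive
  supremum would be smaller than itself. The inequality is demanded only where \<open>Z\<close> is
  positive, which in applications confines the argument to \<Omega>.\<close>

lemma discrete_max_principle:
  fixes Z :: "real^'n \<Rightarrow> real"
  assumes A: "A > 0" and e: "e > 0" and bdd: "\<And>x. Z x \<le> B"
    and Z: "\<And>x. Z x > 0 \<Longrightarrow> (2 * real CARD('n) + A * e\<^sup>2) * Z x \<le> nb_sum e Z x"
  shows "Z x \<le> 0"
proof (rule ccontr)
  assume "\<not> Z x \<le> 0"
  define s where "s = (SUP y. Z y)"
  have bdd': "bdd_above (range Z)" using bdd by (auto intro!: bdd_aboveI[of _ B])
  have le: "Z y \<le> s" for y unfolding s_def by (rule cSUP_upper[OF _ bdd']) auto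
  have s: "s > 0" using le[of x] \<open>\<not> Z x \<le> 0\<close> by linarith
  define N where "N = 2 * real CARD('n)"
  define D where "D = N + A * e\<^sup>2"
  have N: "N > 0" by (simp add: N_def)
  have D: "D > N" using A e by (simp add: D_def)
  have "Z y \<le> N * s / D" for y
  proof (cases "Z y > 0")
    case True
    have "D * Z y \<le> nb_sum e Z y" using Z[OF True] by (simp add: D_def N_def)
    also have "\<dots> \<le> nb_sum e (\<lambda>_. s) y" by (rule nb_sum_mono) (rule le)
    also have "\<dots> = N * s" by (simp add: N_def)
    finally show ?thesis using D N by (simp add: field_simps)
  next
    case False
    then show ?thesis using N D s by (smt (verit) divide_nonneg_nonneg mult_nonneg_nonneg)
  qed
  then have "s \<le> N * s / D" unfolding s_def by (intro cSUP_least) auto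
  also have "\<dots> < s" using D N s by (simp add: field_simps)
  finally show False by simp
qed

text \<open>Monotone iteration of the fixed point map \<open>T\<close> from \<open>0\<close>,
  bounded above by the constant \<open>M / A\<close>. A pointwise limit of a sequence keeps Borel
  measurability, on which the later integral identities rely.\<close>

lemma disc_sol_exists:
  fixes \<Omega> :: "(real^'n) set"
  assumes A: "A > 0" and e: "e > 0" and [measurable]: "\<Omega> \<in> sets borel"
    and h [measurable]: "h \<in> borel_measurable borel" and h0: "\<And>x. 0 \<le> h x" and hM: "\<And>x. h x \<le> M"
  shows "\<exists>W. disc_sol \<Omega> A e h W"
proof -
  define N where "N = 2 * real CARD('n)"
  define D where "D = N + A * e\<^sup>2"
  have N: "N > 0" by (simp add: N_def)
  have D: "D > N" "D > 0" using A e N by (auto simp: D_def intro!: add_pos_pos)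
  define T where "T W x = (if x \<in> \<Omega> then (nb_sum e W x + e\<^sup>2 * h x) / D else 0)" for W :: "real^'n \<Rightarrow> real" and x
  define Ws where "Ws j = (T ^^ j) (\<lambda>_. 0)" for j
  have Ws0: "Ws 0 = (\<lambda>_. 0)" and WsS: "Ws (Suc j) = T (Ws j)" for j by (auto simp: Ws_def)
  have mono: "T W x \<le> T W' x" if "\<And>y. W y \<le> W' y" for W W' x
    unfolding T_def using D by (auto intro!: divide_right_mono add_mono nb_sum_mono that)
  have M0: "0 \<le> M" using h0 hM order_trans by blast
  have bnd: "T W x \<le> M / A" if "\<And>y. W y \<le> M / A" for W x
  proof -
    have "nb_sum e W x + e\<^sup>2 * h x \<le> nb_sum e (\<lambda>_. M / A) x + e\<^sup>2 * M"
      by (intro add_mono nb_sum_mono that mult_left_mono hM) auto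
    also have "\<dots> = D * (M / A)" using A by (simp add: D_def N_def field_simps)
    finally have "(nb_sum e W x + e\<^sup>2 * h x) / D \<le> M / A" using D by (simp add: field_simps)
    then show ?thesis using M0 A by (auto simp: T_def)
  qed
  have nn: "0 \<le> T W x" if "\<And>y. 0 \<le> W y" for W x
  proof -
    have "0 \<le> nb_sum e W x" unfolding nb_sum_def by (intro sum_nonneg add_nonneg_nonneg that)
    then show ?thesis using D h0 by (auto simp: T_def)
  qed
  have W_nn: "0 \<le> Ws j x" for j x by (induction j arbitrary: x) (auto simp: Ws0 WsS nn)
  have W_bnd: "Ws j x \<le> M / A" for j x by (induction j arbitrary: x) (use M0 A in \<open>auto simp: Ws0 WsS bnd\<close>)
  have W_inc: "Ws j x \<le> Ws (Suc j) x" for j x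
  proof (induction j arbitrary: x)
    case 0 then show ?case using W_nn[of 1] by (simp add: Ws0)
  next
    case (Suc j) have "T (Ws j) x \<le> T (Ws (Suc j)) x" by (rule mono) (rule Suc)
    then show ?case by (simp add: WsS)
  qed
  have "incseq (\<lambda>j. Ws j x)" for x by (rule incseq_SucI) (rule W_inc)
  then have "\<exists>l. (\<lambda>j. Ws j x) \<longlonglongrightarrow> l" for x
    using incseq_convergent[of "\<lambda>j. Ws j x" "M / A"] W_bnd by metis
  then obtain W where W: "\<And>x. (\<lambda>j. Ws j x) \<longlonglongrightarrow> W x" by metis
  have [measurable]: "Ws j \<in> borel_measurable borel" for j
  proof (induction j)
    case (Suc j)
    note [measurable] = Suc
    show ?case unfolding WsS T_def by measurable
  qed (simp add: Ws0)
  have "disc_sol \<Omega> A e h W" unfolding disc_sol_def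
  proof (intro conjI allI impI ballI)
    show "W \<in> borel_measurable borel"
      by (rule borel_measurable_LIMSEQ_real[of borel Ws]) (auto intro: W)
    have "0 \<le> W x" "W x \<le> M / A" for x
      by (rule LIMSEQ_le_const[OF W], simp add: W_nn) (rule LIMSEQ_le_const2[OF W], simp add: W_bnd)
    then show "bounded (range W)" by (intro boundedI[of _ "M / A"]) auto
  next
    fix x assume "x \<notin> \<Omega>"
    then have "Ws j x = 0" for j by (cases j) (auto simp: Ws0 WsS T_def)
    then have "(\<lambda>j. 0) \<longlonglongrightarrow> W x" using W[of x] by simp
    then show "W x = 0" by (simp add: LIMSEQ_const_iff)
  next
    fix x assume x: "x \<in> \<Omega>"
    have "(\<lambda>j. (nb_sum e (Ws j) x + e\<^sup>2 * h x) / D) \<longlonglongrightarrow> (nb_sum e W x + e\<^sup>2 * h x) / D"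
      unfolding nb_sum_def by (intro tendsto_intros W) (use D in auto)
    moreover have "(\<lambda>j. (nb_sum e (Ws j) x + e\<^sup>2 * h x) / D) = (\<lambda>j. Ws (Suc j) x)"
      using x by (auto simp: WsS T_def)
    ultimately have "(\<lambda>j. Ws (Suc j) x) \<longlonglongrightarrow> (nb_sum e W x + e\<^sup>2 * h x) / D" by simp
    then have "W x = (nb_sum e W x + e\<^sup>2 * h x) / D"
      by (rule LIMSEQ_unique[OF LIMSEQ_Suc[OF W[of x]]])
    then show "(2 * real CARD('n) + A * e\<^sup>2) * W x = nb_sum e W x + e\<^sup>2 * h x"
      using D by (simp add: D_def N_def field_simps)
  qed
  then show ?thesis by blast
qed

text \<open>Comparison with a supersolution. Since \<open>W\<close> vanishes outside \<Omega> and
  \<open>q\<close> is nonnegative, \<open>W - q\<close> can be positive only inside, where both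
  relations hold.\<close>

lemma disc_sol_le:
  fixes q :: "real^'n \<Rightarrow> real"
  assumes A: "A > 0" and e: "e > 0" and W: "disc_sol \<Omega> A e h W" and q0: "\<And>x. 0 \<le> q x"
    and q: "\<And>x. x \<in> \<Omega> \<Longrightarrow> nb_sum e q x + e\<^sup>2 * h x \<le> (2 * real CARD('n) + A * e\<^sup>2) * q x"
  shows "W x \<le> q x"
proof -
  from W obtain B where B: "\<And>x. \<bar>W x\<bar> \<le> B" unfolding disc_sol_def bounded_iff by auto
  have "W x - q x \<le> 0"
  proof (rule discrete_max_principle[OF A e])
    fix x show "W x - q x \<le> B" using B[of x] q0[of x] by simp
    assume pos: "W x - q x > 0"
    then have x: "x \<in> \<Omega>" using W q0[of x] by (auto simp: disc_sol_def)
    then have "(2 * real CARD('n) + A * e\<^sup>2) * W x = nb_sum e W x + e\<^sup>2 * h x"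
      using W by (auto simp: disc_sol_def)
    then show "(2 * real CARD('n) + A * e\<^sup>2) * (W x - q x) \<le> nb_sum e (\<lambda>y. W y - q y) x"
      using q[OF x] by (simp add: nb_sum_diff right_diff_distrib)
  qed
  then show ?thesis by simp
qed

lemma disc_sol_nonneg:
  fixes W :: "real^'n \<Rightarrow> real"
  assumes A: "A > 0" and e: "e > 0" and W: "disc_sol \<Omega> A e h W" and h: "\<And>x. x \<in> \<Omega> \<Longrightarrow> 0 \<le> h x"
  shows "0 \<le> W x"
proof -
  from W obtain B where B: "\<And>x. \<bar>W x\<bar> \<le> B" unfolding disc_sol_def bounded_iff by auto
  have "- W x \<le> 0"
  proof (rule discrete_max_principle[OF A e])
    fix x show "- W x \<le> B" using B[of x] by simp
    assume pos: "- W x > 0"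
    then have x: "x \<in> \<Omega>" using W by (auto simp: disc_sol_def)
    then have "(2 * real CARD('n) + A * e\<^sup>2) * W x = nb_sum e W x + e\<^sup>2 * h x"
      using W by (auto simp: disc_sol_def)
    then show "(2 * real CARD('n) + A * e\<^sup>2) * (- W x) \<le> nb_sum e (\<lambda>y. - W y) x"
      using h[OF x] nb_sum_cmult[of e "-1" W x] by simp
  qed
  then show ?thesis by simp
qed

lemma disc_sol_mono:
  fixes W :: "real^'n \<Rightarrow> real"
  assumes A: "A > 0" and e: "e > 0" and W: "disc_sol \<Omega> A e h W" and W': "disc_sol \<Omega> A e h' W'"
    and h: "\<And>x. x \<in> \<Omega> \<Longrightarrow> h x \<le> h' x" and h0: "\<And>x. x \<in> \<Omega> \<Longrightarrow> 0 \<le> h' x"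
  shows "W x \<le> W' x"
proof (rule disc_sol_le[OF A e W])
  show "0 \<le> W' x" for x by (rule disc_sol_nonneg[OF A e W' h0])
  fix x assume x: "x \<in> \<Omega>"
  then have "(2 * real CARD('n) + A * e\<^sup>2) * W' x = nb_sum e W' x + e\<^sup>2 * h' x"
    using W' by (auto simp: disc_sol_def)
  then show "nb_sum e W' x + e\<^sup>2 * h x \<le> (2 * real CARD('n) + A * e\<^sup>2) * W' x"
    using h[OF x] by (simp add: mult_left_mono)
qed

lemma disc_sol_le_const:
  fixes W :: "real^'n \<Rightarrow> real"
  assumes A: "A > 0" and e: "e > 0" and W: "disc_sol \<Omega> A e h W" and h: "\<And>x. h x \<le> M" and M: "0 \<le> M"
  shows "W x \<le> M / A"
proof (rule disc_sol_le[OF A e W])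
  show "0 \<le> M / A" using A M by simp
  fix x
  have "e\<^sup>2 * h x \<le> e\<^sup>2 * M" by (rule mult_left_mono[OF h]) simp
  then show "nb_sum e (\<lambda>_. M / A) x + e\<^sup>2 * h x \<le> (2 * real CARD('n) + A * e\<^sup>2) * (M / A)"
    using A by (simp add: field_simps)
qed

section \<open>Barriers at separating hyperplanes and the translation estimate\<close>

lemma separating_halfspace:
  fixes \<Omega> :: "(real^'n) set"
  assumes "convex \<Omega>" "\<Omega> \<noteq> {}" "y \<notin> \<Omega>"
  obtains u b where "norm u = 1" "\<And>x. x \<in> \<Omega> \<Longrightarrow> u \<bullet> x \<le> b" "b \<le> u \<bullet> y"
proof -
  obtain a b where ab: "a \<noteq> 0" "\<forall>x\<in>\<Omega>. a \<bullet> x \<le> b" "\<forall>x\<in>{y}. b \<le> a \<bullet> x"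
    using separating_hyperplane_sets[of \<Omega> "{y}"] assms by auto
  show ?thesis
  proof
    show "norm (a /\<^sub>R norm a) = 1" using ab by simp
    show "(a /\<^sub>R norm a) \<bullet> x \<le> b / norm a" if "x \<in> \<Omega>" for x
      using ab that by (simp add: divide_simps)
    show "b / norm a \<le> (a /\<^sub>R norm a) \<bullet> y" using ab by (simp add: divide_simps)
  qed
qed

text \<open>The profile \<open>t * (b - t) / 2\<close> has second derivative \<open>- 1\<close>, so
  axis \<open>i\<close> contributes exactly \<open>- (e * u $ i)\<^sup>2\<close>, without an error
  term, and these contributions add up to \<open>- e\<^sup>2\<close> for a unit vector
  \<open>u\<close>.\<close>

lemma nb_sum_quadratic:
  fixes u :: "real^'n"
  assumes "norm u = 1"
  shows "nb_sum e (\<lambda>y. (a - u \<bullet> y) * (b - (a - u \<bullet> y)) / 2 + c) x =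
    2 * real CARD('n) * ((a - u \<bullet> x) * (b - (a - u \<bullet> x)) / 2 + c) - e\<^sup>2"
proof -
  have s: "(\<Sum>i\<in>UNIV. (u $ i)\<^sup>2) = 1"
    using assms by (simp add: norm_vec_def L2_set_def)
  define t where "t = a - u \<bullet> x"
  have "nb_sum e (\<lambda>y. (a - u \<bullet> y) * (b - (a - u \<bullet> y)) / 2 + c) x
      = (\<Sum>i\<in>UNIV. 2 * (t * (b - t) / 2 + c) - e\<^sup>2 * (u $ i)\<^sup>2)"
    unfolding nb_sum_def
    by (intro sum.cong refl)
      (simp add: t_def inner_add_right inner_diff_right inner_axis power2_eq_square field_simps)
  also have "\<dots> = 2 * real CARD('n) * (t * (b - t) / 2 + c) - e\<^sup>2 * (\<Sum>i\<in>UNIV. (u $ i)\<^sup>2)"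
    by (simp add: sum_subtractf sum_distrib_left)
  finally show ?thesis by (simp add: s t_def)
qed

text \<open>Barrier argument: a concave parabola in the distance \<open>t\<close> to a hyperplane
  separating \<open>y\<close> from \<Omega> is a supersolution after multiplication by
  \<open>M\<close>. It grows at most linearly in \<open>t\<close>, and \<open>t\<close> is at most
  \<open>norm (y - x)\<close>; the additional \<open>e\<close> pays for neighbours that overstep the
  hyperplane.\<close>

lemma disc_sol_boundary:
  fixes \<Omega> :: "(real^'n) set"
  assumes A: "A > 0" and e: "e > 0" "e \<le> 1" and W: "disc_sol \<Omega> A e h W"
    and h: "\<And>x. h x \<le> M" and M: "0 \<le> M"
    and conv: "convex \<Omega>" and R: "\<Omega> \<subseteq> cball 0 R" "R \<ge> 1" and x: "x \<in> \<Omega>" and y: "y \<notin> \<Omega>"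
  shows "W x \<le> M * (2 * R + 1) * (norm (y - x) + e)"
proof -
  have "\<Omega> \<noteq> {}" using x by auto
  obtain u b0 where u: "norm u = 1" and b0: "\<And>x. x \<in> \<Omega> \<Longrightarrow> u \<bullet> x \<le> b0" and b0y: "b0 \<le> u \<bullet> y"
    using separating_halfspace[OF conv \<open>\<Omega> \<noteq> {}\<close> y] by blast
  have ux: "\<bar>u \<bullet> z\<bar> \<le> norm z" for z using Cauchy_Schwarz_ineq2[of u z] u by simp
  have Rz: "\<bar>u \<bullet> z\<bar> \<le> R" if "z \<in> \<Omega>" for z using ux[of z] R that by force
  \<comment> \<open>Cutting the offset at \<open>R\<close> bounds the distance \<open>t\<close> by
    \<open>2 * R\<close> inside \<Omega>, even if the hyperplane found is far away.\<close>
  define a where "a = min b0 R"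
  have a: "u \<bullet> z \<le> a" if "z \<in> \<Omega>" for z using b0[OF that] Rz[OF that] by (auto simp: a_def)
  have aR: "a \<le> R" "a \<le> u \<bullet> y" using b0y by (auto simp: a_def)
  \<comment> \<open>The second zero \<open>4 * R\<close> of the parabola lies beyond the largest
    possible distance \<open>2 * R + e\<close>. The offset \<open>(2 * R + 1) * e\<close>
    compensates the worst value \<open>- e * (4 * R + e) / 2\<close>, taken at a neighbour behind
    the hyperplane.\<close>
  define f where "f z = (a - u \<bullet> z) * (4 * R - (a - u \<bullet> z)) / 2 + (2 * R + 1) * e" for z
  have f_nn: "0 \<le> f z" if z: "z' \<in> \<Omega>" "dist z z' \<le> e" for z z'
  proof -
    define t where "t = a - u \<bullet> z"
    have "\<bar>u \<bullet> (z - z')\<bar> \<le> e" using ux[of "z - z'"] z by (simp add: dist_norm)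
    then have t: "- e \<le> t" "t \<le> 2 * R + e"
      using a[OF z(1)] Rz[OF z(1)] aR by (auto simp: t_def inner_diff_right)
    have "0 \<le> t * (4 * R - t) / 2 + (2 * R + 1) * e"
    proof (cases "t \<ge> 0")
      case True
      then show ?thesis using t R e by (intro add_nonneg_nonneg) auto
    next
      case False
      have "(- t) * (4 * R - t) \<le> e * (4 * R + 1)"
        using False t R e by (intro mult_mono) auto
      moreover have "e * (4 * R + 1) \<le> (2 * R + 1) * e * 2" using e by (simp add: field_simps)
      ultimately show ?thesis by linarith
    qed
    then show ?thesis by (simp add: f_def t_def)
  qed
  \<comment> \<open>Truncation at \<open>0\<close> makes the comparison function nonnegative
    everywhere; by \<open>f_nn\<close> it changes nothing at points of \<Omega> and at their
    neighbours.\<close>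
  have "W x \<le> M * max 0 (f x)"
  proof (rule disc_sol_le[OF A e(1) W])
    show "0 \<le> M * max 0 (f z)" for z using M by simp
    fix z assume z: "z \<in> \<Omega>"
    have "nb_sum e (\<lambda>z. M * max 0 (f z)) z = nb_sum e (\<lambda>z. M * f z) z"
      by (rule nb_sum_cong) (use f_nn[OF z] e in \<open>auto simp: max_def\<close>)
    also have "\<dots> = M * (2 * real CARD('n) * f z - e\<^sup>2)"
      unfolding nb_sum_cmult f_def nb_sum_quadratic[OF u] by simp
    finally have "nb_sum e (\<lambda>z. M * max 0 (f z)) z = M * (2 * real CARD('n) * f z - e\<^sup>2)" .
    then have "nb_sum e (\<lambda>z. M * max 0 (f z)) z = 2 * real CARD('n) * (M * f z) - e\<^sup>2 * M"
      by (simp add: algebra_simps)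
    moreover have "e\<^sup>2 * h z \<le> e\<^sup>2 * M" by (rule mult_left_mono[OF h]) simp
    moreover have "0 \<le> A * e\<^sup>2 * (M * f z)" using A M f_nn[OF z, of z] e by simp
    moreover have "max 0 (f z) = f z" using f_nn[OF z, of z] e by simp
    ultimately show "nb_sum e (\<lambda>z. M * max 0 (f z)) z + e\<^sup>2 * h z \<le> (2 * real CARD('n) + A * e\<^sup>2) * (M * max 0 (f z))"
      unfolding distrib_right by linarith
  qed
  also have "\<dots> = M * f x" using f_nn[OF x, of x] e by simp
  also have "\<dots> \<le> M * ((2 * R + 1) * (norm (y - x) + e))"
  proof (rule mult_left_mono[OF _ M])
    define t where "t = a - u \<bullet> x"
    have t: "0 \<le> t" "t \<le> norm (y - x)"
      using a[OF x] aR ux[of "y - x"] by (auto simp: t_def inner_diff_right)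
    have "t * (4 * R - t) / 2 \<le> (2 * R + 1) * t" using t by (simp add: field_simps)
    also have "\<dots> \<le> (2 * R + 1) * norm (y - x)" using t R by (intro mult_left_mono) auto
    finally show "f x \<le> (2 * R + 1) * (norm (y - x) + e)"
      by (simp add: f_def t_def algebra_simps)
  qed
  finally show ?thesis by (simp add: mult.assoc)
qed

text \<open>The maximum principle is applied to \<open>W (x + z) - W x - c\<close>. If
  \<open>x + z\<close> is outside \<Omega>, this cannot be positive; if only \<open>x\<close> is
  outside, the boundary estimate applies; if both are inside, the equations subtract and the part
  \<open>d / A\<close> of \<open>c\<close> absorbs the change of the source. The shift
  \<open>- z\<close> gives the other sign.\<close>

lemma disc_sol_translate:
  fixes \<Omega> :: "(real^'n) set"
  assumes A: "A > 0" and e: "e > 0" "e \<le> 1" and W: "disc_sol \<Omega> A e h W"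
    and h0: "\<And>x. 0 \<le> h x" and h: "\<And>x. h x \<le> M" and M: "0 \<le> M"
    and conv: "convex \<Omega>" and R: "\<Omega> \<subseteq> cball 0 R" "R \<ge> 1"
    and hz: "\<And>x. \<bar>h (x + z) - h x\<bar> \<le> d"
  shows "\<bar>W (x + z) - W x\<bar> \<le> M * (2 * R + 1) * (norm z + e) + d / A"
proof -
  have d: "0 \<le> d" using hz[of 0] by linarith
  have *: "W (x + z) - W x - (M * (2 * R + 1) * (norm z + e) + d / A) \<le> 0"
    if hz: "\<And>x. h (x + z) - h x \<le> d" for z x
  proof -
    define c where "c = M * (2 * R + 1) * (norm z + e) + d / A"
    have c1: "M * (2 * R + 1) * (norm z + e) \<ge> 0" using M R e by simp
    have c: "d / A \<le> c" "0 \<le> c" using c1 d A by (auto simp: c_def)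
    from W obtain B where B: "\<And>x. \<bar>W x\<bar> \<le> B" unfolding disc_sol_def bounded_iff by auto
    have W0: "0 \<le> W x" for x by (rule disc_sol_nonneg[OF A e(1) W h0])
    have "W (x + z) - W x - c \<le> 0"
    proof (rule discrete_max_principle[OF A e(1)])
      fix x show "W (x + z) - W x - c \<le> B" using B[of "x + z"] W0[of x] c by linarith
      assume pos: "W (x + z) - W x - c > 0"
      have xz: "x + z \<in> \<Omega>"
      proof (rule ccontr)
        assume "x + z \<notin> \<Omega>"
        then have "W (x + z) = 0" using W by (auto simp: disc_sol_def)
        then show False using pos W0[of x] c by linarith
      qed
      have x: "x \<in> \<Omega>"
      proof (rule ccontr)
        assume x: "x \<notin> \<Omega>"
        have "W (x + z) \<le> M * (2 * R + 1) * (norm (x - (x + z)) + e)"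
          by (rule disc_sol_boundary[OF A e W h M conv R xz x])
        moreover have "0 \<le> d / A" using d A by simp
        ultimately show False using pos W0[of x] by (simp add: c_def)
      qed
      have "(2 * real CARD('n) + A * e\<^sup>2) * W x = nb_sum e W x + e\<^sup>2 * h x"
        "(2 * real CARD('n) + A * e\<^sup>2) * W (x + z) = nb_sum e W (x + z) + e\<^sup>2 * h (x + z)"
        using W x xz by (auto simp: disc_sol_def)
      then have "(2 * real CARD('n) + A * e\<^sup>2) * (W (x + z) - W x - c)
         = nb_sum e (\<lambda>y. W (y + z) - W y - c) x + e\<^sup>2 * (h (x + z) - h x) - A * e\<^sup>2 * c"
        unfolding nb_sum_diff nb_sum_shift by (simp add: algebra_simps)
      moreover have "e\<^sup>2 * (h (x + z) - h x) \<le> e\<^sup>2 * d" by (rule mult_left_mono[OF hz]) simp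
      moreover have "d \<le> A * c" using c A by (simp add: field_simps)
      then have "e\<^sup>2 * d \<le> e\<^sup>2 * (A * c)" by (rule mult_left_mono) simp
      ultimately show "(2 * real CARD('n) + A * e\<^sup>2) * (W (x + z) - W x - c) \<le> nb_sum e (\<lambda>y. W (y + z) - W y - c) x"
        by (simp add: algebra_simps)
    qed
    then show ?thesis by (simp add: c_def)
  qed
  have h1: "h (x + z) - h x \<le> d" "h (x + - z) - h x \<le> d" for x
    using hz[of x] hz[of "x - z"] by auto
  show ?thesis using *[of z x, OF h1(1)] *[of "- z" "x + z", OF h1(2)] by simp
qed

section \<open>Symmetry of the discrete Laplacian and compactness of discrete solutions\<close>

lemma lborel_integral_translate:
  fixes f :: "real^'n \<Rightarrow> real"
  assumes "f \<in> borel_measurable borel"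
  shows "(\<integral>x. f (x + c) \<partial>lborel) = (\<integral>x. f x \<partial>lborel)"
proof -
  have "(\<integral>x. f x \<partial>lborel) = (\<integral>x. f x \<partial>distr lborel borel ((+) c))"
    by (simp add: lborel_distr_plus)
  also have "\<dots> = (\<integral>x. f (c + x) \<partial>lborel)"
    using assms by (subst integral_distr) auto
  finally show ?thesis by (simp add: add.commute)
qed

lemma integrable_indicator_cball: "integrable lborel (indicator (cball (0::real^'n) R) :: _ \<Rightarrow> real)"
  using borel_integrable_compact[of "cball (0::real^'n) R" "\<lambda>_. 1::real"] by simp

lemma integrable_cmult_indicator_cball:
  "integrable lborel (\<lambda>x. c * indicator (cball (0::real^'n) R) x :: real)"
  using Bochner_Integration.integrable_mult_right[OF integrable_indicator_cball, of c] .

lemma integrable_bounded_support: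
  fixes f :: "real^'n \<Rightarrow> real"
  assumes [measurable]: "f \<in> borel_measurable borel" and B: "\<And>x. \<bar>f x\<bar> \<le> B"
    and supp: "\<And>x. x \<notin> cball 0 R \<Longrightarrow> f x = 0"
  shows "integrable lborel f"
proof (rule Bochner_Integration.integrable_bound)
  show "integrable lborel (\<lambda>x::real^'n. B * indicator (cball 0 R) x :: real)"
    by (rule integrable_cmult_indicator_cball)
  show "AE x in lborel. norm (f x) \<le> norm (B * indicator (cball 0 R) x :: real)"
  proof (rule AE_I2)
    fix x show "norm (f x) \<le> norm (B * indicator (cball 0 R) x :: real)"
      using B[of x] supp[of x] by (cases "x \<in> cball 0 R") auto
  qed
qed simp

lemma cball_measurable [measurable]: "cball (a :: 'a::euclidean_space) r \<in> sets borel"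
  by (rule borel_closed) simp

lemma dlap_outside:
  assumes "\<And>z. z \<notin> cball x r \<Longrightarrow> f z = 0" "d > 0" "y \<notin> cball x (r + d)"
  shows "dlap d f y = 0"
proof -
  have "nb_sum d f y = nb_sum d (\<lambda>_. 0) y"
  proof (rule nb_sum_cong)
    fix z assume "dist z y = \<bar>d\<bar>"
    then have "z \<notin> cball x r" using assms(2,3) dist_triangle[of x y z] by (auto simp: dist_commute)
    then show "f z = 0" by (rule assms(1))
  qed
  moreover have "f y = 0" using assms(2,3) by (intro assms(1)) auto
  ultimately show ?thesis by (simp add: dlap_def)
qed

lemma integral_tendsto_bounded_support:
  fixes f :: "nat \<Rightarrow> real^'n \<Rightarrow> real"
  assumes f [measurable]: "\<And>k. f k \<in> borel_measurable borel" and B: "\<And>k x. \<bar>f k x\<bar> \<le> B"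
    and supp: "\<And>k x. x \<notin> cball 0 R \<Longrightarrow> f k x = 0" and lim: "\<And>x. (\<lambda>k. f k x) \<longlonglongrightarrow> g x"
  shows "(\<lambda>k. \<integral>x. f k x \<partial>lborel) \<longlonglongrightarrow> (\<integral>x. g x \<partial>lborel)"
proof (rule integral_dominated_convergence[where w = "\<lambda>x. B * indicator (cball 0 R) x"])
  show "g \<in> borel_measurable lborel" "f k \<in> borel_measurable lborel" for k
    using borel_measurable_LIMSEQ_real[of borel f g] lim f by simp_all
  show "integrable lborel (\<lambda>x::real^'n. B * indicator (cball 0 R) x :: real)"
    by (rule integrable_cmult_indicator_cball)
  show "AE x in lborel. (\<lambda>k. f k x) \<longlonglongrightarrow> g x" by (intro AE_I2 lim)
  show "AE x in lborel. norm (f k x) \<le> B * indicator (cball 0 R) x" for k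
  proof (rule AE_I2)
    fix x show "norm (f k x) \<le> B * indicator (cball 0 R) x"
      using B[of k x] supp[of x k] by (cases "x \<in> cball 0 R") auto
  qed
qed

text \<open>Translation invariance moves a shift from one factor to the other with reversed sign,
  and \<open>nb_sum\<close> contains both signs. Compact support is asked of \<open>g\<close> alone,
  so \<open>f\<close> may be a constant, as in \<open>integral_test_lap\<close>.\<close>

lemma integral_nb_sum_swap:
  fixes f g :: "real^'n \<Rightarrow> real"
  assumes f [measurable]: "f \<in> borel_measurable borel" and fB: "\<And>x. \<bar>f x\<bar> \<le> B"
    and g [measurable]: "g \<in> borel_measurable borel" and gB: "\<And>x. \<bar>g x\<bar> \<le> B'"
    and supp: "\<And>x. x \<notin> cball 0 R \<Longrightarrow> g x = 0"
  shows "(\<integral>x. g x * nb_sum e f x \<partial>lborel) = (\<integral>x. f x * nb_sum e g x \<partial>lborel)"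
proof -
  have B: "0 \<le> B" using fB[of 0] by linarith
  have int: "integrable lborel (\<lambda>x. g (x + a) * f (x + b))" for a b
  proof (rule integrable_bounded_support[where B = "B' * B" and R = "R + norm a"])
    show "\<bar>g (x + a) * f (x + b)\<bar> \<le> B' * B" for x
      unfolding abs_mult by (intro mult_mono fB gB) (use gB[of 0] in linarith, simp)
    fix x :: "real^'n" assume "x \<notin> cball 0 (R + norm a)"
    then have "x + a \<notin> cball 0 R" using norm_triangle_ineq4[of "x + a" a] by auto
    then show "g (x + a) * f (x + b) = 0" by (simp add: supp)
  qed measurable
  have tr: "(\<integral>x. g x * f (x + c) \<partial>lborel) = (\<integral>x. f x * g (x - c) \<partial>lborel)" for c
    using lborel_integral_translate[of "\<lambda>x. g (x - c) * f x" c] by (simp add: mult.commute)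
  have tr': "(\<integral>x. g x * f (x - c) \<partial>lborel) = (\<integral>x. f x * g (x + c) \<partial>lborel)" for c
    using tr[of "- c"] by simp
  have int': "integrable lborel (\<lambda>x. g x * f (x + b))" "integrable lborel (\<lambda>x. g x * f (x - b))"
    "integrable lborel (\<lambda>x. f x * g (x + b))" "integrable lborel (\<lambda>x. f x * g (x - b))" for b
    using int[of 0 b] int[of 0 "- b"] int[of b 0] int[of "- b" 0] by (simp_all add: mult.commute)
  have "(\<integral>x. g x * nb_sum e f x \<partial>lborel) =
     (\<Sum>i\<in>UNIV. (\<integral>x. g x * f (x + e *\<^sub>R axis i 1) \<partial>lborel) + (\<integral>x. g x * f (x - e *\<^sub>R axis i 1) \<partial>lborel))"
    unfolding nb_sum_def sum_distrib_left distrib_left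
    by (subst Bochner_Integration.integral_sum) (auto intro!: int' sum.cong Bochner_Integration.integral_add)
  also have "\<dots> = (\<Sum>i\<in>UNIV. (\<integral>x. f x * g (x + e *\<^sub>R axis i 1) \<partial>lborel) + (\<integral>x. f x * g (x - e *\<^sub>R axis i 1) \<partial>lborel))"
    by (simp only: tr tr' add.commute)
  also have "\<dots> = (\<integral>x. f x * nb_sum e g x \<partial>lborel)"
    unfolding nb_sum_def sum_distrib_left distrib_left
    by (subst Bochner_Integration.integral_sum) (auto intro!: int' sum.cong Bochner_Integration.integral_add[symmetric])
  finally show ?thesis .
qed

lemma integral_dlap_swap:
  fixes f g :: "real^'n \<Rightarrow> real"
  assumes f [measurable]: "f \<in> borel_measurable borel" and fB: "\<And>x. \<bar>f x\<bar> \<le> B"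
    and g [measurable]: "g \<in> borel_measurable borel" and gB: "\<And>x. \<bar>g x\<bar> \<le> B'"
    and supp: "\<And>x. x \<notin> cball 0 R \<Longrightarrow> g x = 0"
  shows "(\<integral>x. g x * dlap e f x \<partial>lborel) = (\<integral>x. f x * dlap e g x \<partial>lborel)"
proof -
  have nb: "\<bar>nb_sum e u x\<bar> \<le> 2 * real CARD('n) * C" if "\<And>x. \<bar>u x\<bar> \<le> C" for u :: "real^'n \<Rightarrow> real" and C x
  proof -
    have u: "u y \<le> C" "- C \<le> u y" for y using that[of y] by auto
    have "nb_sum e u x \<le> nb_sum e (\<lambda>_. C) x" by (rule nb_sum_mono) (rule u)
    moreover have "nb_sum e (\<lambda>_. - C) x \<le> nb_sum e u x" by (rule nb_sum_mono) (rule u)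
    ultimately
 show ?thesis by simp
  qed
  have B: "0 \<le> B" "0 \<le> B'" using fB[of 0] gB[of 0] by linarith+
  have i1: "integrable lborel (\<lambda>x. g x * nb_sum e f x)"
  proof (rule integrable_bounded_support[where B = "B' * (2 * real CARD('n) * B)" and R = R])
    show "\<bar>g x * nb_sum e f x\<bar> \<le> B' * (2 * real CARD('n) * B)" for x
      unfolding abs_mult by (intro mult_mono gB nb fB) (use B in auto)
  qed (use supp in auto)
  have i2: "integrable lborel (\<lambda>x. f x * nb_sum e g x)"
  proof (rule integrable_bounded_support[where B = "B * (2 * real CARD('n) * B')" and R = "R + \<bar>e\<bar>"])
    show "\<bar>f x * nb_sum e g x\<bar> \<le> B * (2 * real CARD('n) * B')" for x
      unfolding abs_mult by (intro mult_mono gB nb fB) (use B in auto)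
    fix x :: "real^'n" assume x: "x \<notin> cball 0 (R + \<bar>e\<bar>)"
    have "nb_sum e g x = nb_sum e (\<lambda>_. 0) x"
    proof (rule nb_sum_cong)
      fix y assume "dist y x = \<bar>e\<bar>"
      then have "y \<notin> cball 0 R" using x norm_triangle_ineq4[of y "y - x"] by (auto simp: dist_norm)
      then show "g y = 0" by (rule supp)
    qed
    then show "f x * nb_sum e g x = 0" by simp
  qed measurable
  have i3: "integrable lborel (\<lambda>x. g x * f x)"
  proof (rule integrable_bounded_support[where B = "B' * B" and R = R])
    show "\<bar>g x * f x\<bar> \<le> B' * B" for x
      unfolding abs_mult by (intro mult_mono gB fB) (use B in auto)
  qed (use supp in auto)
  have "(\<integral>x. g x * dlap e f x \<partial>lborel) = (\<integral>x. (g x * nb_sum e f x - 2 * real CARD('n) * (g x * f x)) / e\<^sup>2 \<partial>lborel)"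
    by (intro Bochner_Integration.integral_cong refl) (simp add: dlap_def algebra_simps)
  also have "\<dots> = ((\<integral>x. g x * nb_sum e f x \<partial>lborel) - 2 * real CARD('n) * (\<integral>x. g x * f x \<partial>lborel)) / e\<^sup>2"
    using i1 i3 by simp
  also have "\<dots> = ((\<integral>x. f x * nb_sum e g x \<partial>lborel) - 2 * real CARD('n) * (\<integral>x. g x * f x \<partial>lborel)) / e\<^sup>2"
    using integral_nb_sum_swap[OF f fB g gB supp] by simp
  also have "\<dots> = (\<integral>x. (f x * nb_sum e g x - 2 * real CARD('n) * (g x * f x)) / e\<^sup>2 \<partial>lborel)"
    using i2 i3 by simp
  also have "\<dots> = (\<integral>x. f x * dlap e g x \<partial>lborel)"
    by (intro Bochner_Integration.integral_cong refl) (simp add: dlap_def algebra_simps)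
  finally show ?thesis .
qed

text \<open>A subsequence converges on a countable dense set. At any other point
  \<open>disc_sol_translate\<close> compares the values with those at a nearby dense point, up to an
  error that becomes small with the step size, so the values form a Cauchy sequence.\<close>

lemma disc_sol_convergent_subseq:
  fixes \<Omega> :: "(real^'n) set"
  assumes A: "A > 0" and e: "\<And>j. 0 < e j" "\<And>j. e j \<le> 1" and e0: "e \<longlonglongrightarrow> 0"
    and W: "\<And>j. disc_sol \<Omega> A (e j) h (W j)"
    and h0: "\<And>x. 0 \<le> h x" and h: "\<And>x. h x \<le> M" and uc: "uniformly_continuous_on UNIV h"
    and conv: "convex \<Omega>" and R: "\<Omega> \<subseteq> cball 0 R" "R \<ge> 1"
  obtains r w where "strict_mono (r :: nat \<Rightarrow> nat)" "\<And>x. (\<lambda>j. W (r j) x) \<longlonglongrightarrow> w x"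
proof -
  have M: "0 \<le> M" using h0 h order_trans by blast
  obtain D :: "(real^'n) set" where D: "countable D" "\<And>X. open X \<Longrightarrow> X \<noteq> {} \<Longrightarrow> \<exists>d\<in>D. d \<in> X"
    using countable_dense_setE by blast
  have "norm (W j x) \<le> M / A" for j x
    using disc_sol_nonneg[OF A e(1) W h0] disc_sol_le_const[OF A e(1) W h M] by simp
  then obtain r where r: "strict_mono (r :: nat \<Rightarrow> nat)" and rD: "\<And>x. x \<in> D \<Longrightarrow> \<exists>l. (\<lambda>n. W (r n) x) \<longlonglongrightarrow> l"
    using function_convergent_subsequence[OF D(1), of W "M / A"] by metis
  have "Cauchy (\<lambda>j. W (r j) x)" for x
  proof (rule metric_CauchyI)
    fix \<eta> :: real assume \<eta>: "\<eta> > 0"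
    define C where "C = M * (2 * R + 1) + 1"
    have C: "C > 0" using M R by (simp add: C_def add_nonneg_pos)
    obtain d where d: "d > 0" "\<And>x y. dist x y < d \<Longrightarrow> dist (h x) (h y) < \<eta> * A / 16"
      using uc[unfolded uniformly_continuous_on_def, rule_format, of "\<eta> * A / 16"] \<eta> A
      by (auto simp: dist_commute)
    \<comment> \<open>With \<open>norm z\<close> and, for large \<open>j\<close>, the step size
      below \<open>\<eta> / (16 * C)\<close>, the two errors in \<open>close\<close> are at most
      \<open>\<eta> / 8\<close> and \<open>\<eta> / 16\<close>.\<close>
    define d' where "d' = min d (\<eta> / (16 * C))"
    have d': "d' > 0" using d \<eta> C by (simp add: d'_def)
    obtain y where y: "y \<in> D" "y \<in> ball x d'" using D(2)[of "ball x d'"] d' by auto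
    define z where "z = y - x"
    have z: "norm z < d" "norm z < \<eta> / (16 * C)"
      using y by (auto simp: z_def d'_def dist_norm norm_minus_commute)
    have "(\<lambda>j. e (r j)) \<longlonglongrightarrow> 0" using LIMSEQ_subseq_LIMSEQ[OF e0 r] by (simp add: o_def)
    then have "\<forall>\<^sub>F j in sequentially. e (r j) < \<eta> / (16 * C)"
      using \<eta> C by (intro order_tendstoD) auto
    then obtain N1 where N1: "\<And>j. j \<ge> N1 \<Longrightarrow> e (r j) < \<eta> / (16 * C)"
      by (auto simp: eventually_sequentially)
    have close: "\<bar>W (r j) y - W (r j) x\<bar> < \<eta> / 4" if "j \<ge> N1" for j
    proof -
      have "\<bar>W (r j) (x + z) - W (r j) x\<bar> \<le> M * (2 * R + 1) * (norm z + e (r j)) + (\<eta> * A / 16) / A"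
      proof (rule disc_sol_translate[OF A e W h0 h M conv R])
        fix x
        have "dist (x + z) x < d" using z by (simp add: dist_norm)
        then show "\<bar>h (x + z) - h x\<bar> \<le> \<eta> * A / 16" using d(2)[of "x + z" x] by (simp add: dist_real_def)
      qed
      also have "M * (2 * R + 1) * (norm z + e (r j)) \<le> C * (\<eta> / (16 * C) + \<eta> / (16 * C))"
        using z N1[OF that] C M R e(1)[of "r j"] by (intro mult_mono add_mono) (auto simp: C_def)
      also have "C * (\<eta> / (16 * C) + \<eta> / (16 * C)) = \<eta> / 8" using C by (simp add: field_simps)
      finally show ?thesis using A \<eta> by (simp add: z_def)
    qed
    obtain l where "(\<lambda>n. W (r n) y) \<longlonglongrightarrow> l" using rD[OF y(1)] by blast
    then have "Cauchy (\<lambda>n. W (r n) y)" by (rule LIMSEQ_imp_Cauchy)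
    then obtain N2 where N2: "\<And>m n. m \<ge> N2 \<Longrightarrow> n \<ge> N2 \<Longrightarrow> dist (W (r m) y) (W (r n) y) < \<eta> / 4"
      using metric_CauchyD[of "\<lambda>n. W (r n) y" "\<eta> / 4"] \<eta> by auto
    show "\<exists>N. \<forall>m\<ge>N. \<forall>n\<ge>N. dist (W (r m) x) (W (r n) x) < \<eta>"
    proof (intro exI[of _ "max N1 N2"] allI impI)
      fix m n assume mn: "m \<ge> max N1 N2" "n \<ge> max N1 N2"
      then show "dist (W (r m) x) (W (r n) x) < \<eta>"
        using close[of m] close[of n] N2[of m n] \<eta> dist_triangle[of "W (r m) x" "W (r n) x" "W (r m) y"]
          dist_triangle[of "W (r m) y" "W (r n) x" "W (r n) y"] dist_commute[of "W (r m) x" "W (r m) y"]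
        by (simp add: dist_real_def)
    qed
  qed
  then have "\<exists>l. (\<lambda>j. W (r j) x) \<longlonglongrightarrow> l" for x
    using Cauchy_convergent convergent_def by blast
  then obtain w where "\<And>x. (\<lambda>j. W (r j) x) \<longlonglongrightarrow> w x" by metis
  then show ?thesis using that r by blast
qed

section \<open>Limits of discrete solutions\<close>

locale discrete_limit =
  fixes \<Omega> :: "(real^'n) set" and A M R :: real and e :: "nat \<Rightarrow> real" and h w :: "real^'n \<Rightarrow> real"
    and W :: "nat \<Rightarrow> real^'n \<Rightarrow> real"
  assumes A: "A > 0" and e: "\<And>j. 0 < e j" "\<And>j. e j \<le> 1" and e0: "e \<longlonglongrightarrow> 0"
    and W: "\<And>j. disc_sol \<Omega> A (e j) h (W j)"
    and h0: "\<And>x. 0 \<le> h x" and h: "\<And>x. h x \<le> M" and uc: "uniformly_continuous_on UNIV h"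
    and conv: "convex \<Omega>" and R: "\<Omega> \<subseteq> cball 0 R" "R \<ge> 1"
    and lim: "\<And>x. (\<lambda>j. W j x) \<longlonglongrightarrow> w x"
begin

lemma M_nonneg: "0 \<le> M" using h0 h order_trans by blast

lemma W_nonneg: "0 \<le> W j x"
  by (rule disc_sol_nonneg[OF A e(1) W h0])

lemma W_le: "W j x \<le> M / A"
  by (rule disc_sol_le_const[OF A e(1) W h M_nonneg])

lemma lim_nonneg: "0 \<le> w x"
  by (rule LIMSEQ_le_const[OF lim]) (simp add: W_nonneg)

lemma lim_outside: "x \<notin> \<Omega> \<Longrightarrow> w x = 0"
proof -
  assume "x \<notin> \<Omega>"
  then have "W j x = 0" for j using W[of j] by (auto simp: disc_sol_def)
  then show ?thesis using lim[of x] by (simp add: LIMSEQ_const_iff)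
qed

lemma lim_boundary:
  assumes xy: "x \<in> \<Omega>" "y \<notin> \<Omega>"
  shows "w x \<le> M * (2 * R + 1) * norm (y - x)"
proof (rule LIMSEQ_le[OF lim])
  show "(\<lambda>j. M * (2 * R + 1) * (norm (y - x) + e j)) \<longlonglongrightarrow> M * (2 * R + 1) * norm (y - x)"
    using e0 by (auto intro!: tendsto_eq_intros)
  show "\<exists>N. \<forall>n\<ge>N. W n x \<le> M * (2 * R + 1) * (norm (y - x) + e n)"
    using disc_sol_boundary[OF A e W h M_nonneg conv R xy] by blast
qed

text \<open>The translation estimate survives the limit while its term in \<open>e j\<close>
  vanishes: the limit is uniformly continuous although the approximants may jump.\<close>

lemma lim_continuous: "continuous_on UNIV w"
proof (rule uniformly_continuous_imp_continuous, unfold uniformly_continuous_on_def, intro allI impI)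
  fix \<eta> :: real assume \<eta>: "\<eta> > 0"
  define C where "C = M * (2 * R + 1) + 1"
  have C: "C > 0" using M_nonneg R by (simp add: C_def add_nonneg_pos)
  obtain d where d: "d > 0" "\<And>x y. dist x y < d \<Longrightarrow> dist (h x) (h y) < \<eta> * A / 4"
    using uc[unfolded uniformly_continuous_on_def, rule_format, of "\<eta> * A / 4"] \<eta> A
    by (auto simp: dist_commute)
  have "dist (w x') (w x) < \<eta>" if xx: "dist x' x < min d (\<eta> / (4 * C))" for x x'
  proof -
    define z where "z = x' - x"
    have z: "norm z < d" "norm z < \<eta> / (4 * C)" using xx by (auto simp: z_def dist_norm)
    have "\<bar>w x' - w x\<bar> \<le> M * (2 * R + 1) * norm z + \<eta> / 4"
    proof (rule LIMSEQ_le)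
      show "(\<lambda>j. \<bar>W j x' - W j x\<bar>) \<longlonglongrightarrow> \<bar>w x' - w x\<bar>" by (intro tendsto_intros lim)
      show "(\<lambda>j. M * (2 * R + 1) * (norm z + e j) + \<eta> / 4) \<longlonglongrightarrow> M * (2 * R + 1) * norm z + \<eta> / 4"
        using e0 by (auto intro!: tendsto_eq_intros)
      have "\<bar>W j (x + z) - W j x\<bar> \<le> M * (2 * R + 1) * (norm z + e j) + (\<eta> * A / 4) / A" for j
      proof (rule disc_sol_translate[OF A e W h0 h M_nonneg conv R])
        fix x
        have "dist (x + z) x < d" using z by (simp add: dist_norm)
        then show "\<bar>h (x + z) - h x\<bar> \<le> \<eta> * A / 4" using d(2)[of "x + z" x] by (simp add: dist_real_def)
      qed
      then show "\<exists>N. \<forall>j\<ge>N. \<bar>W j x' - W j x\<bar> \<le> M * (2 * R + 1) * (norm z + e j) + \<eta> / 4"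
        using A by (simp add: z_def)
    qed
    also have "M * (2 * R + 1) * norm z \<le> C * (\<eta> / (4 * C))"
      using z C M_nonneg R by (intro mult_mono) (auto simp: C_def)
    also have "C * (\<eta> / (4 * C)) = \<eta> / 4" using C by simp
    finally show ?thesis using \<eta> by (simp add: dist_real_def)
  qed
  then show "\<exists>d>0. \<forall>x\<in>UNIV. \<forall>x'\<in>UNIV. dist x' x < d \<longrightarrow> dist (w x') (w x) < \<eta>"
    using d(1) \<eta> C by (intro exI[of _ "min d (\<eta> / (4 * C))"]) auto
qed

text \<open>Since \<open>\<phi>\<close> vanishes outside \<Omega>, the discrete equation is used
  only where it holds. Giving the Laplacian \<open>\<psi>\<close> of the test function as a bounded
  limit of \<open>dlap\<close> reduces the proof to the symmetry of \<open>dlap\<close> and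
  dominated convergence.\<close>

lemma lim_weak:
  assumes \<phi> [measurable]: "\<phi> \<in> borel_measurable borel" and \<phi>0: "\<And>x. x \<notin> \<Omega> \<Longrightarrow> \<phi> x = 0"
    and \<phi>B: "\<And>x. \<bar>\<phi> x\<bar> \<le> B" and dB: "\<And>x j. \<bar>dlap (e j) \<phi> x\<bar> \<le> B"
    and dlim: "\<And>x. (\<lambda>j. dlap (e j) \<phi> x) \<longlonglongrightarrow> \<psi> x"
  shows "(\<integral>x. w x * \<psi> x \<partial>lborel) = (\<integral>x. (A * w x - h x) * \<phi> x \<partial>lborel)"
proof -
  have [measurable]: "w \<in> borel_measurable borel"
    using lim_continuous by (rule borel_measurable_continuous_onI)
  have [measurable]: "h \<in> borel_measurable borel"
    using uniformly_continuous_imp_continuous[OF uc] by (rule borel_measurable_continuous_onI)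
  have [measurable]: "W j \<in> borel_measurable borel" for j using W[of j] by (simp add: disc_sol_def)
  note M = M_nonneg
  have supp: "\<phi> x = 0" if "x \<notin> cball 0 R" for x using \<phi>0 R that by blast
  have [measurable]: "dlap (e j) \<phi> \<in> borel_measurable borel" for j
    unfolding dlap_def[abs_def] by measurable
  have B: "0 \<le> B" using \<phi>B[of 0] by linarith
  have dsupp: "dlap (e j) \<phi> x = 0" if "x \<notin> cball 0 (R + 1)" for x j
    by (rule dlap_outside[where x = 0 and r = R, OF supp e(1)]) (use that e(2)[of j] in auto)
  have WB: "\<bar>W j x\<bar> \<le> M / A" for j x using W_nonneg W_le by simp
  define I where "I = (\<integral>x. h x * \<phi> x \<partial>lborel)"
  have ih: "integrable lborel (\<lambda>x. h x * \<phi> x)"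
  proof (rule integrable_bounded_support[where B = "M * B" and R = R])
    show "\<bar>h x * \<phi> x\<bar> \<le> M * B" for x unfolding abs_mult
      by (intro mult_mono \<phi>B) (use h0 h M in auto)
  qed (use supp in auto)
  have iW: "integrable lborel (\<lambda>x. W j x * \<phi> x)" for j
  proof (rule integrable_bounded_support[where B = "M / A * B" and R = R])
    show "\<bar>W j x * \<phi> x\<bar> \<le> M / A * B" for x unfolding abs_mult
      by (intro mult_mono \<phi>B WB) (use M A in auto)
  qed (use supp in auto)
  have eq: "(\<integral>x. W j x * dlap (e j) \<phi> x \<partial>lborel) = A * (\<integral>x. W j x * \<phi> x \<partial>lborel) - I" for j
  proof -
    have "\<phi> x * dlap (e j) (W j) x = A * (W j x * \<phi> x) - h x * \<phi> x" for x
    proof (cases "x \<in> \<Omega>")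
      case True
      then have "(2 * real CARD('n) + A * (e j)\<^sup>2) * W j x = nb_sum (e j) (W j) x + (e j)\<^sup>2 * h x"
        using W[of j] by (auto simp: disc_sol_def)
      then have "nb_sum (e j) (W j) x - 2 * real CARD('n) * W j x = (e j)\<^sup>2 * (A * W j x - h x)"
        by (simp add: algebra_simps)
      then have "dlap (e j) (W j) x = A * W j x - h x" using e(1)[of j] by (simp add: dlap_def)
      then show ?thesis by (simp only:) (simp add: algebra_simps)
    qed (simp add: \<phi>0)
    then have "(\<integral>x. \<phi> x * dlap (e j) (W j) x \<partial>lborel) = A * (\<integral>x. W j x * \<phi> x \<partial>lborel) - I"
      using iW ih by (simp add: I_def)
    then show ?thesis
      using integral_dlap_swap[where f = "W j" and e = "e j", OF _ WB \<phi> \<phi>B supp] by simp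
  qed
  have bnd: "\<bar>w x\<bar> \<le> M / A" for x
    by (rule LIMSEQ_le_const2[OF tendsto_rabs[OF lim]]) (simp add: WB)
  have iw: "integrable lborel (\<lambda>x. w x * \<phi> x)"
  proof (rule integrable_bounded_support[where B = "M / A * B" and R = R])
    show "\<bar>w x * \<phi> x\<bar> \<le> M / A * B" for x unfolding abs_mult
      by (intro mult_mono \<phi>B bnd) (use M A in auto)
  qed (use supp in auto)
  have "(\<lambda>j. \<integral>x. W j x * dlap (e j) \<phi> x \<partial>lborel) \<longlonglongrightarrow> (\<integral>x. w x * \<psi> x \<partial>lborel)"
  proof (rule integral_tendsto_bounded_support[where B = "M / A * B" and R = "R + 1"])
    show "\<bar>W j x * dlap (e j) \<phi> x\<bar> \<le> M / A * B" for j x unfolding abs_mult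
      by (intro mult_mono WB dB) (use M A in auto)
    show "(\<lambda>j. W j x * dlap (e j) \<phi> x) \<longlonglongrightarrow> w x * \<psi> x" for x by (intro tendsto_mult lim dlim)
  qed (use dsupp in auto)
  moreover have "(\<lambda>j. \<integral>x. W j x * \<phi> x \<partial>lborel) \<longlonglongrightarrow> (\<integral>x. w x * \<phi> x \<partial>lborel)"
  proof (rule integral_tendsto_bounded_support[where B = "M / A * B" and R = R])
    show "\<bar>W j x * \<phi> x\<bar> \<le> M / A * B" for j x unfolding abs_mult
      by (intro mult_mono WB \<phi>B) (use M A in auto)
    show "(\<lambda>j. W j x * \<phi> x) \<longlonglongrightarrow> w x * \<phi> x" for x by (intro tendsto_mult lim tendsto_const)
  qed (use supp in auto)
  then have "(\<lambda>j. A * (\<integral>x. W j x * \<phi> x \<partial>lborel) - I) \<longlonglongrightarrow> A * (\<integral>x. w x * \<phi> x \<partial>lborel) - I"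
    by (intro tendsto_intros)
  ultimately have "(\<integral>x. w x * \<psi> x \<partial>lborel) = A * (\<integral>x. w x * \<phi> x \<partial>lborel) - I"
    unfolding eq by (rule LIMSEQ_unique)
  also have "\<dots> = (\<integral>x. A * (w x * \<phi> x) - h x * \<phi> x \<partial>lborel)"
    using iw ih by (simp add: I_def)
  finally show "(\<integral>x. w x * \<psi> x \<partial>lborel) = (\<integral>x. (A * w x - h x) * \<phi> x \<partial>lborel)"
    by (simp add: algebra_simps)
qed

end

section \<open>Second differences of radial functions\<close>

text \<open>Taylor's formula with Lagrange remainder at \<open>d\<close> and at \<open>- d\<close>:
  the first order terms cancel, and each remainder keeps its own intermediate point.\<close>

lemma second_difference:
  fixes g g' g'' :: "real \<Rightarrow> real"
  assumes d: "d > 0"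
    and g: "\<And>t. \<bar>t\<bar> \<le> d \<Longrightarrow> (g has_real_derivative g' t) (at t)"
    and g': "\<And>t. \<bar>t\<bar> \<le> d \<Longrightarrow> (g' has_real_derivative g'' t) (at t)"
  obtains \<xi> \<eta> where "\<bar>\<xi>\<bar> \<le> d" "\<bar>\<eta>\<bar> \<le> d" "g d + g (- d) - 2 * g 0 = d\<^sup>2 / 2 * (g'' \<xi> + g'' \<eta>)"
proof -
  define D where "D m = (if m = (0::nat) then g else if m = 1 then g' else g'')" for m
  have D: "\<forall>m t. m < 2 \<and> - d \<le> t \<and> t \<le> d \<longrightarrow> (D m has_real_derivative D (Suc m) t) (at t)"
    using g g' by (auto simp: D_def abs_le_iff less_2_cases_iff)
  have *: "\<exists>\<xi>. \<bar>\<xi>\<bar> \<le> d \<and> g x = g 0 + g' 0 * x + g'' \<xi> / 2 * x\<^sup>2" if x: "x = d \<or> x = - d" for x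
  proof -
    have "\<exists>t. (if x < 0 then x < t \<and> t < 0 else 0 < t \<and> t < x) \<and>
        g x = (\<Sum>m<2. D m 0 / fact m * (x - 0) ^ m) + D 2 t / fact 2 * (x - 0)\<^sup>2"
      by (rule Taylor[of 2 D g "- d" d 0 x]) (use D x d in \<open>auto simp: D_def\<close>)
    then obtain t where t: "if x < 0 then x < t \<and> t < 0 else 0 < t \<and> t < x"
      "g x = g 0 + g' 0 * x + g'' t / 2 * x\<^sup>2"
      by (auto simp: D_def numeral_2_eq_2)
    have "\<bar>t\<bar> \<le> d" using t(1) x d by (auto split: if_splits)
    then show ?thesis using t(2) by blast
  qed
  obtain \<xi> where \<xi>: "\<bar>\<xi>\<bar> \<le> d" "g d = g 0 + g' 0 * d + g'' \<xi> / 2 * d\<^sup>2" using *[of d] by blast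
  obtain \<eta> where \<eta>: "\<bar>\<eta>\<bar> \<le> d" "g (- d) = g 0 + g' 0 * (- d) + g'' \<eta> / 2 * (- d)\<^sup>2" using *[of "- d"] by blast
  show ?thesis using that[OF \<xi>(1) \<eta>(1)] \<xi>(2) \<eta>(2) by (simp add: field_simps)
qed

text \<open>\<open>D i\<close> is the second derivative along axis \<open>i\<close>. Each second
  difference is a mean of two values of \<open>D i\<close> within distance \<open>d\<close>, so the
  error per axis is the oscillation \<open>\<eta>\<close>. A small \<open>\<eta>\<close> gives
  convergence, a crude one gives bounds for all step sizes.\<close>

lemma dlap_approx:
  fixes f :: "real^'n \<Rightarrow> real" and G D :: "'n \<Rightarrow> real^'n \<Rightarrow> real"
  assumes d: "d > 0"
    and G: "\<And>i t. \<bar>t\<bar> \<le> d \<Longrightarrow> ((\<lambda>t. f (x + t *\<^sub>R axis i 1)) has_real_derivative G i (x + t *\<^sub>R axis i 1)) (at t)"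
    and D: "\<And>i t. \<bar>t\<bar> \<le> d \<Longrightarrow> ((\<lambda>t. G i (x + t *\<^sub>R axis i 1)) has_real_derivative D i (x + t *\<^sub>R axis i 1)) (at t)"
    and close: "\<And>i y. dist y x \<le> d \<Longrightarrow> \<bar>D i y - D i x\<bar> \<le> \<eta>"
  shows "\<bar>dlap d f x - (\<Sum>i\<in>UNIV. D i x)\<bar> \<le> real CARD('n) * \<eta>"
proof -
  have mid: "\<bar>q - c\<bar> \<le> \<eta>" if "q = (a + b) / 2" "\<bar>a - c\<bar> \<le> \<eta>" "\<bar>b - c\<bar> \<le> \<eta>" for q a b c :: real
    using that(2,3) unfolding that(1) by (simp add: abs_le_iff field_simps)
  have *: "\<bar>(f (x + d *\<^sub>R axis i 1) + f (x - d *\<^sub>R axis i 1) - 2 * f x) / d\<^sup>2 - D i x\<bar> \<le> \<eta>" for i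
  proof -
    obtain \<xi> \<zeta> where \<xi>: "\<bar>\<xi>\<bar> \<le> d" "\<bar>\<zeta>\<bar> \<le> d" and eq: "f (x + d *\<^sub>R axis i 1) + f (x + (- d) *\<^sub>R axis i 1) - 2 * f (x + 0 *\<^sub>R axis i 1) =
        d\<^sup>2 / 2 * (D i (x + \<xi> *\<^sub>R axis i 1) + D i (x + \<zeta> *\<^sub>R axis i 1))"
      by (rule second_difference[OF d, of "\<lambda>t. f (x + t *\<^sub>R axis i 1)" "\<lambda>t. G i (x + t *\<^sub>R axis i 1)"
          "\<lambda>t. D i (x + t *\<^sub>R axis i 1)"]) (use G D in auto)
    have "(f (x + d *\<^sub>R axis i 1) + f (x - d *\<^sub>R axis i 1) - 2 * f x) / d\<^sup>2 =
        (D i (x + \<xi> *\<^sub>R axis i 1) + D i (x + \<zeta> *\<^sub>R axis i 1)) / 2"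
      using eq d by (simp add: field_simps)
    moreover have "\<bar>D i (x + \<xi> *\<^sub>R axis i 1) - D i x\<bar> \<le> \<eta>" "\<bar>D i (x + \<zeta> *\<^sub>R axis i 1) - D i x\<bar> \<le> \<eta>"
      using \<xi> by (intro close; simp add: dist_norm)+
    ultimately show ?thesis by (rule mid)
  qed
  have "dlap d f x = (\<Sum>i\<in>UNIV. (f (x + d *\<^sub>R axis i 1) + f (x - d *\<^sub>R axis i 1) - 2 * f x) / d\<^sup>2)"
    unfolding dlap_def nb_sum_def by (simp add: sum_subtractf sum_divide_distrib[symmetric])
  then have "dlap d f x - (\<Sum>i\<in>UNIV. D i x) =
      (\<Sum>i\<in>UNIV. (f (x + d *\<^sub>R axis i 1) + f (x - d *\<^sub>R axis i 1) - 2 * f x) / d\<^sup>2 - D i x)"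
    by (simp add: sum_subtractf)
  also have "\<bar>\<dots>\<bar> \<le> (\<Sum>i\<in>(UNIV::'n set). \<eta>)"
    by (rule order_trans[OF sum_abs sum_mono]) (rule *)
  finally show ?thesis by simp
qed

lemma dlap_tendsto:
  fixes f :: "real^'n \<Rightarrow> real" and G D :: "'n \<Rightarrow> real^'n \<Rightarrow> real"
  assumes d: "d > 0" and e: "\<And>j. e j > 0" and e0: "e \<longlonglongrightarrow> 0"
    and G: "\<And>i t. \<bar>t\<bar> \<le> d \<Longrightarrow> ((\<lambda>t. f (x + t *\<^sub>R axis i 1)) has_real_derivative G i (x + t *\<^sub>R axis i 1)) (at t)"
    and D: "\<And>i t. \<bar>t\<bar> \<le> d \<Longrightarrow> ((\<lambda>t. G i (x + t *\<^sub>R axis i 1)) has_real_derivative D i (x + t *\<^sub>R axis i 1)) (at t)"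
    and cont: "\<And>i. isCont (D i) x"
  shows "(\<lambda>j. dlap (e j) f x) \<longlonglongrightarrow> (\<Sum>i\<in>UNIV. D i x)"
proof (rule LIMSEQ_I)
  fix r :: real assume r: "r > 0"
  define \<eta> where "\<eta> = r / (2 * real CARD('n))"
  have \<eta>: "\<eta> > 0" using r by (simp add: \<eta>_def)
  have "\<forall>\<^sub>F y in nhds x. \<forall>i\<in>UNIV. \<bar>D i y - D i x\<bar> < \<eta>"
  proof (rule eventually_ball_finite, simp, rule ballI)
    fix i
    have "(D i \<longlongrightarrow> D i x) (nhds x)" using cont[of i] by (simp add: isCont_def tendsto_at_iff_tendsto_nhds)
    then show "\<forall>\<^sub>F y in nhds x. \<bar>D i y - D i x\<bar> < \<eta>"
      using \<eta> by (auto simp: tendsto_iff dist_real_def)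
  qed
  then obtain d1 where d1: "d1 > 0" "\<And>y i. dist y x < d1 \<Longrightarrow> \<bar>D i y - D i x\<bar> < \<eta>"
    by (auto simp: eventually_nhds_metric)
  have "\<forall>\<^sub>F j in sequentially. e j < min d d1" using d d1 by (intro order_tendstoD(2)[OF e0]) auto
  then obtain N where N: "\<And>j. j \<ge> N \<Longrightarrow> e j < min d d1" by (auto simp: eventually_sequentially)
  have "norm (dlap (e j) f x - (\<Sum>i\<in>UNIV. D i x)) < r" if "j \<ge> N" for j
  proof -
    have "\<bar>dlap (e j) f x - (\<Sum>i\<in>UNIV. D i x)\<bar> \<le> real CARD('n) * \<eta>"
    proof (rule dlap_approx[OF e, where G = G])
      show "\<bar>D i y - D i x\<bar> \<le> \<eta>" if "dist y x \<le> e j" for i y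
        using d1(2)[of y i] that N[OF \<open>j \<ge> N\<close>] by simp
    qed (use G D N[OF that] in auto)
    also have "\<dots> < r" using r by (simp add: \<eta>_def)
    finally show ?thesis by simp
  qed
  then show "\<exists>N. \<forall>j\<ge>N. norm (dlap (e j) f x - (\<Sum>i\<in>UNIV. D i x)) < r" by blast
qed

text \<open>As a function of \<open>(norm z)\<^sup>2 + e\<^sup>2\<close>, a profile with a
  singularity at \<open>0\<close> becomes differentiable at the origin for \<open>e > 0\<close>;
  \<open>e = 0\<close> is the singular kernel itself.\<close>

definition radial :: "(real \<Rightarrow> real) \<Rightarrow> real \<Rightarrow> real^'n \<Rightarrow> real" where
  "radial F e z = F ((norm z)\<^sup>2 + e\<^sup>2)"

lemma radial_has_derivative:
  fixes z :: "real^'n"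
  assumes e: "e > 0" and F: "\<And>s. s > 0 \<Longrightarrow> (F has_real_derivative F' s) (at s)"
  shows "(radial F e has_derivative (\<lambda>h. 2 * (z \<bullet> h) * radial F' e z)) (at z)"
proof -
  have pos: "(norm z)\<^sup>2 + e\<^sup>2 > 0" using e by (simp add: add_nonneg_pos)
  have "((\<lambda>z. z \<bullet> z + e\<^sup>2) has_derivative (\<lambda>h. 2 * (z \<bullet> h))) (at z)"
    by (auto intro!: derivative_eq_intros simp: inner_commute)
  then have "((\<lambda>z. (norm z)\<^sup>2 + e\<^sup>2) has_derivative (\<lambda>h. 2 * (z \<bullet> h))) (at z)"
    by (simp add: power2_norm_eq_inner)
  from has_derivative_compose[OF this F[OF pos, unfolded has_field_derivative_def]]
  show ?thesis unfolding radial_def by (simp add: mult_ac)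
qed

lemma radial_line_derivative:
  fixes z :: "real^'n"
  assumes e: "e > 0" and F: "\<And>s. s > 0 \<Longrightarrow> (F has_real_derivative F' s) (at s)"
  shows "((\<lambda>t. radial F e (z + t *\<^sub>R axis i 1)) has_real_derivative
    2 * (z + t *\<^sub>R axis i 1) $ i * radial F' e (z + t *\<^sub>R axis i 1)) (at t)"
proof -
  have "((\<lambda>t. z + t *\<^sub>R axis i 1) has_derivative (\<lambda>s. s *\<^sub>R axis i 1)) (at t)"
    by (auto intro!: derivative_eq_intros)
  from has_derivative_compose[OF this radial_has_derivative[OF e F]]
  have "((\<lambda>t. radial F e (z + t *\<^sub>R axis i 1)) has_derivative
     (\<lambda>s. 2 * ((z + t *\<^sub>R axis i 1) \<bullet> (s *\<^sub>R axis i 1)) * radial F' e (z + t *\<^sub>R axis i 1))) (at t)" .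
  moreover have "(\<lambda>s. 2 * ((z + t *\<^sub>R axis i 1) \<bullet> (s *\<^sub>R axis i 1)) * radial F' e (z + t *\<^sub>R axis i 1)) =
     (*) (2 * (z + t *\<^sub>R axis i 1) $ i * radial F' e (z + t *\<^sub>R axis i 1))"
    by (simp add: fun_eq_iff inner_axis)
  ultimately show ?thesis unfolding has_field_derivative_def by simp
qed

lemma radial_line_derivative2:
  fixes z :: "real^'n"
  assumes e: "e > 0" and F': "\<And>s. s > 0 \<Longrightarrow> (F' has_real_derivative F'' s) (at s)"
  shows "((\<lambda>t. 2 * (z + t *\<^sub>R axis i 1) $ i * radial F' e (z + t *\<^sub>R axis i 1)) has_real_derivative
    2 * radial F' e (z + t *\<^sub>R axis i 1) + 4 * ((z + t *\<^sub>R axis i 1) $ i)\<^sup>2 * radial F'' e (z + t *\<^sub>R axis i 1)) (at t)"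
proof -
  have d1: "((\<lambda>t. 2 * (z + t *\<^sub>R axis i 1) $ i) has_real_derivative 2) (at t)"
    by (auto intro!: derivative_eq_intros)
  have alg: "2 * a + 2 * c * b * (2 * c) = 2 * a + 4 * c\<^sup>2 * b" for a b c :: real
    by (simp add: power2_eq_square)
  have d2: "((\<lambda>t. radial F' e (z + t *\<^sub>R axis i 1)) has_real_derivative
      2 * (z + t *\<^sub>R axis i 1) $ i * radial F'' e (z + t *\<^sub>R axis i 1)) (at t)"
    by (rule radial_line_derivative[OF e F'])
  note D = DERIV_mult[OF d1 d2]
  show ?thesis
    by (rule DERIV_cong[OF D], rule alg)
qed

lemma bounded_of_compact_support:
  fixes f :: "real^'n \<Rightarrow> real"
  assumes "continuous_on UNIV f" and "\<And>z. z \<notin> cball 0 R \<Longrightarrow> f z = 0"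
  obtains B where "\<And>z. \<bar>f z\<bar> \<le> B" "B \<ge> 0"
proof -
  have "compact (f ` cball 0 R)"
    by (rule compact_continuous_image[OF continuous_on_subset[OF assms(1)]]) auto
  then have "bounded (f ` cball 0 R)" by (rule compact_imp_bounded)
  then obtain B where "\<forall>y\<in>f ` cball 0 R. norm y \<le> B" unfolding bounded_iff by blast
  then have B: "\<bar>f z\<bar> \<le> B" if "z \<in> cball 0 R" for z using that by simp
  have *: "\<bar>f z\<bar> \<le> max B 0" for z
  proof (cases "z \<in> cball 0 R")
    case True then show ?thesis using B[OF True] by simp
  next
    case False then show ?thesis using assms(2)[OF False] by simp
  qed
  show ?thesis by (rule that[OF *]) simp
qed

lemma continuous_on_radial:
  assumes e: "e > 0" and F: "\<And>s. s > 0 \<Longrightarrow> isCont F s"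
  shows "continuous_on UNIV (radial F e :: real^'n \<Rightarrow> real)"
proof -
  have "continuous_on {0<..} F" using F by (simp add: continuous_on_eq_continuous_at)
  moreover have "continuous_on UNIV (\<lambda>z::real^'n. (norm z)\<^sup>2 + e\<^sup>2)" by (intro continuous_intros)
  moreover have "(\<lambda>z::real^'n. (norm z)\<^sup>2 + e\<^sup>2) ` UNIV \<subseteq> {0<..}" using e by (auto simp: add_nonneg_pos)
  ultimately show ?thesis unfolding radial_def[abs_def] by (rule continuous_on_compose2)
qed

text \<open>The limit is the Laplacian of \<open>F ((norm z)\<^sup>2 + e\<^sup>2)\<close> in terms
  of \<open>F'\<close> and \<open>F''\<close>. The bound \<open>B\<close> holds for all step sizes,
  as \<open>lim_weak\<close> demands, because the second derivatives are continuous with compact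
  support.\<close>

lemma radial_dlap:
  fixes a :: "real^'n"
  assumes e: "e > 0"
    and F: "\<And>s. s > 0 \<Longrightarrow> (F has_real_derivative F' s) (at s)"
    and F': "\<And>s. s > 0 \<Longrightarrow> (F' has_real_derivative F'' s) (at s)"
    and F'': "\<And>s. s > 0 \<Longrightarrow> isCont F'' s"
    and r: "r > 0" and supp: "\<And>s. s \<ge> r\<^sup>2 \<Longrightarrow> F s = 0 \<and> F' s = 0 \<and> F'' s = 0"
  obtains B where "\<And>y. \<bar>radial F e (y - a)\<bar> \<le> B" "\<And>y d. d > 0 \<Longrightarrow> \<bar>dlap d (\<lambda>y. radial F e (y - a)) y\<bar> \<le> B"
    "\<And>y d. (\<And>j. d j > 0) \<Longrightarrow> d \<longlonglongrightarrow> 0 \<Longrightarrow> (\<lambda>j. dlap (d j) (\<lambda>y. radial F e (y - a)) y) \<longlonglongrightarrow>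
      2 * real CARD('n) * radial F' e (y - a) + 4 * (norm (y - a))\<^sup>2 * radial F'' e (y - a)"
proof -
  define G where "G i y = 2 * (y - a) $ i * radial F' e (y - a)" for i y
  define D where "D i y = 2 * radial F' e (y - a) + 4 * ((y - a) $ i)\<^sup>2 * radial F'' e (y - a)" for i y
  have isF: "isCont F s" "isCont F' s" if "s > 0" for s
    using F[OF that] F'[OF that] by (auto intro: DERIV_isCont)
  have z0: "F1 ((norm (z::real^'n))\<^sup>2 + e\<^sup>2) = 0" if "z \<notin> cball 0 r" "F1 \<in> {F, F', F''}" for z F1
  proof -
    have nz: "\<bar>r\<bar> \<le> norm z" using that(1) r by simp
    have "r\<^sup>2 \<le> (norm z)\<^sup>2" using power_mono[OF nz, of 2] by simp
    then have "r\<^sup>2 \<le> (norm z)\<^sup>2 + e\<^sup>2" using zero_le_power2[of e] by linarith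
    then show ?thesis using supp that by auto
  qed
  have cont: "continuous_on UNIV (radial F1 e :: real^'n \<Rightarrow> real)" if "F1 \<in> {F, F', F''}" for F1
    by (rule continuous_on_radial[OF e]) (use that isF F'' in auto)
  have zr: "radial F e z = 0" "radial F' e z = 0" "radial F'' e z = 0" if "z \<notin> cball 0 r" for z :: "real^'n"
    using that by (simp_all add: radial_def z0)
  have cont': "continuous_on UNIV (radial F e :: real^'n \<Rightarrow> real)"
    "continuous_on UNIV (radial F' e :: real^'n \<Rightarrow> real)" "continuous_on UNIV (radial F'' e :: real^'n \<Rightarrow> real)"
    by (rule cont; simp)+
  obtain B0 where B0: "\<And>z::real^'n. \<bar>radial F e z\<bar> \<le> B0"
    using bounded_of_compact_support[OF cont'(1) zr(1)] by blast
  have c0: "continuous_on UNIV (\<lambda>z::real^'n. 2 * radial F' e z + 4 * (z $ i)\<^sup>2 * radial F'' e z)" for i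
    by (intro continuous_on_add continuous_on_mult continuous_on_const continuous_on_power continuous_on_component continuous_on_id cont')
  have "\<exists>B. \<forall>z::real^'n. \<bar>2 * radial F' e z + 4 * (z $ i)\<^sup>2 * radial F'' e z\<bar> \<le> B" for i
  proof -
    have "2 * radial F' e z + 4 * (z $ i)\<^sup>2 * radial F'' e z = 0" if "z \<notin> cball 0 r" for z :: "real^'n"
      using zr[OF that] by simp
    from bounded_of_compact_support[OF c0[of i] this] show ?thesis by blast
  qed
  then obtain B1 where B1: "\<And>z i. \<bar>2 * radial F' e z + 4 * ((z::real^'n) $ i)\<^sup>2 * radial F'' e z\<bar> \<le> B1 i" by metis
  define B2 where "B2 = (\<Sum>i\<in>UNIV. B1 i)"
  have B1nn: "0 \<le> B1 i" for i using B1[of 0 i] by linarith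
  have "B1 i \<le> B2" for i unfolding B2_def by (rule member_le_sum) (auto simp: B1nn)
  then have DB: "\<bar>D i y\<bar> \<le> B2" for i y unfolding D_def using order_trans[OF B1[of "y - a" i]] by blast
  have GD: "((\<lambda>t. radial F e (y + t *\<^sub>R axis i 1 - a)) has_real_derivative G i (y + t *\<^sub>R axis i 1)) (at t)"
    "((\<lambda>t. G i (y + t *\<^sub>R axis i 1)) has_real_derivative D i (y + t *\<^sub>R axis i 1)) (at t)" for y i t
    using radial_line_derivative[OF e F, of "y - a" i t] radial_line_derivative2[OF e F', of "y - a" i t]
    unfolding G_def D_def by (simp_all add: algebra_simps)
  have sumD: "(\<Sum>i\<in>UNIV. D i y) = 2 * real CARD('n) * radial F' e (y - a) + 4 * (norm (y - a))\<^sup>2 * radial F'' e (y - a)" for y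
  proof -
    have "(norm (y - a))\<^sup>2 = (\<Sum>i\<in>UNIV. ((y - a) $ i)\<^sup>2)"
      by (simp add: norm_vec_def L2_set_def sum_nonneg)
    then show ?thesis by (simp add: D_def sum.distrib sum_distrib_right sum_distrib_left)
  qed
  have isD: "isCont (D i) y" for i y
  proof -
    have "isCont (\<lambda>z::real^'n. 2 * radial F' e z + 4 * (z $ i)\<^sup>2 * radial F'' e z) (y - a)"
      using c0[of i] by (simp add: continuous_on_eq_continuous_at)
    moreover have "isCont (\<lambda>y. y - a) y" by simp
    ultimately show ?thesis unfolding D_def by (rule isCont_o2[rotated])
  qed
  have lim: "(\<lambda>j. dlap (d j) (\<lambda>y. radial F e (y - a)) y) \<longlonglongrightarrow> (\<Sum>i\<in>UNIV. D i y)"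
    if "\<And>j. d j > 0" "d \<longlonglongrightarrow> 0" for d y
    by (rule dlap_tendsto[OF zero_less_one that, where G = G]) (use GD isD in auto)
  \<comment> \<open>For any step size \<open>2 * B2\<close> bounds the oscillation of each second
    derivative, and \<open>real CARD('n) * B2\<close> bounds their sum.\<close>
  define B where "B = max B0 (real CARD('n) * (2 * B2) + real CARD('n) * B2)"
  have bd: "\<bar>dlap d (\<lambda>y. radial F e (y - a)) y\<bar> \<le> B" if "d > 0" for d y
  proof -
    have "\<bar>dlap d (\<lambda>y. radial F e (y - a)) y - (\<Sum>i\<in>UNIV. D i y)\<bar> \<le> real CARD('n) * (2 * B2)"
    proof (rule dlap_approx[OF that, where G = G])
      show "\<bar>D i y' - D i y\<bar> \<le> 2 * B2" for i y' using DB[of i y'] DB[of i y] by linarith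
    qed (use GD in auto)
    moreover have "\<bar>\<Sum>i\<in>UNIV. D i y\<bar> \<le> real CARD('n) * B2"
      using order_trans[OF sum_abs sum_mono[of UNIV "\<lambda>i. \<bar>D i y\<bar>" "\<lambda>_. B2"]] DB by simp
    moreover have "\<bar>p\<bar> \<le> u + v" if "\<bar>p - q\<bar> \<le> u" "\<bar>q\<bar> \<le> v" for p q u v :: real using that by linarith
    ultimately have "\<bar>dlap d (\<lambda>y. radial F e (y - a)) y\<bar> \<le> real CARD('n) * (2 * B2) + real CARD('n) * B2"
      by blast
    then show ?thesis unfolding B_def by (rule max.coboundedI2)
  qed
  show ?thesis
  proof (rule that)
    show "\<bar>radial F e (y - a)\<bar> \<le> B" for y using B0[of "y - a"] by (simp add: B_def)
    show "d > 0 \<Longrightarrow> \<bar>dlap d (\<lambda>y. radial F e (y - a)) y\<bar> \<le> B" for y d by (rule bd)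
    show "(\<lambda>j. dlap (d j) (\<lambda>y. radial F e (y - a)) y) \<longlonglongrightarrow>
      2 * real CARD('n) * radial F' e (y - a) + 4 * (norm (y - a))\<^sup>2 * radial F'' e (y - a)"
      if "\<And>j. d j > 0" "d \<longlonglongrightarrow> 0" for y d
      using lim[OF that] by (simp add: sumD)
  qed
qed

section \<open>Convolution with weakly singular kernels\<close>

lemma uniformly_continuous_of_compact_support:
  fixes f :: "'a::euclidean_space \<Rightarrow> real"
  assumes cont: "continuous_on UNIV f" and supp: "\<And>z. z \<notin> cball 0 r \<Longrightarrow> f z = 0"
  shows "uniformly_continuous_on UNIV f"
  unfolding uniformly_continuous_on_def
proof (intro allI impI)
  fix e :: real assume e: "e > 0"
  have "uniformly_continuous_on (cball 0 (r + 1)) f"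
    by (rule compact_uniformly_continuous) (use cont continuous_on_subset in auto)
  then obtain d where d: "d > 0" "\<And>x x'. x \<in> cball 0 (r + 1) \<Longrightarrow> x' \<in> cball 0 (r + 1) \<Longrightarrow> dist x' x < d \<Longrightarrow> dist (f x') (f x) < e"
    unfolding uniformly_continuous_on_def using e by meson
  have "dist (f x') (f x) < e" if xx: "dist x' x < min d 1" for x x'
  proof (cases "x \<in> cball 0 (r + 1) \<and> x' \<in> cball 0 (r + 1)")
    case True then show ?thesis using d xx by auto
  next
    case False
    have "norm x' \<le> norm x + dist x' x" "norm x \<le> norm x' + dist x' x"
      by (metis dist_norm norm_triangle_sub add.commute norm_minus_commute)+
    then have "norm x > r" "norm x' > r" using False xx by auto
    then show ?thesis using supp[of x] supp[of x'] e by auto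
  qed
  then show "\<exists>d>0. \<forall>x\<in>UNIV. \<forall>x'\<in>UNIV. dist x' x < d \<longrightarrow> dist (f x') (f x) < e"
    using d(1) by (intro exI[of _ "min d 1"]) auto
qed

lemma lborel_distr_reflect: "distr lborel borel (\<lambda>y. x - y) = (lborel :: 'a::euclidean_space measure)"
proof -
  have "lborel = density (distr lborel borel (\<lambda>y. x + (-1) *\<^sub>R y)) (\<lambda>_. ennreal (\<bar>-1\<bar> ^ DIM('a)))"
    by (rule lborel_affine) simp
  then show ?thesis by (simp add: density_1)
qed

lemma lborel_integral_reflect:
  fixes f :: "'a::euclidean_space \<Rightarrow> real"
  assumes "f \<in> borel_measurable borel"
  shows "(\<integral>y. f (x - y) \<partial>lborel) = (\<integral>y. f y \<partial>lborel)"
proof -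
  have "(\<integral>y. f y \<partial>lborel) = (\<integral>y. f y \<partial>distr lborel borel (\<lambda>y. x - y))" by (simp add: lborel_distr_reflect)
  also have "\<dots> = (\<integral>y. f (x - y) \<partial>lborel)" using assms by (subst integral_distr) auto
  finally show ?thesis by simp
qed

lemma lborel_integrable_reflect:
  fixes f :: "'a::euclidean_space \<Rightarrow> real"
  assumes "integrable lborel f"
  shows "integrable lborel (\<lambda>y. f (x - y))"
proof -
  have "integrable (distr lborel borel (\<lambda>y. x - y)) f" using assms by (simp add: lborel_distr_reflect)
  then show ?thesis by (rule integrable_distr[rotated]) simp
qed

definition cv :: "('a::euclidean_space \<Rightarrow> real) \<Rightarrow> ('a \<Rightarrow> real) \<Rightarrow> 'a \<Rightarrow> real" where
  "cv K g x = (\<integral>y. K (x - y) * g y \<partial>lborel)"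

lemma cv_integrable:
  fixes g :: "'a::euclidean_space \<Rightarrow> real"
  assumes K: "integrable lborel K" and [measurable]: "g \<in> borel_measurable borel" and B: "\<And>y. \<bar>g y\<bar> \<le> B"
  shows "integrable lborel (\<lambda>y. K (x - y) * g y)"
proof (rule Bochner_Integration.integrable_bound)
  show "integrable lborel (\<lambda>y. B * K (x - y))"
    using lborel_integrable_reflect[OF K] by (rule Bochner_Integration.integrable_mult_right)
  have [measurable]: "K \<in> borel_measurable borel" using K by auto
  show "(\<lambda>y. K (x - y) * g y) \<in> borel_measurable lborel" by simp
  have "\<bar>K (x - y)\<bar> * \<bar>g y\<bar> \<le> \<bar>B\<bar> * \<bar>K (x - y)\<bar>" for y
    using mult_mono[of "\<bar>g y\<bar>" "\<bar>B\<bar>" "\<bar>K (x - y)\<bar>" "\<bar>K (x - y)\<bar>"] B[of y] by (simp add: mult.commute)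
  then show "AE y in lborel. norm (K (x - y) * g y) \<le> norm (B * K (x - y))"
    by (simp add: abs_mult)
qed

lemma cv_bound:
  fixes g :: "'a::euclidean_space \<Rightarrow> real"
  assumes K: "integrable lborel K" and g [measurable]: "g \<in> borel_measurable borel" and B: "\<And>y. \<bar>g y\<bar> \<le> B"
  shows "\<bar>cv K g x\<bar> \<le> B * (\<integral>z. \<bar>K z\<bar> \<partial>lborel)"
proof -
  have [measurable]: "K \<in> borel_measurable borel" using K by auto
  have "\<bar>cv K g x\<bar> \<le> (\<integral>y. \<bar>K (x - y) * g y\<bar> \<partial>lborel)"
    unfolding cv_def by (rule integral_abs_bound)
  also have "\<dots> \<le> (\<integral>y. B * \<bar>K (x - y)\<bar> \<partial>lborel)"
  proof (rule integral_mono)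
    show "integrable lborel (\<lambda>y. \<bar>K (x - y) * g y\<bar>)" using cv_integrable[OF K g B] by (rule integrable_abs)
    show "integrable lborel (\<lambda>y. B * \<bar>K (x - y)\<bar>)"
      by (intro Bochner_Integration.integrable_mult_right integrable_abs lborel_integrable_reflect[OF K])
    show "\<bar>K (x - y) * g y\<bar> \<le> B * \<bar>K (x - y)\<bar>" for y
      using mult_right_mono[OF B[of y], of "\<bar>K (x - y)\<bar>"] by (simp add: abs_mult mult.commute)
  qed
  also have "\<dots> = B * (\<integral>y. \<bar>K (x - y)\<bar> \<partial>lborel)" by simp
  also have "(\<integral>y. \<bar>K (x - y)\<bar> \<partial>lborel) = (\<integral>z. \<bar>K z\<bar> \<partial>lborel)"
    using lborel_integral_reflect[of "\<lambda>z. \<bar>K z\<bar>" x] by simp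
  finally show ?thesis .
qed

lemma cv_diff_kernel:
  fixes g :: "'a::euclidean_space \<Rightarrow> real"
  assumes K: "integrable lborel K" "integrable lborel K'" and g: "g \<in> borel_measurable borel" "\<And>y. \<bar>g y\<bar> \<le> B"
  shows "cv K g x - cv K' g x = cv (\<lambda>z. K z - K' z) g x"
  unfolding cv_def left_diff_distrib
  using cv_integrable[OF K(1) g] cv_integrable[OF K(2) g] by simp

text \<open>Approximation of a singular kernel in \<open>L\<^sup>1\<close> by continuous kernels
  with a common support. Convolutions with a bounded function then converge uniformly, which
  transfers continuity and derivatives to the singular kernel.\<close>

definition kernel_limit :: "real \<Rightarrow> (nat \<Rightarrow> real^'n \<Rightarrow> real) \<Rightarrow> (real^'n \<Rightarrow> real) \<Rightarrow> bool" where
  "kernel_limit r Kn K \<longleftrightarrow> (\<forall>n. continuous_on UNIV (Kn n) \<and> (\<forall>z. z \<notin> cball 0 r \<longrightarrow> Kn n z = 0)) \<and>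
     integrable lborel K \<and> (\<lambda>n. \<integral>z. \<bar>Kn n z - K z\<bar> \<partial>lborel) \<longlonglongrightarrow> 0"

lemma continuous_compact_support_integrable:
  fixes f :: "real^'n \<Rightarrow> real"
  assumes c: "continuous_on UNIV f" and s: "\<And>z. z \<notin> cball 0 r \<Longrightarrow> f z = 0"
  shows "integrable lborel f"
proof -
  obtain B where "\<And>z. \<bar>f z\<bar> \<le> B" using bounded_of_compact_support[OF c s] by blast
  then show ?thesis by (rule integrable_bounded_support[OF borel_measurable_continuous_onI[OF c] _ s])
qed

lemma kernel_limit_integrable: "kernel_limit r Kn K \<Longrightarrow> integrable lborel (Kn n)"
  unfolding kernel_limit_def by (blast intro: continuous_compact_support_integrable)

lemma kernel_limit_cv_bound:
  assumes "kernel_limit r Kn K" and g: "g \<in> borel_measurable borel" "\<And>y. \<bar>g y\<bar> \<le> B"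
  shows "\<bar>cv (Kn n) g x - cv K g x\<bar> \<le> B * (\<integral>z. \<bar>Kn n z - K z\<bar> \<partial>lborel)"
proof -
  have i: "integrable lborel (Kn n)" "integrable lborel K"
    using assms(1) kernel_limit_integrable by (auto simp: kernel_limit_def)
  then show ?thesis unfolding cv_diff_kernel[OF i g]
    by (intro cv_bound g) auto
qed

lemma kernel_limit_cv_uniform:
  fixes g :: "real^'n \<Rightarrow> real"
  assumes k: "kernel_limit r Kn K" and g: "g \<in> borel_measurable borel" "\<And>y. \<bar>g y\<bar> \<le> B" and e: "e > 0"
  shows "\<forall>\<^sub>F n in sequentially. \<forall>x. \<bar>cv (Kn n) g x - cv K g x\<bar> < e"
proof -
  have B: "0 \<le> B" using g(2)[of 0] by linarith
  have "(\<lambda>n. B * (\<integral>z. \<bar>Kn n z - K z\<bar> \<partial>lborel)) \<longlonglongrightarrow> B * 0"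
    using k by (intro tendsto_intros) (auto simp: kernel_limit_def)
  then have "\<forall>\<^sub>F n in sequentially. B * (\<integral>z. \<bar>Kn n z - K z\<bar> \<partial>lborel) < e"
    using e by (intro order_tendstoD) auto
  then show ?thesis
    by (rule eventually_mono) (use kernel_limit_cv_bound[OF k g] le_less_trans in blast)
qed

lemma cv_continuous_smooth_kernel:
  fixes g :: "real^'n \<Rightarrow> real"
  assumes c: "continuous_on UNIV K" and s: "\<And>z. z \<notin> cball 0 r \<Longrightarrow> K z = 0"
    and g: "g \<in> borel_measurable borel" "\<And>y. \<bar>g y\<bar> \<le> B" and gs: "\<And>y. y \<notin> cball 0 R \<Longrightarrow> g y = 0"
  shows "continuous_on UNIV (cv K g)"
  unfolding continuous_on_sequentially o_def cv_def
proof (intro allI ballI impI, elim conjE)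
  fix x :: "nat \<Rightarrow> real^'n" and a assume x: "x \<longlonglongrightarrow> a"
  obtain C where C: "\<And>z. \<bar>K z\<bar> \<le> C" "C \<ge> 0" using bounded_of_compact_support[OF c s] by blast
  have [measurable]: "K \<in> borel_measurable borel" by (rule borel_measurable_continuous_onI[OF c])
  note [measurable] = g(1)
  have B: "0 \<le> B" using g(2)[of 0] by linarith
  show "(\<lambda>n. \<integral>y. K (x n - y) * g y \<partial>lborel) \<longlonglongrightarrow> (\<integral>y. K (a - y) * g y \<partial>lborel)"
  proof (rule integral_tendsto_bounded_support[where B = "C * B" and R = R])
    have "isCont K z" for z using c by (simp add: continuous_on_eq_continuous_at)
    then show "(\<lambda>n. K (x n - y) * g y) \<longlonglongrightarrow> K (a - y) * g y" for y
      by (intro tendsto_mult tendsto_const isCont_tendsto_compose[of _ K] tendsto_diff x)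
    show "\<bar>K (x n - y) * g y\<bar> \<le> C * B" for n y unfolding abs_mult by (intro mult_mono C g) auto
  qed (use gs in auto)
qed

lemma cv_continuous:
  fixes g :: "real^'n \<Rightarrow> real"
  assumes k: "kernel_limit r Kn K" and g: "g \<in> borel_measurable borel" "\<And>y. \<bar>g y\<bar> \<le> B"
    and gs: "\<And>y. y \<notin> cball 0 R \<Longrightarrow> g y = 0"
  shows "continuous_on UNIV (cv K g)"
proof (rule uniform_limit_theorem[where F = sequentially])
  show "\<forall>\<^sub>F n in sequentially. continuous_on UNIV (cv (Kn n) g)"
    using k by (intro always_eventually allI cv_continuous_smooth_kernel[OF _ _ g gs, of _ r]) (auto simp: kernel_limit_def)
  show "uniform_limit UNIV (\<lambda>n. cv (Kn n) g) (cv K g) sequentially"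
    unfolding uniform_limit_iff using kernel_limit_cv_uniform[OF k g] by (simp add: dist_real_def)
qed simp

lemma vec_sum_le_norm:
  fixes h :: "real^'n"
  assumes "\<And>i. \<bar>c i\<bar> \<le> C"
  shows "\<bar>\<Sum>i\<in>UNIV. h $ i * c i\<bar> \<le> real CARD('n) * C * norm h"
proof -
  have "\<bar>\<Sum>i\<in>UNIV. h $ i * c i\<bar> \<le> (\<Sum>i\<in>(UNIV::'n set). norm h * C)"
    by (rule order_trans[OF sum_abs sum_mono])
      (auto simp: abs_mult intro!: mult_mono component_le_norm_cart assms)
  then show ?thesis by (simp add: mult_ac)
qed

lemma C1_linearization:
  fixes K :: "real^'n \<Rightarrow> real"
  assumes der: "\<And>z. (K has_derivative (\<lambda>h. \<Sum>i\<in>UNIV. h $ i * Ki i z)) (at z)"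
    and close: "\<And>i y. dist y z < d \<Longrightarrow> \<bar>Ki i y - Ki i z\<bar> \<le> \<eta>" and u: "norm u < d"
  shows "\<bar>K (z + u) - K z - (\<Sum>i\<in>UNIV. u $ i * Ki i z)\<bar> \<le> norm u * (real CARD('n) * \<eta>)"
proof -
  have d: "d > 0" using u norm_ge_zero[of u] by linarith
  have \<eta>: "\<eta> \<ge> 0" using close[of z] d by fastforce
  have "norm (K (z + u) - K z - (\<Sum>i\<in>UNIV. ((z + u) - z) $ i * Ki i z)) \<le> norm ((z + u) - z) * (real CARD('n) * \<eta>)"
  proof (rule differentiable_bound_linearization[where S = "ball z d" and f' = "\<lambda>z h. \<Sum>i\<in>UNIV. h $ i * Ki i z"])
    show "z \<in> ball z d" using d by simp
    show "z + t *\<^sub>R (z + u - z) \<in> ball z d" if "t \<in> {0..1}" for t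
    proof -
      have "\<bar>t\<bar> * norm u \<le> norm u" using that by (intro mult_left_le_one_le) auto
      then show ?thesis using u by (simp add: dist_norm)
    qed
    show "(K has_derivative (\<lambda>h. \<Sum>i\<in>UNIV. h $ i * Ki i y)) (at y within ball z d)" for y
      by (rule has_derivative_at_withinI[OF der])
    show "onorm ((\<lambda>h. \<Sum>i\<in>UNIV. h $ i * Ki i y) - (\<lambda>h::real^'n. \<Sum>i\<in>UNIV. h $ i * Ki i z)) \<le> real CARD('n) * \<eta>"
      if y: "y \<in> ball z d" for y
    proof (rule onorm_bound)
      fix h :: "real^'n"
      have "\<bar>\<Sum>i\<in>UNIV. h $ i * (Ki i y - Ki i z)\<bar> \<le> real CARD('n) * \<eta> * norm h"
        by (rule vec_sum_le_norm) (use close[of y] y in \<open>auto simp: dist_commute\<close>)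
      then show "norm (((\<lambda>h. \<Sum>i\<in>UNIV. h $ i * Ki i y) - (\<lambda>h. \<Sum>i\<in>UNIV. h $ i * Ki i z)) h) \<le> real CARD('n) * \<eta> * norm h"
        by (simp add: sum_subtractf right_diff_distrib)
    next
      show "0 \<le> real CARD('n) * \<eta>" using \<eta> by simp
    qed
  qed
  then show ?thesis by simp
qed

text \<open>As \<open>g\<close> is only bounded and measurable, the derivative falls on the kernel.
  Uniform continuity of \<open>Ki\<close> makes the linearization error of \<open>K\<close> uniform
  in the integration variable, and the support of \<open>g\<close> bounds the domain of
  integration.\<close>

lemma cv_has_derivative_smooth_kernel:
  fixes g :: "real^'n \<Rightarrow> real"
  assumes c: "continuous_on UNIV K" and s: "\<And>z. z \<notin> cball 0 r \<Longrightarrow> K z = 0"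
    and ci: "\<And>i. continuous_on UNIV (Ki i)" and si: "\<And>i z. z \<notin> cball 0 r \<Longrightarrow> Ki i z = 0"
    and der: "\<And>z. (K has_derivative (\<lambda>h. \<Sum>i\<in>UNIV. h $ i * Ki i z)) (at z)"
    and g: "g \<in> borel_measurable borel" "\<And>y. \<bar>g y\<bar> \<le> B" and gs: "\<And>y. y \<notin> cball 0 R \<Longrightarrow> g y = 0"
  shows "(cv K g has_derivative (\<lambda>h. \<Sum>i\<in>UNIV. h $ i * cv (Ki i) g x)) (at x)"
  unfolding has_derivative_at_alt
proof (intro conjI allI impI)
  show "bounded_linear (\<lambda>h::real^'n. \<Sum>i\<in>UNIV. h $ i * cv (Ki i) g x)"
    by (intro bounded_linear_sum bounded_linear_mult_const bounded_linear_vec_nth)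
  fix e :: real assume e: "e > 0"
  define V where "V = measure lborel (cball (0::real^'n) R)"
  have V: "0 \<le> V" by (simp add: V_def)
  have B: "0 \<le> B" using g(2)[of 0] by linarith
  \<comment> \<open>The summand \<open>1\<close> keeps \<open>C\<close> positive when
    \<open>B * V\<close> vanishes.\<close>
  define C where "C = real CARD('n) * B * V + 1"
  have C: "C > 0" using B V by (simp add: C_def add_nonneg_pos)
  have eC: "e / C > 0" using e C by simp
  have "\<exists>d>0. \<forall>z z'. dist z' z < d \<longrightarrow> \<bar>Ki i z' - Ki i z\<bar> < e / C" for i
    using uniformly_continuous_of_compact_support[OF ci[of i] si[of _ i]] eC
    unfolding uniformly_continuous_on_def dist_real_def by simp
  then obtain di where di: "\<And>i. di i > 0" "\<And>i z z'. dist z' z < di i \<Longrightarrow> \<bar>Ki i z' - Ki i z\<bar> < e / C"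
    by metis
  define d where "d = Min (range di)"
  have d1: "d > 0" using di(1) by (simp add: d_def)
  have "d \<le> di i" for i by (simp add: d_def)
  then have d: "d > 0" "\<And>i z z'. dist z' z < d \<Longrightarrow> \<bar>Ki i z' - Ki i z\<bar> < e / C"
    using d1 di(2) less_le_trans by blast+
  have lin: "\<bar>K (z + u) - K z - (\<Sum>i\<in>UNIV. u $ i * Ki i z)\<bar> \<le> norm u * (real CARD('n) * (e / C))"
    if u: "norm u < d" for z u
  proof (rule C1_linearization[OF der _ u])
    show "\<bar>Ki i y - Ki i z\<bar> \<le> e / C" if "dist y z < d" for i y
      using d(2)[OF that] by (rule less_imp_le)
  qed
  have iK: "integrable lborel K" using continuous_compact_support_integrable[OF c s] .
  have iKi: "integrable lborel (Ki i)" for i using continuous_compact_support_integrable[OF ci si] .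
  note ig = cv_integrable[OF iK g] cv_integrable[OF iKi g]
  note [measurable] = g(1)
  show "\<exists>d>0. \<forall>y. norm (y - x) < d \<longrightarrow>
      norm (cv K g y - cv K g x - (\<Sum>i\<in>UNIV. (y - x) $ i * cv (Ki i) g x)) \<le> e * norm (y - x)"
  proof (intro exI[of _ d] conjI allI impI d(1))
    fix x' assume x': "norm (x' - x) < d"
    define u where "u = x' - x"
    have u: "norm u < d" using x' by (simp add: u_def)
    define E where "E y = K (x' - y) * g y - K (x - y) * g y - (\<Sum>i\<in>UNIV. u $ i * (Ki i (x - y) * g y))" for y
    have iE: "integrable lborel E" unfolding E_def
      by (intro Bochner_Integration.integrable_diff ig Bochner_Integration.integrable_sum Bochner_Integration.integrable_mult_right)
    have "cv K g x' - cv K g x - (\<Sum>i\<in>UNIV. u $ i * cv (Ki i) g x) = (\<integral>y. E y \<partial>lborel)"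
      unfolding E_def cv_def using ig by (simp add: Bochner_Integration.integral_sum)
    also have "\<bar>\<dots>\<bar> \<le> (\<integral>y. \<bar>E y\<bar> \<partial>lborel)" by (rule integral_abs_bound)
    also have "\<dots> \<le> (\<integral>y. norm u * (real CARD('n) * (e / C)) * B * indicator (cball 0 R) y \<partial>(lborel :: (real^'n) measure))"
    proof (rule integral_mono)
      show "integrable lborel (\<lambda>y. \<bar>E y\<bar>)" using iE by (rule integrable_abs)
      show "integrable lborel (\<lambda>y::real^'n. norm u * (real CARD('n) * (e / C)) * B * indicator (cball 0 R) y :: real)"
        by (rule integrable_cmult_indicator_cball)
      fix y :: "real^'n"
      have "E y = (K ((x - y) + u) - K (x - y) - (\<Sum>i\<in>UNIV. u $ i * Ki i (x - y))) * g y"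
        unfolding E_def u_def by (simp add: algebra_simps sum_distrib_left)
      then have "\<bar>E y\<bar> = \<bar>K ((x - y) + u) - K (x - y) - (\<Sum>i\<in>UNIV. u $ i * Ki i (x - y))\<bar> * \<bar>g y\<bar>"
        by (simp only: abs_mult)
      also have "\<dots> \<le> (norm u * (real CARD('n) * (e / C))) * B"
        by (rule mult_mono[OF lin[OF u] g(2)]) (use e C in auto)
      finally have "\<bar>E y\<bar> \<le> (norm u * (real CARD('n) * (e / C))) * B" .
      moreover have "E y = 0" if "y \<notin> cball 0 R" using gs[OF that] by (simp add: E_def)
      ultimately show "\<bar>E y\<bar> \<le> norm u * (real CARD('n) * (e / C)) * B * indicator (cball 0 R) y"
        by (cases "y \<in> cball 0 R") auto
    qed
    also have "\<dots> = norm u * (real CARD('n) * (e / C)) * B * V" by (simp add: V_def)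
    also have "\<dots> = norm u * e * ((real CARD('n) * B * V) / C)" by simp
    also have "\<dots> \<le> norm u * e * 1"
      using C e by (intro mult_left_mono) (auto simp: C_def)
    finally show "norm (cv K g x' - cv K g x - (\<Sum>i\<in>UNIV. (x' - x) $ i * cv (Ki i) g x)) \<le> e * norm (x' - x)"
      by (simp add: u_def mult.commute)
  qed
qed

text \<open>The derivatives of the convolutions with \<open>Kn\<close> converge uniformly, so limit
  and derivative may be exchanged. Integrability of the gradient kernels \<open>Ki\<close> is thus
  what yields a derivative for a merely bounded \<open>g\<close>.\<close>

lemma cv_has_derivative:
  fixes g :: "real^'n \<Rightarrow> real"
  assumes k: "kernel_limit r Kn K" and ki: "\<And>i. kernel_limit r (\<lambda>n. Kin n i) (Ki i)"
    and der: "\<And>n z. (Kn n has_derivative (\<lambda>h. \<Sum>i\<in>UNIV. h $ i * Kin n i z)) (at z)"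
    and g: "g \<in> borel_measurable borel" "\<And>y. \<bar>g y\<bar> \<le> B" and gs: "\<And>y. y \<notin> cball 0 R \<Longrightarrow> g y = 0"
  shows "(cv K g has_derivative (\<lambda>h. \<Sum>i\<in>UNIV. h $ i * cv (Ki i) g x)) (at x)"
proof -
  have lim: "(\<lambda>n. cv (Kn n) g x) \<longlonglongrightarrow> cv K g x" for x
  proof (rule LIMSEQ_I)
    fix e :: real assume e: "e > 0"
    have "\<forall>\<^sub>F n in sequentially. \<bar>cv (Kn n) g x - cv K g x\<bar> < e"
      using kernel_limit_cv_uniform[OF k g e] by (rule eventually_mono) simp
    then show "\<exists>N. \<forall>n\<ge>N. norm (cv (Kn n) g x - cv K g x) < e" by (simp add: eventually_sequentially)
  qed
  have "\<exists>G. \<forall>x\<in>UNIV. (\<lambda>n. cv (Kn n) g x) \<longlonglongrightarrow> G x \<and>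
     (G has_derivative (\<lambda>h. \<Sum>i\<in>UNIV. h $ i * cv (Ki i) g x)) (at x within UNIV)"
  proof (rule has_derivative_sequence[OF convex_UNIV])
    show "(cv (Kn n) g has_derivative (\<lambda>h. \<Sum>i\<in>UNIV. h $ i * cv (Kin n i) g x)) (at x within UNIV)" for n x
      by (rule cv_has_derivative_smooth_kernel[OF _ _ _ _ der g gs]) (use k ki in \<open>auto simp: kernel_limit_def\<close>)
    show "(\<lambda>n. cv (Kn n) g 0) \<longlonglongrightarrow> cv K g 0" by (rule lim)
    fix e :: real assume e: "e > 0"
    have "\<forall>\<^sub>F n in sequentially. \<forall>i\<in>UNIV. \<forall>x. \<bar>cv (Kin n i) g x - cv (Ki i) g x\<bar> < e / real CARD('n)"
      by (rule eventually_ball_finite) (use kernel_limit_cv_uniform[OF ki g] e in auto)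
    then show "\<forall>\<^sub>F n in sequentially. \<forall>x\<in>UNIV. \<forall>h. norm ((\<Sum>i\<in>UNIV. h $ i * cv (Kin n i) g x) - (\<Sum>i\<in>UNIV. h $ i * cv (Ki i) g x)) \<le> e * norm h"
    proof (rule eventually_mono, intro ballI allI)
      fix n x and h :: "real^'n"
      assume *: "\<forall>i\<in>UNIV. \<forall>x. \<bar>cv (Kin n i) g x - cv (Ki i) g x\<bar> < e / real CARD('n)"
      have "\<bar>\<Sum>i\<in>UNIV. h $ i * (cv (Kin n i) g x - cv (Ki i) g x)\<bar> \<le> real CARD('n) * (e / real CARD('n)) * norm h"
        by (rule vec_sum_le_norm) (use * in \<open>auto intro: less_imp_le\<close>)
      then show "norm ((\<Sum>i\<in>UNIV. h $ i * cv (Kin n i) g x) - (\<Sum>i\<in>UNIV. h $ i * cv (Ki i) g x)) \<le> e * norm h"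
        by (simp add: right_diff_distrib sum_subtractf)
    qed
  next
    show "0 \<in> UNIV" by simp
  qed
  then obtain G where G: "\<And>x. (\<lambda>n. cv (Kn n) g x) \<longlonglongrightarrow> G x"
     "\<And>x. (G has_derivative (\<lambda>h. \<Sum>i\<in>UNIV. h $ i * cv (Ki i) g x)) (at x)" by auto
  have "G = cv K g" using G(1) lim LIMSEQ_unique by blast
  then show ?thesis using G(2) by simp
qed

section \<open>Integrable singularities\<close>

text \<open>Dyadic decomposition: for \<open>r / 2 ^ Suc k < norm z \<le> r / 2 ^ k\<close> the
  integrand is at most \<open>f k z\<close>, whose integral is a fixed multiple of
  \<open>r / 2 ^ Suc k\<close>, so the series is geometric. Each \<open>f k\<close> lives on a whole
  ball instead of a shell, which is enough for an upper bound.\<close>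

lemma integrable_norm_powr:
  "integrable lborel (\<lambda>z::real^'n. indicator (cball 0 r) z * norm z powr (1 - real CARD('n)) :: real)"
proof (cases "r > 0")
  case False
  have "(indicator (cball 0 r) z * norm z powr (1 - real CARD('n)) :: real) = 0" for z :: "real^'n"
  proof (cases "z = 0")
    case nz: False
    then have "norm z > 0" by simp
    then have "\<not> norm z \<le> r" using False by linarith
    then have "z \<notin> cball 0 r" by simp
    then show ?thesis by simp
  qed simp
  then have "(\<lambda>z::real^'n. indicator (cball 0 r) z * norm z powr (1 - real CARD('n)) :: real) = (\<lambda>_. 0)" by blast
  then show ?thesis by (simp only: integrable_zero)
next
  case r: True
  define N where "N = CARD('n)"
  have N: "N \<ge> 1" by (simp add: N_def Suc_leI)
  define f where "f k z = (r / 2 ^ Suc k) powr (1 - real N) * indicator (cball 0 (r / 2 ^ k)) z" for k and z :: "real^'n"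
  define c where "c = unit_ball_vol (real N) * 2 ^ N * r"
  have c: "c \<ge> 0" using r by (simp add: c_def)
  have int_f: "(\<integral>\<^sup>+z. ennreal (f k z) \<partial>lborel) = ennreal (c * (1/2) ^ Suc k)" for k
  proof -
    define a where "a = r / 2 ^ Suc k"
    have a: "a > 0" using r by (simp add: a_def)
    have "(\<integral>\<^sup>+z. ennreal (f k z) \<partial>lborel) = (\<integral>\<^sup>+z. ennreal (a powr (1 - real N)) * indicator (cball (0::real^'n) (2 * a)) z \<partial>lborel)"
      by (intro nn_integral_cong) (auto simp: f_def a_def indicator_def)
    also have "\<dots> = ennreal (a powr (1 - real N)) * emeasure lborel (cball (0::real^'n) (2 * a))"
      by (intro nn_integral_cmult_indicator) simp
    also have "emeasure lborel (cball (0::real^'n) (2 * a)) = ennreal (unit_ball_vol (real N) * (2 * a) ^ N)"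
      using a by (simp add: emeasure_cball N_def)
    also have "ennreal (a powr (1 - real N)) * \<dots> = ennreal (a powr (1 - real N) * (unit_ball_vol (real N) * (2 * a) ^ N))"
      using a by (intro ennreal_mult[symmetric]) auto
    also have "a powr (1 - real N) * (unit_ball_vol (real N) * (2 * a) ^ N) = unit_ball_vol (real N) * 2 ^ N * (a powr (1 - real N) * a powr real N)"
      using a by (simp add: power_mult_distrib powr_realpow)
    also have "a powr (1 - real N) * a powr real N = a" using a by (simp add: powr_add[symmetric])
    also have "unit_ball_vol (real N) * 2 ^ N * a = c * (1/2) ^ Suc k"
      by (simp add: c_def a_def power_one_over)
    finally show ?thesis .
  qed
  have le: "ennreal (norm (indicator (cball 0 r) z * norm z powr (1 - real CARD('n)) :: real)) \<le> (\<Sum>k. ennreal (f k z))" for z :: "real^'n"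
  proof (cases "z \<noteq> 0 \<and> norm z \<le> r")
    case True
    have "(\<lambda>k. r * (1/2) ^ Suc k) \<longlonglongrightarrow> r * 0"
      by (intro tendsto_intros LIMSEQ_Suc LIMSEQ_power_zero) simp
    then have "\<forall>\<^sub>F k in sequentially. r * (1/2) ^ Suc k < norm z"
      by (rule order_tendstoD(2)) (use True in simp)
    then have ex: "\<exists>k. r / 2 ^ Suc k < norm z" by (auto simp: eventually_sequentially power_one_over)
    define k where "k = (LEAST k. r / 2 ^ Suc k < norm z)"
    have k1: "r / 2 ^ Suc k < norm z" unfolding k_def by (rule LeastI_ex[OF ex])
    have k2: "norm z \<le> r / 2 ^ k"
    proof (cases k)
      case 0 then show ?thesis using True by simp
    next
      case (Suc m)
      then have "m < (LEAST k. r / 2 ^ Suc k < norm z)" unfolding k_def by linarith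
      then have "\<not> r / 2 ^ Suc m < norm z" by (rule not_less_Least)
      then show ?thesis using Suc by simp
    qed
    have "norm z powr (1 - real N) \<le> (r / 2 ^ Suc k) powr (1 - real N)"
      using k1 r N by (intro powr_mono2') auto
    then have "norm (indicator (cball 0 r) z * norm z powr (1 - real CARD('n)) :: real) \<le> f k z"
      using True k2 by (simp add: f_def N_def)
    then have "ennreal (norm (indicator (cball 0 r) z * norm z powr (1 - real CARD('n)) :: real)) \<le> ennreal (f k z)"
      by (rule ennreal_leI)
    also have "\<dots> = (\<Sum>k\<in>{k}. ennreal (f k z))" by simp
    also have "\<dots> \<le> (\<Sum>k. ennreal (f k z))" by (rule sum_le_suminf) auto
    finally show ?thesis .
  next
    case False
    then have "norm (indicator (cball 0 r) z * norm z powr (1 - real CARD('n)) :: real) = 0" by auto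
    then show ?thesis by (simp only: ennreal_0 zero_le)
  qed
  show ?thesis
  proof (rule integrableI_bounded)
    have "(\<integral>\<^sup>+z. ennreal (norm (indicator (cball 0 r) z * norm z powr (1 - real CARD('n)) :: real)) \<partial>(lborel :: (real^'n) measure))
       \<le> (\<integral>\<^sup>+z. (\<Sum>k. ennreal (f k z)) \<partial>lborel)"
      by (rule nn_integral_mono) (rule le)
    also have "\<dots> = (\<Sum>k. \<integral>\<^sup>+z. ennreal (f k z) \<partial>lborel)"
      by (rule nn_integral_suminf) (unfold f_def, measurable)
    also have "\<dots> = (\<Sum>k. ennreal (c * (1/2) ^ Suc k))" unfolding int_f by (rule refl)
    also have "\<dots> = ennreal (c * 1)"
      by (rule suminf_ennreal_eq) (use c in simp, rule sums_mult[OF power_half_series])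
    also have "\<dots> < \<infinity>" by simp
    finally show "(\<integral>\<^sup>+z. ennreal (norm (indicator (cball 0 r) z * norm z powr (1 - real CARD('n)) :: real)) \<partial>(lborel :: (real^'n) measure)) < \<infinity>" .
  next
    show "(\<lambda>z::real^'n. indicator (cball 0 r) z * norm z powr (1 - real CARD('n)) :: real) \<in> borel_measurable lborel"
      by measurable
  qed
qed

text \<open>Dominated convergence; the origin is a null set, so neither a bound nor convergence is
  asked there. \<open>K 0 = 0\<close> agrees with the value of a real power at
  \<open>0\<close>.\<close>

lemma kernel_limit_dominated:
  fixes Kn :: "nat \<Rightarrow> real^'n \<Rightarrow> real"
  assumes c: "\<And>n. continuous_on UNIV (Kn n)" and s: "\<And>n z. z \<notin> cball 0 r \<Longrightarrow> Kn n z = 0"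
    and lim: "\<And>z. z \<noteq> 0 \<Longrightarrow> (\<lambda>n. Kn n z) \<longlonglongrightarrow> K z" and K0: "K 0 = 0"
    and dom: "\<And>n z. z \<noteq> 0 \<Longrightarrow> z \<in> cball 0 r \<Longrightarrow> \<bar>Kn n z\<bar> \<le> C * norm z powr (1 - real CARD('n))"
  shows "kernel_limit r Kn K"
proof -
  let ?m = "\<lambda>z::real^'n. \<bar>C\<bar> * (indicator (cball 0 r) z * norm z powr (1 - real CARD('n))) :: real"
  have im: "integrable lborel ?m" using integrable_norm_powr by (rule Bochner_Integration.integrable_mult_right)
  have [measurable]: "Kn n \<in> borel_measurable borel" for n by (rule borel_measurable_continuous_onI[OF c])
  \<comment> \<open>\<open>Kn n 0\<close> may diverge. Replacing this single value by
    \<open>0\<close> gives a sequence converging everywhere, which makes \<open>K\<close>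
    measurable.\<close>
  have KnE: "(\<lambda>n. if z = 0 then 0 else Kn n z) \<longlonglongrightarrow> K z" for z using lim[of z] K0 by (cases "z = 0") auto
  have [measurable]: "K \<in> borel_measurable borel"
    by (rule borel_measurable_LIMSEQ_real[of borel "\<lambda>n z. if z = 0 then 0 else Kn n z"]) (auto intro: KnE)
  have AE0: "AE z in lborel. z \<noteq> (0::real^'n)" by (rule AE_lborel_singleton)
  have dom': "\<bar>Kn n z\<bar> \<le> ?m z" if "z \<noteq> 0" for n z
  proof (cases "z \<in> cball 0 r")
    case True
    have "C * norm z powr (1 - real CARD('n)) \<le> \<bar>C\<bar> * norm z powr (1 - real CARD('n))" by (intro mult_right_mono) auto
    then show ?thesis using order_trans[OF dom[OF that True]] True by simp
  qed (simp add: s)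
  have domK: "\<bar>K z\<bar> \<le> ?m z" if "z \<noteq> 0" for z
    by (rule LIMSEQ_le_const2[OF tendsto_rabs[OF lim[OF that]]]) (use dom'[OF that] in blast)
  have iK: "integrable lborel K"
  proof (rule Bochner_Integration.integrable_bound[OF im])
    show "AE z in lborel. norm (K z) \<le> norm (?m z)"
      using AE0 by eventually_elim (use domK in force)
  qed simp
  have "(\<lambda>n. \<integral>z. \<bar>Kn n z - K z\<bar> \<partial>lborel) \<longlonglongrightarrow> (\<integral>z. 0 \<partial>(lborel :: (real^'n) measure))"
  proof (rule integral_dominated_convergence[where w = "\<lambda>z. ?m z + ?m z"])
    show "integrable lborel (\<lambda>z. ?m z + ?m z)" using im im by (rule Bochner_Integration.integrable_add)
    show "AE z in lborel. (\<lambda>n. \<bar>Kn n z - K z\<bar>) \<longlonglongrightarrow> 0"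
      using AE0
    proof eventually_elim
      fix z :: "real^'n" assume "z \<noteq> 0"
      then have "(\<lambda>n. \<bar>Kn n z - K z\<bar>) \<longlonglongrightarrow> \<bar>K z - K z\<bar>" by (intro tendsto_intros lim)
      then show "(\<lambda>n. \<bar>Kn n z - K z\<bar>) \<longlonglongrightarrow> 0" by simp
    qed
    show "AE z in lborel. norm \<bar>Kn n z - K z\<bar> \<le> ?m z + ?m z" for n
      using AE0
    proof eventually_elim
      fix z :: "real^'n" assume z: "z \<noteq> 0"
      have "\<bar>Kn n z - K z\<bar> \<le> \<bar>Kn n z\<bar> + \<bar>K z\<bar>" by (rule abs_triangle_ineq4)
      also have "\<dots> \<le> ?m z + ?m z" by (intro add_mono dom'[OF z] domK[OF z])
      finally show "norm \<bar>Kn n z - K z\<bar> \<le> ?m z + ?m z" by simp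
    qed
  qed measurable
  then show ?thesis using c s iK by (auto simp: kernel_limit_def)
qed

section \<open>Kernels with the singularity of the fundamental solution\<close>

definition profile :: "real \<Rightarrow> (real \<Rightarrow> real) \<Rightarrow> real \<Rightarrow> real" where
  "profile \<alpha> Q s = s powr \<alpha> * Q s"

definition profile' :: "real \<Rightarrow> (real \<Rightarrow> real) \<Rightarrow> (real \<Rightarrow> real) \<Rightarrow> real \<Rightarrow> real" where
  "profile' \<alpha> Q Q' s = \<alpha> * s powr (\<alpha> - 1) * Q s + s powr \<alpha> * Q' s"

lemma profile_derivative:
  assumes "s > 0" "(Q has_real_derivative Q' s) (at s)"
  shows "(profile \<alpha> Q has_real_derivative profile' \<alpha> Q Q' s) (at s)"
proof -
  have "((\<lambda>s. s powr \<alpha>) has_real_derivative \<alpha> * s powr (\<alpha> - 1)) (at s)"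
    using assms(1) by (rule has_real_derivative_powr)
  from DERIV_mult[OF this assms(2)] show ?thesis
    unfolding profile_def[abs_def] profile'_def by (simp add: algebra_simps)
qed

lemma isCont_powr_const: "s > 0 \<Longrightarrow> isCont (\<lambda>s::real. s powr a) s"
  using has_real_derivative_powr DERIV_isCont by blast

lemma sq_outside:
  fixes r e :: real and z :: "'a::real_normed_vector"
  assumes "r > 0" "z \<notin> cball 0 r"
  shows "r\<^sup>2 \<le> (norm z)\<^sup>2 + e\<^sup>2"
proof -
  have "r\<^sup>2 \<le> (norm z)\<^sup>2" using assms by (intro power_mono) auto
  then show ?thesis using zero_le_power2[of e] by linarith
qed

lemma powr_sq_le:
  fixes z :: "'a::real_normed_vector" and a e :: real
  assumes "z \<noteq> 0" "a \<le> 0"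
  shows "((norm z)\<^sup>2 + e\<^sup>2) powr a \<le> norm z powr (2 * a)"
proof -
  have "((norm z)\<^sup>2 + e\<^sup>2) powr a \<le> ((norm z)\<^sup>2) powr a"
    using assms by (intro powr_mono2') auto
  also have "((norm z)\<^sup>2) powr a = (norm z powr 2) powr a" using assms by (simp add: powr_realpow)
  also have "\<dots> = norm z powr (2 * a)" by (rule powr_powr)
  finally show ?thesis .
qed

text \<open>With this \<alpha>, \<open>s powr \<alpha>\<close> at
  \<open>s = (norm z)\<^sup>2\<close> is \<open>norm z powr (2 - n)\<close>. The locale serves both
  the truncated fundamental solution and the regular part of its Laplacian, which differ only in the
  factor \<open>Q\<close>. The parameter \<open>n_type\<close> carries the index type.\<close>

locale singular_profile =
  fixes n_type :: "'n::finite itself" and Q Q' :: "real \<Rightarrow> real" and \<alpha> r B :: real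
  assumes dim: "CARD('n) \<ge> 3" and \<alpha>_eq: "\<alpha> = 1 - real CARD('n) / 2" and r: "r > 0"
    and Q: "\<And>s. (Q has_real_derivative Q' s) (at s)" and Q': "\<And>s. isCont Q' s"
    and B: "\<And>s. s \<ge> 0 \<Longrightarrow> \<bar>Q s\<bar> \<le> B" "\<And>s. s \<ge> 0 \<Longrightarrow> \<bar>Q' s\<bar> \<le> B"
    and supp: "\<And>s. s \<ge> r\<^sup>2 \<Longrightarrow> Q s = 0" "\<And>s. s \<ge> r\<^sup>2 \<Longrightarrow> Q' s = 0"
begin

lemma \<alpha>: "\<alpha> < 0" using dim by (simp add: \<alpha>_eq)

lemma B_nonneg: "0 \<le> B" using B(1)[of 0] by simp

lemma profile_DERIV: "s > 0 \<Longrightarrow> (profile a Q has_real_derivative profile' a Q Q' s) (at s)"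
  by (rule profile_derivative, assumption, rule Q)

lemma isCont_profile: "s > 0 \<Longrightarrow> isCont (profile a Q) s"
  by (rule DERIV_isCont) (rule profile_DERIV)

lemma isCont_profile': "s > 0 \<Longrightarrow> isCont (profile' a Q Q') s"
  unfolding profile'_def[abs_def]
  by (intro continuous_intros isCont_powr_const Q' DERIV_isCont[OF Q])

lemma sq_lim:
  fixes z :: "real^'n"
  assumes e: "e \<longlonglongrightarrow> 0" and z: "z \<noteq> 0" and F: "\<And>s. s > 0 \<Longrightarrow> isCont F s"
  shows "(\<lambda>j. radial F (e j) z) \<longlonglongrightarrow> radial F 0 z"
  unfolding radial_def
proof (rule isCont_tendsto_compose[of _ F])
  show "isCont F ((norm z)\<^sup>2 + 0\<^sup>2)" using z by (intro F) simp
  show "(\<lambda>j. (norm z)\<^sup>2 + (e j)\<^sup>2) \<longlonglongrightarrow> (norm z)\<^sup>2 + 0\<^sup>2" by (intro tendsto_intros e)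
qed

lemma profile_bound:
  fixes z :: "real^'n"
  assumes z: "z \<noteq> 0" "z \<in> cball 0 r"
  shows "\<bar>radial (profile \<alpha> Q) e z\<bar> \<le> (B * r) * norm z powr (1 - real CARD('n))"
proof -
  define s where "s = (norm z)\<^sup>2 + e\<^sup>2"
  have nz: "norm z > 0" "norm z \<le> r" using z by auto
  have "\<bar>radial (profile \<alpha> Q) e z\<bar> = s powr \<alpha> * \<bar>Q s\<bar>"
    by (simp add: radial_def profile_def s_def abs_mult)
  also have "\<dots> \<le> norm z powr (2 * \<alpha>) * B"
    unfolding s_def using \<alpha> z by (intro mult_mono powr_sq_le B) auto
  also have "norm z powr (2 * \<alpha>) = norm z * norm z powr (1 - real CARD('n))"
  proof -
    have "norm z * norm z powr (1 - real CARD('n)) = norm z powr 1 * norm z powr (1 - real CARD('n))" using nz by simp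
    also have "\<dots> = norm z powr (2 * \<alpha>)" unfolding powr_add[symmetric] by (simp add: \<alpha>_eq)
    finally show ?thesis by simp
  qed
  also have "norm z * norm z powr (1 - real CARD('n)) * B \<le> r * norm z powr (1 - real CARD('n)) * B"
    using nz B_nonneg by (intro mult_right_mono) auto
  finally show ?thesis by (simp add: mult_ac)
qed

lemma kernel_limit_profile:
  assumes e: "\<And>j. e j > 0" and e0: "e \<longlonglongrightarrow> 0"
  shows "kernel_limit r (\<lambda>j. radial (profile \<alpha> Q) (e j) :: real^'n \<Rightarrow> real) (radial (profile \<alpha> Q) 0)"
proof (rule kernel_limit_dominated)
  show "continuous_on UNIV (radial (profile \<alpha> Q) (e j) :: real^'n \<Rightarrow> real)" for j
    by (rule continuous_on_radial[OF e isCont_profile])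
  show "radial (profile \<alpha> Q) (e j) z = 0" if "z \<notin> cball 0 r" for j and z :: "real^'n"
    using supp(1)[OF sq_outside[OF r that]] by (simp add: radial_def profile_def)
  show "(\<lambda>j. radial (profile \<alpha> Q) (e j) z) \<longlonglongrightarrow> radial (profile \<alpha> Q) 0 z" if "z \<noteq> 0" for z :: "real^'n"
    by (rule sq_lim[OF e0 that isCont_profile])
  show "radial (profile \<alpha> Q) 0 (0::real^'n) = 0" by (simp add: radial_def profile_def)
qed (rule profile_bound)

text \<open>The left side is a partial derivative of the regularized kernel. Differentiating the
  power gives \<open>norm z * norm z powr (2 * (\<alpha> - 1))\<close>, which is exactly the
  integrable power \<open>1 - n\<close>; differentiating \<open>Q\<close> gives a less singular
  term. The bound does not depend on \<open>e\<close>.\<close>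

lemma profile'_bound:
  fixes z :: "real^'n"
  assumes z: "z \<noteq> 0" "z \<in> cball 0 r"
  shows "\<bar>2 * z $ i * radial (profile' \<alpha> Q Q') e z\<bar> \<le> (2 * B * (\<bar>\<alpha>\<bar> + r\<^sup>2)) * norm z powr (1 - real CARD('n))"
proof -
  define s where "s = (norm z)\<^sup>2 + e\<^sup>2"
  define m where "m = norm z powr (1 - real CARD('n))"
  have nz: "norm z > 0" "norm z \<le> r" using z by auto
  have p1: "norm z * norm z powr (2 * (\<alpha> - 1)) = m"
  proof -
    have "norm z * norm z powr (2 * (\<alpha> - 1)) = norm z powr 1 * norm z powr (2 * (\<alpha> - 1))" using nz by simp
    also have "\<dots> = m" unfolding powr_add[symmetric] m_def by (simp add: \<alpha>_eq)
    finally show ?thesis .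
  qed
  have p2: "norm z * norm z powr (2 * \<alpha>) = (norm z)\<^sup>2 * m"
  proof -
    have "norm z * norm z powr (2 * \<alpha>) = norm z powr 1 * norm z powr (2 * \<alpha>)" using nz by simp
    also have "\<dots> = norm z powr 2 * m" unfolding powr_add[symmetric] m_def by (simp add: \<alpha>_eq)
    finally show ?thesis using nz by (simp add: powr_realpow)
  qed
  have "\<bar>profile' \<alpha> Q Q' s\<bar> \<le> \<bar>\<alpha> * s powr (\<alpha> - 1) * Q s\<bar> + \<bar>s powr \<alpha> * Q' s\<bar>"
    unfolding profile'_def by (rule abs_triangle_ineq)
  also have "\<dots> = \<bar>\<alpha>\<bar> * (s powr (\<alpha> - 1) * \<bar>Q s\<bar>) + s powr \<alpha> * \<bar>Q' s\<bar>" by (simp add: abs_mult)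
  also have "\<dots> \<le> \<bar>\<alpha>\<bar> * (norm z powr (2 * (\<alpha> - 1)) * B) + norm z powr (2 * \<alpha>) * B"
    unfolding s_def using \<alpha> z by (intro add_mono mult_left_mono mult_mono powr_sq_le B) auto
  finally have le: "\<bar>profile' \<alpha> Q Q' s\<bar> \<le> \<bar>\<alpha>\<bar> * (norm z powr (2 * (\<alpha> - 1)) * B) + norm z powr (2 * \<alpha>) * B" .
  have "\<bar>2 * z $ i * radial (profile' \<alpha> Q Q') e z\<bar> = 2 * (\<bar>z $ i\<bar> * \<bar>profile' \<alpha> Q Q' s\<bar>)"
    by (simp add: radial_def s_def abs_mult)
  also have "\<dots> \<le> 2 * (norm z * (\<bar>\<alpha>\<bar> * (norm z powr (2 * (\<alpha> - 1)) * B) + norm z powr (2 * \<alpha>) * B))"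
    by (intro mult_left_mono mult_mono component_le_norm_cart le) auto
  also have "\<dots> = 2 * (\<bar>\<alpha>\<bar> * (norm z * norm z powr (2 * (\<alpha> - 1))) * B + (norm z * norm z powr (2 * \<alpha>)) * B)"
    by (simp add: distrib_left mult_ac)
  also have "\<dots> = 2 * B * (\<bar>\<alpha>\<bar> + (norm z)\<^sup>2) * m"
    unfolding p1 p2 by (simp add: algebra_simps)
  also have "\<dots> \<le> 2 * B * (\<bar>\<alpha>\<bar> + r\<^sup>2) * m"
    using nz B_nonneg power_mono[of "norm z" r 2] by (intro mult_right_mono mult_left_mono add_left_mono) (auto simp: m_def)
  finally show ?thesis by (simp add: m_def)
qed

lemma kernel_limit_profile':
  assumes e: "\<And>j. e j > 0" and e0: "e \<longlonglongrightarrow> 0"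
  shows "kernel_limit r (\<lambda>j z. 2 * (z::real^'n) $ i * radial (profile' \<alpha> Q Q') (e j) z) (\<lambda>z. 2 * z $ i * radial (profile' \<alpha> Q Q') 0 z)"
proof (rule kernel_limit_dominated)
  show "continuous_on UNIV (\<lambda>z::real^'n. 2 * z $ i * radial (profile' \<alpha> Q Q') (e j) z)" for j
    by (intro continuous_on_mult continuous_on_const continuous_on_component continuous_on_id continuous_on_radial[OF e isCont_profile'])
  show "2 * z $ i * radial (profile' \<alpha> Q Q') (e j) z = 0" if "z \<notin> cball 0 r" for j and z :: "real^'n"
    using supp[OF sq_outside[OF r that]] by (simp add: radial_def profile'_def)
  show "(\<lambda>j. 2 * z $ i * radial (profile' \<alpha> Q Q') (e j) z) \<longlonglongrightarrow> 2 * z $ i * radial (profile' \<alpha> Q Q') 0 z" if "z \<noteq> 0" for z :: "real^'n"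
    by (intro tendsto_mult tendsto_const sq_lim[OF e0 that isCont_profile'])
qed (simp, rule profile'_bound)

lemma cv_profile:
  fixes g :: "real^'n \<Rightarrow> real"
  assumes g: "g \<in> borel_measurable borel" "\<And>y. \<bar>g y\<bar> \<le> C" and gs: "\<And>y. y \<notin> cball 0 R \<Longrightarrow> g y = 0"
  shows "(cv (radial (profile \<alpha> Q) 0) g has_derivative
      (\<lambda>h. \<Sum>i\<in>UNIV. h $ i * cv (\<lambda>z. 2 * z $ i * radial (profile' \<alpha> Q Q') 0 z) g x)) (at x)"
    and "continuous_on UNIV (cv (\<lambda>z. 2 * z $ i * radial (profile' \<alpha> Q Q') 0 z) g)"
proof -
  define e where "e j = 1 / real (Suc j)" for j
  have e: "\<And>j. e j > 0" "e \<longlonglongrightarrow> 0"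
    unfolding e_def by (simp, rule LIMSEQ_Suc[OF lim_1_over_n])
  have der: "(radial (profile \<alpha> Q) (e j) has_derivative (\<lambda>h. \<Sum>i\<in>UNIV. h $ i * (2 * z $ i * radial (profile' \<alpha> Q Q') (e j) z))) (at z)"
    for j and z :: "real^'n"
  proof -
    have "(radial (profile \<alpha> Q) (e j) has_derivative (\<lambda>h. 2 * (z \<bullet> h) * radial (profile' \<alpha> Q Q') (e j) z)) (at z)"
      by (rule radial_has_derivative[OF e(1) profile_DERIV])
    moreover have "(\<lambda>h. 2 * (z \<bullet> h) * radial (profile' \<alpha> Q Q') (e j) z) = (\<lambda>h. \<Sum>i\<in>UNIV. h $ i * (2 * z $ i * radial (profile' \<alpha> Q Q') (e j) z))"
      by (simp add: fun_eq_iff inner_vec_def sum_distrib_left sum_distrib_right mult_ac)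
    ultimately show ?thesis by simp
  qed
  show "(cv (radial (profile \<alpha> Q) 0) g has_derivative
      (\<lambda>h. \<Sum>i\<in>UNIV. h $ i * cv (\<lambda>z. 2 * z $ i * radial (profile' \<alpha> Q Q') 0 z) g x)) (at x)"
    by (rule cv_has_derivative[OF kernel_limit_profile[of e] kernel_limit_profile'[of e] der g gs]) (use e in auto)
  show "continuous_on UNIV (cv (\<lambda>z. 2 * z $ i * radial (profile' \<alpha> Q Q') 0 z) g)"
    by (rule cv_continuous[OF kernel_limit_profile'[of e] g gs]) (use e in auto)
qed

end

section \<open>A parametrix of the Laplacian\<close>

text \<open>A truncated power rather than a smooth bump: its derivatives are explicit truncated
  powers again, and only finitely many of them occur.\<close>

definition cutoff :: "real \<Rightarrow> nat \<Rightarrow> real \<Rightarrow> real" where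
  "cutoff \<rho> k s = (max 0 (\<rho> - s)) ^ k"

text \<open>The exponent is at least \<open>2\<close>, so at the kink \<open>s = \<rho>\<close> the
  difference quotient is bounded by \<open>\<bar>h\<bar> ^ Suc k\<close> and the formulas from both
  sides join.\<close>

lemma cutoff_DERIV: "(cutoff \<rho> (Suc (Suc k)) has_real_derivative - (real (Suc (Suc k)) * cutoff \<rho> (Suc k) s)) (at s)"
proof -
  consider "s < \<rho>" | "s > \<rho>" | "s = \<rho>" by linarith
  then show ?thesis
  proof cases
    case 1
    have "((\<lambda>s. (\<rho> - s) ^ Suc (Suc k)) has_real_derivative - (real (Suc (Suc k)) * (\<rho> - s) ^ Suc k)) (at s)"
    proof -
      have "((\<lambda>s. \<rho> - s) has_real_derivative - 1) (at s)" by (auto intro!: derivative_eq_intros)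
      from DERIV_power[OF this, of "Suc (Suc k)"] show ?thesis by simp
    qed
    then have "(cutoff \<rho> (Suc (Suc k)) has_real_derivative - (real (Suc (Suc k)) * (\<rho> - s) ^ Suc k)) (at s)"
      by (rule has_field_derivative_transform_within_open[of _ _ _ "{..<\<rho>}"]) (use 1 in \<open>auto simp: cutoff_def max_def\<close>)
    then show ?thesis using 1 by (simp add: cutoff_def max_def)
  next
    case 2
    have "((\<lambda>s. 0) has_real_derivative 0) (at s)" by simp
    then have "(cutoff \<rho> (Suc (Suc k)) has_real_derivative 0) (at s)"
      by (rule has_field_derivative_transform_within_open[of _ _ _ "{\<rho><..}"]) (use 2 in \<open>auto simp: cutoff_def max_def\<close>)
    then show ?thesis using 2 by (simp add: cutoff_def max_def)
  next
    case 3
    have "((\<lambda>h. (cutoff \<rho> (Suc (Suc k)) (s + h) - cutoff \<rho> (Suc (Suc k)) s) / h) \<longlongrightarrow> 0) (at 0)"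
    proof (rule Lim_null_comparison)
      show "\<forall>\<^sub>F h in at 0. norm ((cutoff \<rho> (Suc (Suc k)) (s + h) - cutoff \<rho> (Suc (Suc k)) s) / h) \<le> \<bar>h\<bar> ^ Suc k"
      proof (rule always_eventually, rule allI)
        fix h :: real
        have "max 0 (- h) ^ Suc (Suc k) \<le> \<bar>h\<bar> ^ Suc (Suc k)" by (intro power_mono) auto
        then have "\<bar>cutoff \<rho> (Suc (Suc k)) (s + h) - cutoff \<rho> (Suc (Suc k)) s\<bar> \<le> \<bar>h\<bar> ^ Suc k * \<bar>h\<bar>"
          using 3 by (simp add: cutoff_def mult_ac)
        then show "norm ((cutoff \<rho> (Suc (Suc k)) (s + h) - cutoff \<rho> (Suc (Suc k)) s) / h) \<le> \<bar>h\<bar> ^ Suc k"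
          by (cases "h = 0") (simp_all add: divide_le_eq)
      qed
      have "((\<lambda>h::real. \<bar>h\<bar> ^ Suc k) \<longlongrightarrow> \<bar>0\<bar> ^ Suc k) (at 0)" by (intro tendsto_intros)
      then show "((\<lambda>h::real. \<bar>h\<bar> ^ Suc k) \<longlongrightarrow> 0) (at 0)" by simp
    qed
    then show ?thesis using 3 unfolding DERIV_def by (simp add: cutoff_def)
  qed
qed

lemma isCont_cutoff: "isCont (cutoff \<rho> k) s"
proof -
  have "continuous_on UNIV (cutoff \<rho> k)" unfolding cutoff_def[abs_def] by (intro continuous_intros)
  then show ?thesis by (simp add: continuous_on_eq_continuous_at)
qed

lemma cutoff_zero: "s \<ge> \<rho> \<Longrightarrow> cutoff \<rho> (Suc k) s = 0"
  by (simp add: cutoff_def max_def)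

lemma cutoff_nonneg: "0 \<le> cutoff \<rho> k s"
  by (simp add: cutoff_def)

lemma cutoff_le: "0 \<le> s \<Longrightarrow> \<rho> \<ge> 0 \<Longrightarrow> cutoff \<rho> k s \<le> \<rho> ^ k"
  unfolding cutoff_def by (intro power_mono) auto

lemma bounded_of_support_halfline:
  fixes f :: "real \<Rightarrow> real"
  assumes c: "\<And>s. isCont f s" and z: "\<And>s. s \<ge> \<rho> \<Longrightarrow> f s = 0"
  obtains B where "\<And>s. s \<ge> 0 \<Longrightarrow> \<bar>f s\<bar> \<le> B"
proof -
  have "continuous_on {0..\<rho>} f" using c by (simp add: continuous_at_imp_continuous_on)
  then have "compact (f ` {0..\<rho>})" by (rule compact_continuous_image) simp
  then have "bounded (f ` {0..\<rho>})" by (rule compact_imp_bounded)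
  then obtain B where "\<forall>y\<in>f ` {0..\<rho>}. norm y \<le> B" unfolding bounded_iff by blast
  then have B: "\<bar>f s\<bar> \<le> B" if "s \<in> {0..\<rho>}" for s using that by simp
  have "\<bar>f s\<bar> \<le> max B 0" if "s \<ge> 0" for s
  proof (cases "s \<le> \<rho>")
    case True then show ?thesis using B[of s] that by simp
  next
    case False then show ?thesis using z[of s] by simp
  qed
  then show ?thesis by (rule that)
qed

locale parametrix =
  fixes n_type :: "'n::finite itself" and N \<alpha> r :: real
  assumes dim: "CARD('n) \<ge> 3" and N: "N = real CARD('n)" and \<alpha>_eq: "\<alpha> = 1 - N / 2" and r: "r > 0"
begin

text \<open>
  \<open>radial F e\<close> is the fundamental solution, regularized by \<open>e\<close> and truncated at radius \<open>r\<close>; the power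
  \<open>4\<close> of the cutoff keeps \<open>Q1\<close> continuously differentiable.  Its Laplacian splits as
  \<open>om - e\<^sup>2 kap - 4 e\<^sup>2 low\<close>: for \<open>e \<rightarrow> 0\<close> the first term stays integrable, the second concentrates
  at the origin, and the third vanishes.
\<close>

definition q where "q k = cutoff (r\<^sup>2) k"
text \<open>This is \<open>(8 - 2 * N) * q' + 4 * s * q''\<close> for \<open>q = q 4\<close>: at
  \<open>e = 0\<close> the Laplacian of \<open>s powr \<alpha> * q\<close> away from the origin,
  divided by \<open>s powr \<alpha>\<close>. Hence \<open>om\<close> is no more singular than
  \<open>F\<close>.\<close>

definition Q1 where "Q1 s = (8 - 2 * N) * (- (4 * q 3 s)) + 4 * s * (12 * q 2 s)"
definition Q1' where "Q1' s = (8 - 2 * N) * (12 * q 2 s) + (4 * (12 * q 2 s) + 4 * s * (- (24 * q 1 s)))"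
definition F where "F = profile \<alpha> (q 4)"
definition F' where "F' = profile' \<alpha> (q 4) (\<lambda>s. - (4 * q 3 s))"
text \<open>The terms of \<open>F''\<close> in which the cutoff has been differentiated; they are
  less singular than the remaining one.\<close>

definition low where "low s = 2 * \<alpha> * s powr (\<alpha> - 1) * (- (4 * q 3 s)) + s powr \<alpha> * (12 * q 2 s)"
definition F'' where "F'' s = \<alpha> * (\<alpha> - 1) * s powr (\<alpha> - 2) * q 4 s + low s"
definition om where "om = profile \<alpha> Q1"
text \<open>Up to the cutoff factor, \<open>e\<^sup>2 * kap\<close> is minus the Laplacian of
  \<open>((norm z)\<^sup>2 + e\<^sup>2) powr (1 - N / 2)\<close>, with the scaling of an approximate
  identity.\<close>

definition kap where "kap s = N * (N - 2) * s powr (\<alpha> - 2) * q 4 s"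

lemma N3: "N \<ge> 3" using dim N by simp

lemma \<alpha>: "\<alpha> < 0" using N3 by (simp add: \<alpha>_eq)

lemma q_DERIV: "(q 4 has_real_derivative - (4 * q 3 s)) (at s)" "(q 3 has_real_derivative - (3 * q 2 s)) (at s)"
  "(q 2 has_real_derivative - (2 * q 1 s)) (at s)"
  using cutoff_DERIV[of "r\<^sup>2" 2 s] cutoff_DERIV[of "r\<^sup>2" 1 s] cutoff_DERIV[of "r\<^sup>2" 0 s]
  by (simp_all add: q_def eval_nat_numeral)

lemma q_zero: "s \<ge> r\<^sup>2 \<Longrightarrow> k > 0 \<Longrightarrow> q k s = 0"
  using cutoff_zero[of "r\<^sup>2" s "k - 1"] by (simp add: q_def)

lemma isCont_q: "isCont (q k) s" unfolding q_def by (rule isCont_cutoff)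

lemma q_nonneg: "0 \<le> q k s" unfolding q_def by (rule cutoff_nonneg)

lemma Q1_DERIV: "(Q1 has_real_derivative Q1' s) (at s)"
  unfolding Q1_def[abs_def] Q1'_def by (auto intro!: derivative_eq_intros q_DERIV simp: algebra_simps)

lemma singular_profiles:
  shows "\<exists>B. singular_profile TYPE('n) (q 4) (\<lambda>s. - (4 * q 3 s)) \<alpha> r B"
    and "\<exists>B. singular_profile TYPE('n) Q1 Q1' \<alpha> r B"
proof -
  have ex: "\<exists>B. singular_profile TYPE('n) Q Q' \<alpha> r B"
    if Q: "\<And>s. (Q has_real_derivative Q' s) (at s)" and Q': "\<And>s. isCont Q' s"
      and z: "\<And>s. s \<ge> r\<^sup>2 \<Longrightarrow> Q s = 0" "\<And>s. s \<ge> r\<^sup>2 \<Longrightarrow> Q' s = 0" for Q Q'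
  proof -
    have cQ: "isCont Q s" for s by (rule DERIV_isCont[OF Q])
    obtain B where B: "\<And>s. s \<ge> 0 \<Longrightarrow> \<bar>Q s\<bar> \<le> B" using bounded_of_support_halfline[OF cQ z(1)] by blast
    obtain B' where B': "\<And>s. s \<ge> 0 \<Longrightarrow> \<bar>Q' s\<bar> \<le> B'" using bounded_of_support_halfline[OF Q' z(2)] by blast
    have "singular_profile TYPE('n) Q Q' \<alpha> r (max B B')"
    proof
      show "\<bar>Q s\<bar> \<le> max B B'" "\<bar>Q' s\<bar> \<le> max B B'" if "0 \<le> s" for s using B[OF that] B'[OF that] by auto
    qed (use dim r Q Q' z in \<open>auto simp: \<alpha>_eq N\<close>)
    then show ?thesis by blast
  qed
  show "\<exists>B. singular_profile TYPE('n) (q 4) (\<lambda>s. - (4 * q 3 s)) \<alpha> r B"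
    by (rule ex) (auto intro!: q_DERIV continuous_intros isCont_q simp: q_zero)
  show "\<exists>B. singular_profile TYPE('n) Q1 Q1' \<alpha> r B"
  proof (rule ex)
    show "isCont Q1' s" for s unfolding Q1'_def[abs_def] by (intro continuous_intros isCont_q)
    show "(Q1 has_real_derivative Q1' s) (at s)" for s by (rule Q1_DERIV)
  qed (auto simp: Q1_def Q1'_def q_zero)
qed

lemma F_DERIV: "s > 0 \<Longrightarrow> (F has_real_derivative F' s) (at s)"
  unfolding F_def F'_def by (rule profile_derivative[where Q' = "\<lambda>s. - (4 * q 3 s)"], assumption, rule q_DERIV(1))

lemma F'_DERIV: "s > 0 \<Longrightarrow> (F' has_real_derivative F'' s) (at s)"
proof -
  assume s: "s > 0"
  have p: "((\<lambda>s. s powr a) has_real_derivative a * s powr (a - 1)) (at s)" for a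
    using s by (rule has_real_derivative_powr)
  have "((\<lambda>s. \<alpha> * s powr (\<alpha> - 1) * q 4 s + s powr \<alpha> * (- (4 * q 3 s))) has_real_derivative F'' s) (at s)"
    by (rule derivative_eq_intros p q_DERIV refl)+
      (simp add: F''_def low_def algebra_simps)
  then show ?thesis by (simp add: F'_def profile'_def[abs_def])
qed

lemma isCont_low: "s > 0 \<Longrightarrow> isCont low s"
  unfolding low_def[abs_def] by (intro continuous_intros isCont_q isCont_powr_const)

lemma isCont_F'': "s > 0 \<Longrightarrow> isCont F'' s"
  unfolding F''_def[abs_def] by (intro continuous_intros isCont_q isCont_powr_const isCont_low)

lemma F_supp: "s \<ge> r\<^sup>2 \<Longrightarrow> F s = 0 \<and> F' s = 0 \<and> F'' s = 0"
  by (simp add: F_def F'_def F''_def low_def profile_def profile'_def q_zero)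

lemma F_nonneg: "0 \<le> F s"
  by (simp add: F_def profile_def q_nonneg)

definition test where "test e = (radial F e :: real^'n \<Rightarrow> real)"
definition test_lap where "test_lap e z = radial om e z - e\<^sup>2 * radial kap e z - 4 * e\<^sup>2 * radial low e (z :: real^'n)"

text \<open>The left side is the Laplacian of \<open>radial F e\<close>. With
  \<open>(norm z)\<^sup>2 = s - e\<^sup>2\<close> the leading powers cancel by
  \<open>2 * N * \<alpha> + 4 * \<alpha> * (\<alpha> - 1) = 0\<close>, the harmonicity of
  \<open>norm z powr (2 - N)\<close>; the subtracted \<open>e\<^sup>2\<close> produces the other two
  terms.\<close>

lemma laplacian_identity:
  fixes z :: "real^'n"
  assumes e: "e > 0"
  shows "2 * real CARD('n) * radial F' e z + 4 * (norm z)\<^sup>2 * radial F'' e z = test_lap e z"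
proof -
  define s where "s = (norm z)\<^sup>2 + e\<^sup>2"
  have s: "s > 0" using e by (simp add: s_def add_nonneg_pos)
  have p1: "s * s powr (\<alpha> - 1) = s powr \<alpha>" "s * s powr (\<alpha> - 2) = s powr (\<alpha> - 1)"
    using s by (simp_all add: powr_diff power2_eq_square field_simps)
  have c: "2 * N * \<alpha> + 4 * \<alpha> * (\<alpha> - 1) = 0" "2 * N + 8 * \<alpha> = 8 - 2 * N" "4 * (\<alpha> * (\<alpha> - 1)) = N * (N - 2)"
    by (simp_all add: \<alpha>_eq field_simps)
  have "2 * N * F' s + 4 * s * F'' s =
     (2 * N * \<alpha>) * s powr (\<alpha> - 1) * q 4 s + (4 * \<alpha> * (\<alpha> - 1)) * (s * s powr (\<alpha> - 2)) * q 4 s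
     + 2 * N * s powr \<alpha> * (- (4 * q 3 s)) + 8 * \<alpha> * (s * s powr (\<alpha> - 1)) * (- (4 * q 3 s)) + 4 * s * (s powr \<alpha> * (12 * q 2 s))"
    by (simp add: F'_def profile'_def F''_def low_def algebra_simps)
  also have "\<dots> = (2 * N * \<alpha> + 4 * \<alpha> * (\<alpha> - 1)) * s powr (\<alpha> - 1) * q 4 s
     + (2 * N + 8 * \<alpha>) * s powr \<alpha> * (- (4 * q 3 s)) + 4 * s * (s powr \<alpha> * (12 * q 2 s))"
    unfolding p1 by (simp add: algebra_simps)
  also have "\<dots> = om s" unfolding c by (simp add: om_def profile_def Q1_def algebra_simps)
  finally have 1: "2 * N * F' s + 4 * s * F'' s = om s" .
  have 2: "4 * F'' s = kap s + 4 * low s"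
    unfolding F''_def kap_def c(3)[symmetric] by (simp add: algebra_simps)
  have "2 * N * F' s + 4 * (s - e\<^sup>2) * F'' s = om s - e\<^sup>2 * (4 * F'' s)"
    using 1 by (simp add: algebra_simps)
  also have "\<dots> = om s - e\<^sup>2 * kap s - 4 * e\<^sup>2 * low s" unfolding 2 by (simp add: algebra_simps)
  finally show ?thesis by (simp add: radial_def s_def test_lap_def N[symmetric])
qed

lemma test_dlap:
  fixes a :: "real^'n"
  assumes e: "e > 0"
  obtains B where "\<And>y. \<bar>test e (y - a)\<bar> \<le> B" "\<And>y d. d > 0 \<Longrightarrow> \<bar>dlap d (\<lambda>y. test e (y - a)) y\<bar> \<le> B"
    "\<And>y d. (\<And>j. d j > 0) \<Longrightarrow> d \<longlonglongrightarrow> 0 \<Longrightarrow> (\<lambda>j. dlap (d j) (\<lambda>y. test e (y - a)) y) \<longlonglongrightarrow> test_lap e (y - a)"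
proof -
  obtain B where "\<And>y. \<bar>radial F e (y - a)\<bar> \<le> B" "\<And>y d. d > 0 \<Longrightarrow> \<bar>dlap d (\<lambda>y. radial F e (y - a)) y\<bar> \<le> B"
    "\<And>y d. (\<And>j. d j > 0) \<Longrightarrow> d \<longlonglongrightarrow> 0 \<Longrightarrow> (\<lambda>j. dlap (d j) (\<lambda>y. radial F e (y - a)) y) \<longlonglongrightarrow>
      2 * real CARD('n) * radial F' e (y - a) + 4 * (norm (y - a))\<^sup>2 * radial F'' e (y - a)"
    using radial_dlap[OF e F_DERIV F'_DERIV isCont_F'' r F_supp, where a = a] by blast
  then show ?thesis using that unfolding laplacian_identity[OF e] test_def by blast
qed

lemma radial_even: "radial G e (x - y) = radial G e (y - (x::real^'n))"
  by (simp add: radial_def norm_minus_commute)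

lemma test_supp: "z \<notin> cball 0 r \<Longrightarrow> test e z = 0"
  using F_supp[OF sq_outside[OF r, of z e]] by (simp add: test_def radial_def)

lemma continuous_test: "e > 0 \<Longrightarrow> continuous_on UNIV (test e)"
  unfolding test_def by (rule continuous_on_radial) (auto intro: DERIV_isCont F_DERIV)

definition low_ker where "low_ker e z = 4 * e\<^sup>2 * radial low e (z::real^'n)"
definition kap_ker where "kap_ker e z = e\<^sup>2 * radial kap e (z::real^'n)"

lemma kernel_limit_F:
  "(\<And>j. e j > 0) \<Longrightarrow> e \<longlonglongrightarrow> 0 \<Longrightarrow> kernel_limit r (\<lambda>j. radial F (e j) :: real^'n \<Rightarrow> real) (radial F 0)"
  using singular_profiles(1) singular_profile.kernel_limit_profile unfolding F_def by blast

lemma kernel_limit_om: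
  "(\<And>j. e j > 0) \<Longrightarrow> e \<longlonglongrightarrow> 0 \<Longrightarrow> kernel_limit r (\<lambda>j. radial om (e j) :: real^'n \<Rightarrow> real) (radial om 0)"
  using singular_profiles(2) singular_profile.kernel_limit_profile unfolding om_def by blast

text \<open>The factor \<open>e\<^sup>2\<close> offsets one power of \<open>s\<close>, since
  \<open>e\<^sup>2 \<le> s\<close>. So the kernel is dominated by the singularity of
  \<open>F\<close> uniformly in \<open>j\<close>, and away from the origin it tends to
  \<open>0\<close>.\<close>

lemma kernel_limit_low:
  assumes e: "\<And>j. e j > 0" "\<And>j. e j \<le> 1" and e0: "e \<longlonglongrightarrow> 0"
  shows "kernel_limit r (\<lambda>j. low_ker (e j)) (\<lambda>_. 0)"
proof (rule kernel_limit_dominated)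
  show "continuous_on UNIV (low_ker (e j))" for j unfolding low_ker_def[abs_def]
    by (intro continuous_on_mult continuous_on_const continuous_on_radial[OF e(1) isCont_low])
  show "low_ker (e j) z = 0" if "z \<notin> cball 0 r" for j z
    using sq_outside[OF r that] by (simp add: low_ker_def radial_def low_def q_zero)
  show "(\<lambda>j. low_ker (e j) z) \<longlonglongrightarrow> 0" if "z \<noteq> 0" for z
  proof -
    have "(\<lambda>j. radial low (e j) z) \<longlonglongrightarrow> radial low 0 z"
      unfolding radial_def
    proof (rule isCont_tendsto_compose[of _ low])
      show "isCont low ((norm z)\<^sup>2 + 0\<^sup>2)" using that by (intro isCont_low) simp
      show "(\<lambda>j. (norm z)\<^sup>2 + (e j)\<^sup>2) \<longlonglongrightarrow> (norm z)\<^sup>2 + 0\<^sup>2" by (intro tendsto_intros e0)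
    qed
    then have "(\<lambda>j. 4 * (e j)\<^sup>2 * radial low (e j) z) \<longlonglongrightarrow> 4 * 0\<^sup>2 * radial low 0 z"
      by (intro tendsto_intros e0)
    then show ?thesis by (simp add: low_ker_def)
  qed
  show "\<bar>low_ker (e j) z\<bar> \<le> (4 * (8 * \<bar>\<alpha>\<bar> * (r\<^sup>2) ^ 3 + 12 * (r\<^sup>2) ^ 2) * r) * norm z powr (1 - real CARD('n))"
    if z: "z \<noteq> 0" "z \<in> cball 0 r" for j z
  proof -
    define s where "s = (norm z)\<^sup>2 + (e j)\<^sup>2"
    have nz: "norm z > 0" "norm z \<le> r" using z by auto
    have s: "s > 0" "(e j)\<^sup>2 \<le> s" using e(1)[of j] by (auto simp: s_def add_nonneg_pos)
    have e1: "(e j)\<^sup>2 \<le> 1" using e[of j] by (simp add: power_le_one)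
    have sp: "s powr \<alpha> \<le> r * norm z powr (1 - real CARD('n))"
    proof -
      have "s powr \<alpha> \<le> norm z powr (2 * \<alpha>)" unfolding s_def using z \<alpha> by (intro powr_sq_le) auto
      also have "\<dots> = norm z powr 1 * norm z powr (1 - real CARD('n))"
        unfolding powr_add[symmetric] by (simp add: \<alpha>_eq N)
      also have "\<dots> \<le> r * norm z powr (1 - real CARD('n))" using nz by (intro mult_right_mono) auto
      finally show ?thesis .
    qed
    have q: "\<bar>q k s\<bar> \<le> (r\<^sup>2) ^ k" for k using cutoff_le[of s "r\<^sup>2" k] q_nonneg[of k s] s by (simp add: q_def)
    have es: "(e j)\<^sup>2 * s powr (\<alpha> - 1) \<le> s powr \<alpha>"
    proof -
      have "(e j)\<^sup>2 * s powr (\<alpha> - 1) \<le> s * s powr (\<alpha> - 1)" using s by (intro mult_right_mono) auto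
      also have "\<dots> = s powr \<alpha>" using s by (simp add: powr_diff)
      finally show ?thesis .
    qed
    have "(e j)\<^sup>2 * low s = (2 * \<alpha>) * ((e j)\<^sup>2 * s powr (\<alpha> - 1)) * (- (4 * q 3 s)) + (e j)\<^sup>2 * s powr \<alpha> * (12 * q 2 s)"
      by (simp add: low_def algebra_simps)
    then have "\<bar>(e j)\<^sup>2 * low s\<bar> \<le> (2 * \<bar>\<alpha>\<bar>) * ((e j)\<^sup>2 * s powr (\<alpha> - 1)) * (4 * \<bar>q 3 s\<bar>) + (e j)\<^sup>2 * s powr \<alpha> * (12 * \<bar>q 2 s\<bar>)"
      by (simp only:) (rule order_trans[OF abs_triangle_ineq], simp add: abs_mult)
    also have "\<dots> \<le> (2 * \<bar>\<alpha>\<bar>) * s powr \<alpha> * (4 * (r\<^sup>2) ^ 3) + 1 * s powr \<alpha> * (12 * (r\<^sup>2) ^ 2)"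
      by (intro add_mono mult_mono mult_left_mono q es e1) auto
    also have "\<dots> = (8 * \<bar>\<alpha>\<bar> * (r\<^sup>2) ^ 3 + 12 * (r\<^sup>2) ^ 2) * s powr \<alpha>" by (simp add: algebra_simps)
    also have "\<dots> \<le> (8 * \<bar>\<alpha>\<bar> * (r\<^sup>2) ^ 3 + 12 * (r\<^sup>2) ^ 2) * (r * norm z powr (1 - real CARD('n)))"
      by (intro mult_left_mono sp) auto
    finally have le: "\<bar>(e j)\<^sup>2 * low s\<bar> \<le> (8 * \<bar>\<alpha>\<bar> * (r\<^sup>2) ^ 3 + 12 * (r\<^sup>2) ^ 2) * (r * norm z powr (1 - real CARD('n)))" .
    have "\<bar>low_ker (e j) z\<bar> = 4 * \<bar>(e j)\<^sup>2 * low s\<bar>"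
      by (simp add: low_ker_def radial_def s_def abs_mult mult.assoc)
    also have "\<dots> \<le> 4 * ((8 * \<bar>\<alpha>\<bar> * (r\<^sup>2) ^ 3 + 12 * (r\<^sup>2) ^ 2) * (r * norm z powr (1 - real CARD('n))))"
      by (rule mult_left_mono[OF le]) simp
    finally show ?thesis by (simp only: mult.assoc)
  qed
qed simp

lemma isCont_kap: "s > 0 \<Longrightarrow> isCont kap s"
  unfolding kap_def[abs_def] by (intro continuous_intros isCont_q isCont_powr_const)

lemma continuous_kap_ker: "e > 0 \<Longrightarrow> continuous_on UNIV (kap_ker e)"
  unfolding kap_ker_def[abs_def]
  by (intro continuous_on_mult continuous_on_const continuous_on_radial isCont_kap)

lemma kap_ker_supp: "z \<notin> cball 0 r \<Longrightarrow> kap_ker e z = 0"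
  using sq_outside[OF r, of z e] by (simp add: kap_ker_def radial_def kap_def q_zero)

lemma kap_ker_nonneg: "0 \<le> kap_ker e z"
  using N3 by (simp add: kap_ker_def radial_def kap_def q_nonneg)

lemma integrable_kap_ker: "e > 0 \<Longrightarrow> integrable lborel (kap_ker e)"
  by (rule continuous_compact_support_integrable[OF continuous_kap_ker kap_ker_supp])

lemma test_lap_eq: "test_lap e z = radial om e z - kap_ker e z - low_ker e z"
  by (simp add: test_lap_def kap_ker_def low_ker_def)

text \<open>Symmetry of \<open>dlap\<close> against the constant \<open>1\<close>, whose differences
  vanish, gives the integral \<open>0\<close> at every step size; dominated convergence passes to
  the Laplacian.\<close>

lemma integral_test_lap:
  assumes e: "e > 0"
  shows "(\<integral>z. test_lap e z \<partial>lborel) = 0"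
proof -
  obtain B where B: "\<And>y. \<bar>test e (y - 0)\<bar> \<le> B" "\<And>y d. d > 0 \<Longrightarrow> \<bar>dlap d (\<lambda>y. test e (y - 0)) y\<bar> \<le> B"
    "\<And>y d. (\<And>j. d j > 0) \<Longrightarrow> d \<longlonglongrightarrow> 0 \<Longrightarrow> (\<lambda>j. dlap (d j) (\<lambda>y. test e (y - 0)) y) \<longlonglongrightarrow> test_lap e (y - 0)"
    using test_dlap[OF e, where a = 0] by blast
  define d where "d j = 1 / real (Suc j)" for j
  have d: "\<And>j. d j > 0" "d \<longlonglongrightarrow> 0" "\<And>j. d j \<le> 1"
    unfolding d_def by (simp, rule LIMSEQ_Suc[OF lim_1_over_n], simp)
  have [measurable]: "test e \<in> borel_measurable borel" by (rule borel_measurable_continuous_onI[OF continuous_test[OF e]])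
  have dm [measurable]: "dlap (d j) (test e) \<in> borel_measurable borel" for j
    unfolding dlap_def[abs_def] by measurable
  have lim: "(\<lambda>j. dlap (d j) (test e) y) \<longlonglongrightarrow> test_lap e y" for y
    using B(3)[of d y] d by simp
  have "(\<lambda>j. \<integral>z. dlap (d j) (test e) z \<partial>lborel) \<longlonglongrightarrow> (\<integral>z. test_lap e z \<partial>lborel)"
  proof (rule integral_tendsto_bounded_support[OF dm _ _ lim])
    show "\<bar>dlap (d j) (test e) z\<bar> \<le> B" for j z using B(2)[OF d(1), of j z] by simp
    show "dlap (d j) (test e) z = 0" if "z \<notin> cball 0 (r + 1)" for j z
      by (rule dlap_outside[where x = 0 and r = r, OF test_supp d(1)]) (use that d(3)[of j] in auto)
  qed
  moreover have "(\<integral>z. dlap (d j) (test e) z \<partial>lborel) = 0" for j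
  proof -
    have "(\<integral>x. test e x * dlap (d j) (\<lambda>_. 1) x \<partial>lborel) = (\<integral>x. 1 * dlap (d j) (test e) x \<partial>lborel)"
      using B(1) by (intro integral_dlap_swap[where B = 1 and R = r] test_supp) auto
    then show ?thesis by (simp add: dlap_def[of _ "\<lambda>_. 1"])
  qed
  ultimately show ?thesis by (simp add: LIMSEQ_const_iff)
qed

text \<open>The factor with which \<open>kap_ker\<close> tends to the Dirac measure. It is expressed
  through \<open>om\<close>, whose integral exists at \<open>e = 0\<close>; its positivity is read
  off from \<open>kap_ker\<close>.\<close>

definition \<kappa> where "\<kappa> = (\<integral>z. radial om 0 (z::real^'n) \<partial>lborel)"

lemma kernel_limit_integral:
  assumes "kernel_limit r Kn K"
  shows "(\<lambda>n. \<integral>z. Kn n z \<partial>lborel) \<longlonglongrightarrow> (\<integral>z. K z \<partial>lborel)"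
proof (rule Lim_transform)
  have i: "integrable lborel (Kn n)" "integrable lborel K" for n
    using assms kernel_limit_integrable by (auto simp: kernel_limit_def)
  show "(\<lambda>n. \<integral>z. K z \<partial>lborel) \<longlonglongrightarrow> (\<integral>z. K z \<partial>lborel)" by simp
  show "(\<lambda>n. (\<integral>z. Kn n z \<partial>lborel) - (\<integral>z. K z \<partial>lborel)) \<longlonglongrightarrow> 0"
  proof (rule Lim_null_comparison)
    show "(\<lambda>n. \<integral>z. \<bar>Kn n z - K z\<bar> \<partial>lborel) \<longlonglongrightarrow> 0" using assms by (simp add: kernel_limit_def)
    have "\<bar>(\<integral>z. Kn n z \<partial>lborel) - (\<integral>z. K z \<partial>lborel)\<bar> \<le> (\<integral>z. \<bar>Kn n z - K z\<bar> \<partial>lborel)" for n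
      unfolding Bochner_Integration.integral_diff[OF i, symmetric] by (rule integral_abs_bound)
    then show "\<forall>\<^sub>F n in sequentially. norm ((\<integral>z. Kn n z \<partial>lborel) - (\<integral>z. K z \<partial>lborel)) \<le> (\<integral>z. \<bar>Kn n z - K z\<bar> \<partial>lborel)"
      by simp
  qed
qed

context
  fixes e :: "nat \<Rightarrow> real"
  assumes e: "\<And>j. e j > 0" "\<And>j. e j \<le> 1" and e0: "e \<longlonglongrightarrow> 0"
begin

text \<open>The Laplacian of a test function has integral \<open>0\<close>, hence the concentrating mass is the mass of \<open>om\<close>.\<close>

lemma integral_kap_ker_lim: "(\<lambda>j. \<integral>z. kap_ker (e j) z \<partial>lborel) \<longlonglongrightarrow> \<kappa>"
proof -
  note ko = kernel_limit_om[of e, OF e(1) e0] and kl = kernel_limit_low[of e, OF e e0]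
  have "(\<integral>z. kap_ker (e j) z \<partial>lborel) = (\<integral>z. radial om (e j) (z::real^'n) \<partial>lborel) - (\<integral>z. low_ker (e j) z \<partial>lborel)" for j
    using integral_test_lap[OF e(1)[of j]] kernel_limit_integrable[OF ko, of j] kernel_limit_integrable[OF kl, of j] integrable_kap_ker[OF e(1)[of j]]
    by (simp add: test_lap_eq)
  moreover have "(\<lambda>j. (\<integral>z. radial om (e j) (z::real^'n) \<partial>lborel) - (\<integral>z. low_ker (e j) z \<partial>lborel)) \<longlonglongrightarrow> \<kappa> - (\<integral>z. 0 \<partial>(lborel :: (real^'n) measure))"
    unfolding \<kappa>_def by (intro tendsto_diff kernel_limit_integral ko kl)
  ultimately show ?thesis by simp
qed

end

end

section \<open>Concentration at the pole and the representation formula\<close>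

context parametrix
begin

text \<open>On the ball of radius \<open>e\<close> one has \<open>s \<le> 2 * e\<^sup>2\<close>, and
  the cutoff is at least \<open>(r\<^sup>2 / 2) ^ 4\<close>. The powers of \<open>e\<close> from the
  prefactor, the kernel and the volume cancel, so the lower bound is independent of \<open>e\<close>
  and passes to \<kappa>.\<close>

lemma integral_kap_ker_ge:
  assumes e: "e > 0" "e \<le> r / 2"
  shows "N * (N - 2) * 2 powr (\<alpha> - 2) * unit_ball_vol N * (r\<^sup>2 / 2) ^ 4 \<le> (\<integral>z. kap_ker e z \<partial>lborel)"
proof -
  define c where "c = e\<^sup>2 * (N * (N - 2) * (2 * e\<^sup>2) powr (\<alpha> - 2) * (r\<^sup>2 / 2) ^ 4)"
  have e2: "2 * e\<^sup>2 \<le> r\<^sup>2 / 2"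
    using power_mono[OF e(2), of 2] e(1) by (simp add: power_divide)
  have le: "c * indicator (cball 0 e) z \<le> kap_ker e z" for z
  proof (cases "z \<in> cball 0 e")
    case True
    define s where "s = (norm z)\<^sup>2 + e\<^sup>2"
    have s: "s > 0" using e by (simp add: s_def add_nonneg_pos)
    have "(norm z)\<^sup>2 \<le> e\<^sup>2" using True by (intro power_mono) auto
    then have s2: "s \<le> 2 * e\<^sup>2" by (simp add: s_def)
    have "(2 * e\<^sup>2) powr (\<alpha> - 2) \<le> s powr (\<alpha> - 2)" using \<alpha> s s2 by (intro powr_mono2') auto
    moreover have "(r\<^sup>2 / 2) ^ 4 \<le> q 4 s"
      unfolding q_def cutoff_def
    proof (rule power_mono)
      show "r\<^sup>2 / 2 \<le> max 0 (r\<^sup>2 - s)" using s2 e2 by (intro max.coboundedI2) linarith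
    qed simp
    ultimately have "c \<le> e\<^sup>2 * (N * (N - 2) * s powr (\<alpha> - 2) * q 4 s)"
      unfolding c_def using N3 by (intro mult_left_mono mult_mono) auto
    then show ?thesis using True by (simp add: kap_ker_def radial_def kap_def s_def)
  qed (simp add: kap_ker_nonneg)
  have "(\<integral>z. c * indicator (cball 0 e) z \<partial>(lborel :: (real^'n) measure)) \<le> (\<integral>z. kap_ker e z \<partial>lborel)"
    by (rule integral_mono[OF integrable_cmult_indicator_cball integrable_kap_ker[OF e(1)] le])
  moreover have "(\<integral>z. c * indicator (cball 0 e) z \<partial>(lborel :: (real^'n) measure)) = c * (unit_ball_vol N * e ^ CARD('n))"
    using e by (simp add: content_cball N[symmetric])
  moreover have "c * (unit_ball_vol N * e ^ CARD('n)) = N * (N - 2) * 2 powr (\<alpha> - 2) * unit_ball_vol N * (r\<^sup>2 / 2) ^ 4"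
  proof -
    have "(2 * e\<^sup>2) powr (\<alpha> - 2) = 2 powr (\<alpha> - 2) * (e\<^sup>2) powr (\<alpha> - 2)"
      using e by (simp add: powr_mult)
    also have "(e\<^sup>2) powr (\<alpha> - 2) = (e powr 2) powr (\<alpha> - 2)" using e by (simp add: powr_realpow)
    also have "\<dots> = e powr (2 * (\<alpha> - 2))" by (rule powr_powr)
    finally have 1: "(2 * e\<^sup>2) powr (\<alpha> - 2) = 2 powr (\<alpha> - 2) * e powr (2 * (\<alpha> - 2))" .
    have 2: "e\<^sup>2 = e powr 2" "e ^ CARD('n) = e powr N" using e by (simp_all add: powr_realpow N)
    have 3: "e powr 2 * e powr (2 * (\<alpha> - 2)) * e powr N = 1"
      unfolding powr_add[symmetric] using e by (simp add: \<alpha>_eq)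
    have "c * (unit_ball_vol N * e ^ CARD('n)) = (e\<^sup>2 * e powr (2 * (\<alpha> - 2)) * e ^ CARD('n)) * (N * (N - 2) * 2 powr (\<alpha> - 2) * unit_ball_vol N * (r\<^sup>2 / 2) ^ 4)"
      unfolding c_def 1 by (simp add: mult_ac)
    also have "e\<^sup>2 * e powr (2 * (\<alpha> - 2)) * e ^ CARD('n) = 1" using 3 by (simp only: 2)
    finally show ?thesis by simp
  qed
  ultimately show ?thesis by simp
qed

lemma \<kappa>_pos: "\<kappa> > 0"
proof -
  define e where "e j = min 1 (r / 2) / real (Suc j)" for j
  have e: "e j > 0" "e j \<le> 1" "e j \<le> r / 2" for j
  proof -
    have "e j \<le> min 1 (r / 2) / 1" unfolding e_def using r by (intro divide_left_mono) auto
    then show "e j \<le> 1" "e j \<le> r / 2" by auto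
  qed (use r in \<open>simp add: e_def\<close>)
  have "(\<lambda>j. min 1 (r / 2) * (1 / real (Suc j))) \<longlonglongrightarrow> min 1 (r / 2) * 0"
    by (intro tendsto_intros LIMSEQ_Suc[OF lim_1_over_n])
  then have e0: "e \<longlonglongrightarrow> 0" by (simp add: e_def[abs_def])
  have "N * (N - 2) * 2 powr (\<alpha> - 2) * unit_ball_vol N * (r\<^sup>2 / 2) ^ 4 \<le> \<kappa>"
    by (rule LIMSEQ_le_const[OF integral_kap_ker_lim[OF e(1,2) e0]]) (use integral_kap_ker_ge e in blast)
  moreover have "0 < N * (N - 2) * 2 powr (\<alpha> - 2) * unit_ball_vol N * (r\<^sup>2 / 2) ^ 4"
    using N3 r by (intro mult_pos_pos unit_ball_vol_pos zero_less_power) auto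
  ultimately show ?thesis by linarith
qed

lemma kap_ker_far:
  assumes "e > 0" "norm z \<ge> d" "d > 0"
  shows "kap_ker e z \<le> e\<^sup>2 * (N * (N - 2) * (d\<^sup>2) powr (\<alpha> - 2) * (r\<^sup>2) ^ 4) * indicator (cball 0 r) z"
proof (cases "z \<in> cball 0 r")
  case True
  define s where "s = (norm z)\<^sup>2 + e\<^sup>2"
  have "d\<^sup>2 \<le> (norm z)\<^sup>2" using assms by (intro power_mono) auto
  then have s: "d\<^sup>2 \<le> s" unfolding s_def by (rule add_increasing2[rotated]) simp
  have "s powr (\<alpha> - 2) \<le> (d\<^sup>2) powr (\<alpha> - 2)" using \<alpha> s assms by (intro powr_mono2') auto
  moreover have "q 4 s \<le> (r\<^sup>2) ^ 4" unfolding q_def by (rule cutoff_le) (auto simp: s_def)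
  ultimately have "e\<^sup>2 * (N * (N - 2) * s powr (\<alpha> - 2) * q 4 s) \<le> e\<^sup>2 * (N * (N - 2) * (d\<^sup>2) powr (\<alpha> - 2) * (r\<^sup>2) ^ 4)"
    using N3 by (intro mult_left_mono mult_mono) (auto simp: q_nonneg)
  then show ?thesis using True by (simp add: kap_ker_def radial_def kap_def s_def)
qed (simp add: kap_ker_supp)

text \<open>Approximate identity: subtracting \<open>w x\<close> leaves \<open>v\<close>, which is
  small near \<open>x\<close> by continuity at this one point, while at distance \<open>d\<close> or
  more the kernel is of order \<open>e\<^sup>2\<close> by \<open>kap_ker_far\<close>.\<close>

lemma cv_kap_ker_lim:
  fixes w :: "real^'n \<Rightarrow> real"
  assumes e: "\<And>j. e j > 0" "\<And>j. e j \<le> 1" and e0: "e \<longlonglongrightarrow> 0"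
    and w: "w \<in> borel_measurable borel" "\<And>y. \<bar>w y\<bar> \<le> B" and c: "isCont w x"
  shows "(\<lambda>j. cv (kap_ker (e j)) w x) \<longlonglongrightarrow> \<kappa> * w x"
proof -
  define v where "v y = w y - w x" for y
  have [measurable]: "w \<in> borel_measurable borel" by (rule w)
  have v: "v \<in> borel_measurable borel" "\<bar>v y\<bar> \<le> 2 * B" for y
  proof -
    show "v \<in> borel_measurable borel" unfolding v_def[abs_def] by measurable
    have "\<bar>v y\<bar> \<le> \<bar>w y\<bar> + \<bar>w x\<bar>" unfolding v_def by (rule abs_triangle_ineq4)
    then show "\<bar>v y\<bar> \<le> 2 * B" using w(2)[of y] w(2)[of x] by linarith
  qed
  have B: "0 \<le> B" using w(2)[of x] by linarith
  note ik = integrable_kap_ker[OF e(1)]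
  note ilim = integral_kap_ker_lim[OF e e0]
  have eq: "cv (kap_ker (e j)) w x = cv (kap_ker (e j)) v x + w x * (\<integral>z. kap_ker (e j) z \<partial>lborel)" for j
  proof -
    have "cv (kap_ker (e j)) w x = (\<integral>y. kap_ker (e j) (x - y) * v y + w x * kap_ker (e j) (x - y) \<partial>lborel)"
      unfolding cv_def by (intro Bochner_Integration.integral_cong refl) (simp add: v_def algebra_simps)
    also have "\<dots> = cv (kap_ker (e j)) v x + w x * (\<integral>y. kap_ker (e j) (x - y) \<partial>lborel)"
      using cv_integrable[OF ik v] lborel_integrable_reflect[OF ik, of j x] unfolding cv_def by simp
    also have "(\<integral>y. kap_ker (e j) (x - y) \<partial>lborel) = (\<integral>z. kap_ker (e j) z \<partial>lborel)"
      by (rule lborel_integral_reflect) (use ik in auto)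
    finally show ?thesis .
  qed
  have "(\<lambda>j. cv (kap_ker (e j)) v x) \<longlonglongrightarrow> 0"
  proof (rule LIMSEQ_I)
    fix \<eta>0 :: real assume \<eta>0: "\<eta>0 > 0"
    \<comment> \<open>This makes \<open>\<eta> * \<kappa>\<close>, the limit of the bound below, at
      most half of \<open>\<eta>0\<close>.\<close>
    define \<eta> where "\<eta> = \<eta>0 / (2 * (\<kappa> + 1))"
    have \<eta>: "\<eta> > 0" using \<eta>0 \<kappa>_pos by (simp add: \<eta>_def)
    obtain d where d: "d > 0" "\<And>y. dist y x < d \<Longrightarrow> \<bar>v y\<bar> < \<eta>"
      using c \<eta> unfolding continuous_at_eps_delta v_def dist_real_def by blast
    define V where "V = measure lborel (cball (0::real^'n) r)"
    define T where "T j = (e j)\<^sup>2 * (N * (N - 2) * (d\<^sup>2) powr (\<alpha> - 2) * (r\<^sup>2) ^ 4)" for j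
    have T: "T j \<ge> 0" for j using N3 by (simp add: T_def)
    have bnd: "\<bar>cv (kap_ker (e j)) v x\<bar> \<le> \<eta> * (\<integral>z. kap_ker (e j) z \<partial>lborel) + 2 * B * T j * V" for j
    proof -
      have "\<bar>cv (kap_ker (e j)) v x\<bar> \<le> (\<integral>y. \<bar>kap_ker (e j) (x - y) * v y\<bar> \<partial>lborel)"
        unfolding cv_def by (rule integral_abs_bound)
      also have "\<dots> \<le> (\<integral>y. \<eta> * kap_ker (e j) (x - y) + (2 * B * T j) * indicator (cball 0 r) (x - y) \<partial>lborel)"
      proof (rule integral_mono)
        show "integrable lborel (\<lambda>y. \<bar>kap_ker (e j) (x - y) * v y\<bar>)"
          using cv_integrable[OF ik v] by (rule integrable_abs)
        show "integrable lborel (\<lambda>y. \<eta> * kap_ker (e j) (x - y) + 2 * B * T j * indicator (cball 0 r) (x - y))"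
          by (intro Bochner_Integration.integrable_add Bochner_Integration.integrable_mult_right
            lborel_integrable_reflect[OF ik] lborel_integrable_reflect[OF integrable_indicator_cball])
        fix y
        show "\<bar>kap_ker (e j) (x - y) * v y\<bar> \<le> \<eta> * kap_ker (e j) (x - y) + 2 * B * T j * indicator (cball 0 r) (x - y)"
        proof (cases "dist y x < d")
          case True
          have "\<bar>kap_ker (e j) (x - y) * v y\<bar> = \<bar>v y\<bar> * kap_ker (e j) (x - y)"
            by (simp add: abs_mult kap_ker_nonneg mult.commute)
          also have "\<dots> \<le> \<eta> * kap_ker (e j) (x - y)"
            using d(2)[OF True] by (intro mult_right_mono kap_ker_nonneg) auto
          finally show ?thesis using B T[of j] by (simp add: add_increasing2)
        next
          case False
          then have "norm (x - y) \<ge> d" by (simp add: dist_norm norm_minus_commute)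
          then have "kap_ker (e j) (x - y) \<le> T j * indicator (cball 0 r) (x - y)"
            unfolding T_def by (rule kap_ker_far[OF e(1) _ d(1)])
          then have "\<bar>v y\<bar> * kap_ker (e j) (x - y) \<le> (2 * B) * (T j * indicator (cball 0 r) (x - y))"
            by (intro mult_mono v kap_ker_nonneg) (use B in auto)
          moreover have "0 \<le> \<eta> * kap_ker (e j) (x - y)" using \<eta> by (simp add: kap_ker_nonneg)
          ultimately show ?thesis by (simp add: abs_mult kap_ker_nonneg mult_ac)
        qed
      qed
      also have "\<dots> = \<eta> * (\<integral>y. kap_ker (e j) (x - y) \<partial>lborel) + (2 * B * T j) * (\<integral>y. indicator (cball 0 r) (x - y) \<partial>lborel)"
        using lborel_integrable_reflect[OF ik, of j x] lborel_integrable_reflect[OF integrable_indicator_cball[where R = r], of x]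
        by (subst Bochner_Integration.integral_add) auto
      also have "(\<integral>y. kap_ker (e j) (x - y) \<partial>lborel) = (\<integral>z. kap_ker (e j) z \<partial>lborel)"
        by (rule lborel_integral_reflect) (use ik in auto)
      also have "(\<integral>y. indicator (cball 0 r) (x - y) \<partial>lborel) = (\<integral>z. indicator (cball 0 r) z \<partial>(lborel :: (real^'n) measure) :: real)"
        by (rule lborel_integral_reflect) simp
      also have "\<dots> = V" by (simp add: V_def)
      finally show ?thesis .
    qed
    have "(\<lambda>j. \<eta> * (\<integral>z. kap_ker (e j) z \<partial>lborel) + 2 * B * T j * V) \<longlonglongrightarrow> \<eta> * \<kappa> + 2 * B * (0\<^sup>2 * (N * (N - 2) * (d\<^sup>2) powr (\<alpha> - 2) * (r\<^sup>2) ^ 4)) * V"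
      unfolding T_def by (intro tendsto_intros ilim e0)
    then have lim: "(\<lambda>j. \<eta> * (\<integral>z. kap_ker (e j) z \<partial>lborel) + 2 * B * T j * V) \<longlonglongrightarrow> \<eta> * \<kappa>" by simp
    have "\<eta> * \<kappa> \<le> \<eta> * (\<kappa> + 1)" using \<eta> by simp
    also have "\<dots> = \<eta>0 / 2" using \<kappa>_pos by (simp add: \<eta>_def field_simps)
    also have "\<dots> < \<eta>0" using \<eta>0 by simp
    finally have "\<forall>\<^sub>F j in sequentially. \<eta> * (\<integral>z. kap_ker (e j) z \<partial>lborel) + 2 * B * T j * V < \<eta>0"
      by (rule order_tendstoD(2)[OF lim])
    then obtain j0 where "\<And>j. j \<ge> j0 \<Longrightarrow> \<eta> * (\<integral>z. kap_ker (e j) z \<partial>lborel) + 2 * B * T j * V < \<eta>0"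
      by (auto simp: eventually_sequentially)
    then have "norm (cv (kap_ker (e j)) v x - 0) < \<eta>0" if "j \<ge> j0" for j
      using le_less_trans[OF bnd[of j]] that by simp
    then show "\<exists>j0. \<forall>j\<ge>j0. norm (cv (kap_ker (e j)) v x - 0) < \<eta>0" by blast
  qed
  then have "(\<lambda>j. cv (kap_ker (e j)) v x + w x * (\<integral>z. kap_ker (e j) z \<partial>lborel)) \<longlonglongrightarrow> 0 + w x * \<kappa>"
    by (intro tendsto_intros ilim)
  then show ?thesis by (simp add: eq mult.commute)
qed

lemma kernel_limit_cv_lim:
  assumes "kernel_limit r' Kn K" and g: "g \<in> borel_measurable borel" "\<And>y. \<bar>g y\<bar> \<le> B"
  shows "(\<lambda>n. cv (Kn n) g x) \<longlonglongrightarrow> cv K g (x :: real^'n)"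
proof (rule LIMSEQ_I)
  fix e :: real assume e: "e > 0"
  have "\<forall>\<^sub>F n in sequentially. \<bar>cv (Kn n) g x - cv K g x\<bar> < e"
    using kernel_limit_cv_uniform[OF assms e] by (rule eventually_mono) simp
  then show "\<exists>N. \<forall>n\<ge>N. norm (cv (Kn n) g x - cv K g x) < e" by (simp add: eventually_sequentially)
qed

text \<open>The weak equation is tested with the regularized kernel centred at \<open>x\<close>. As
  \<open>e\<close> tends to \<open>0\<close>, the three parts of \<open>test_lap\<close> converge to
  \<open>radial om 0\<close>, to minus \<kappa> times the Dirac measure, and to
  \<open>0\<close>.\<close>

lemma representation:
  fixes w g :: "real^'n \<Rightarrow> real"
  assumes w: "w \<in> borel_measurable borel" "\<And>y. \<bar>w y\<bar> \<le> B" and c: "isCont w x"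
    and g: "g \<in> borel_measurable borel" "\<And>y. \<bar>g y\<bar> \<le> B'"
    and weak: "\<And>e. e > 0 \<Longrightarrow> (\<integral>y. w y * test_lap e (y - x) \<partial>lborel) = (\<integral>y. g y * test e (y - x) \<partial>lborel)"
  shows "\<kappa> * w x = cv (radial om 0) w x - cv (radial F 0) g x"
proof -
  define e where "e j = 1 / real (Suc j)" for j
  have e: "\<And>j. e j > 0" "\<And>j. e j \<le> 1" "e \<longlonglongrightarrow> 0"
    unfolding e_def by (simp, simp, rule LIMSEQ_Suc[OF lim_1_over_n])
  note ko = kernel_limit_om[of e, OF e(1,3)] and kF = kernel_limit_F[of e, OF e(1,3)]
    and kl = kernel_limit_low[of e, OF e]
  have even: "test_lap (e j) (y - x) = radial om (e j) (x - y) - kap_ker (e j) (x - y) - low_ker (e j) (x - y)"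
    "test (e j) (y - x) = radial F (e j) (x - y)" for j y
    unfolding test_lap_eq kap_ker_def low_ker_def test_def radial_even[of _ _ x y] by simp_all
  have "cv (radial om (e j)) w x - cv (kap_ker (e j)) w x - cv (low_ker (e j)) w x = cv (radial F (e j)) g x" for j
  proof -
    have "cv (radial F (e j)) g x = (\<integral>y. g y * test (e j) (y - x) \<partial>lborel)"
      unfolding cv_def even by (simp add: mult.commute)
    also have "\<dots> = (\<integral>y. w y * test_lap (e j) (y - x) \<partial>lborel)" using weak[OF e(1)] by simp
    also have "\<dots> = (\<integral>y. radial om (e j) (x - y) * w y - kap_ker (e j) (x - y) * w y - low_ker (e j) (x - y) * w y \<partial>lborel)"
      unfolding even by (simp add: algebra_simps)
    also have "\<dots> = cv (radial om (e j)) w x - cv (kap_ker (e j)) w x - cv (low_ker (e j)) w x"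
      unfolding cv_def
      using cv_integrable[OF kernel_limit_integrable[OF ko] w, of j x] cv_integrable[OF kernel_limit_integrable[OF kl] w, of j x]
        cv_integrable[OF integrable_kap_ker[OF e(1)] w, of j x] by simp
    finally show ?thesis by simp
  qed
  moreover have "(\<lambda>j. cv (radial om (e j)) w x - cv (kap_ker (e j)) w x - cv (low_ker (e j)) w x)
     \<longlonglongrightarrow> cv (radial om 0) w x - \<kappa> * w x - cv (\<lambda>_. 0) w x"
    by (intro tendsto_diff kernel_limit_cv_lim[OF ko w] kernel_limit_cv_lim[OF kl w] cv_kap_ker_lim[OF e w c])
  moreover have "(\<lambda>j. cv (radial F (e j)) g x) \<longlonglongrightarrow> cv (radial F 0) g x"
    by (rule kernel_limit_cv_lim[OF kF g])
  ultimately have "cv (radial om 0) w x - \<kappa> * w x - cv (\<lambda>_. 0) w x = cv (radial F 0) g x"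
    using LIMSEQ_unique by simp
  then show ?thesis by (simp add: cv_def)
qed

end

section \<open>Calculus of continuously differentiable functions\<close>

lemma partial_eq:
  assumes "(f has_derivative f') (at x)"
  shows "partial i f x = f' (axis i 1)"
  using frechet_derivative_at[OF assms] by (simp add: partial_def)

lemma partial_line_derivative:
  assumes "f differentiable at x"
  shows "((\<lambda>t. f (x + t *\<^sub>R axis i 1)) has_real_derivative partial i f x) (at 0)"
proof -
  have f: "(f has_derivative frechet_derivative f (at x)) (at (x + 0 *\<^sub>R axis i 1))"
    using assms by (simp add: frechet_derivative_works)
  have "((\<lambda>t. x + t *\<^sub>R axis i 1) has_derivative (\<lambda>s. s *\<^sub>R axis i 1)) (at 0)"
    by (auto intro!: derivative_eq_intros)
  from has_derivative_compose[OF this f]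
  have "((\<lambda>t. f (x + t *\<^sub>R axis i 1)) has_derivative (\<lambda>s. frechet_derivative f (at x) (s *\<^sub>R axis i 1))) (at 0)" .
  moreover have "(\<lambda>s. frechet_derivative f (at x) (s *\<^sub>R axis i 1)) = (*) (partial i f x)"
    using linear_cmul[OF linear_frechet_derivative[OF assms]] by (simp add: fun_eq_iff partial_def)
  ultimately show ?thesis unfolding has_field_derivative_def by simp
qed

lemma partial_line_derivative':
  assumes "f differentiable at (x + t *\<^sub>R axis i 1)"
  shows "((\<lambda>t. f (x + t *\<^sub>R axis i 1)) has_real_derivative partial i f (x + t *\<^sub>R axis i 1)) (at t)"
proof -
  have "((\<lambda>s. f (x + t *\<^sub>R axis i 1 + s *\<^sub>R axis i 1)) has_real_derivative partial i f (x + t *\<^sub>R axis i 1)) (at 0)"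
    by (rule partial_line_derivative[OF assms])
  then have "((\<lambda>s. f (x + (s + t) *\<^sub>R axis i 1)) has_real_derivative partial i f (x + t *\<^sub>R axis i 1)) (at 0)"
    by (simp add: scaleR_left_distrib add_ac)
  then show ?thesis using DERIV_shift[of "\<lambda>t. f (x + t *\<^sub>R axis i 1)" "partial i f (x + t *\<^sub>R axis i 1)" 0 t] by simp
qed

lemma differentiable_transform_open:
  assumes "open U" "x \<in> U" "\<And>x. x \<in> U \<Longrightarrow> f x = g x" "f differentiable (at x)"
  shows "g differentiable (at x)" "partial i g x = partial i f x"
proof -
  obtain f' where f': "(f has_derivative f') (at x)" using assms(4) by (auto simp: differentiable_def)
  then have g': "(g has_derivative f') (at x)"
    by (rule has_derivative_transform_within_open[OF _ assms(1,2)]) (rule assms(3))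
  then show "g differentiable (at x)" by (auto simp: differentiable_def)
  show "partial i g x = partial i f x" by (simp only: partial_eq[OF g'] partial_eq[OF f'])
qed

lemma C_k_on_cong:
  assumes "open U" "C_k_on k U f" "\<And>x. x \<in> U \<Longrightarrow> f x = g x"
  shows "C_k_on k U g"
  using assms(2,3)
proof (induction k arbitrary: f g)
  case 0
  then show ?case using continuous_on_cong[of U U f g] by simp
next
  case (Suc k)
  note t = differentiable_transform_open[OF assms(1) _ Suc.prems(2)]
  have "C_k_on k U (partial i g)" for i
    by (rule Suc.IH[of "partial i f"]) (use Suc.prems(1) t(2) in auto)
  then show ?case using Suc.prems(1) t(1) by auto
qed

lemma C_k_on_Suc: "C_k_on (Suc k) U f \<Longrightarrow> C_k_on k U f"
proof (induction k arbitrary: f)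
  case 0
  then have "f differentiable (at x)" if "x \<in> U" for x using that by simp
  then have "f differentiable_on U" using differentiable_at_imp_differentiable_on by blast
  then show ?case using differentiable_imp_continuous_on by simp
next
  case (Suc k)
  have "C_k_on k U (partial i f)" for i by (rule Suc.IH) (use Suc.prems in simp)
  then show ?case using Suc.prems by simp
qed

lemma C_k_on_le: "C_k_on k U f \<Longrightarrow> j \<le> k \<Longrightarrow> C_k_on j U f"
  by (induction k) (use C_k_on_Suc le_Suc_eq in \<open>blast+\<close>)

lemma C_k_on_differentiable: "C_k_on k U f \<Longrightarrow> k > 0 \<Longrightarrow> x \<in> U \<Longrightarrow> f differentiable (at x)"
  by (cases k) auto

lemma C_k_on_continuous: "C_k_on k U f \<Longrightarrow> continuous_on U f"
  using C_k_on_le[of k U f 0] by simp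

text \<open>Derivatives at a point do not depend on the surrounding set, so neighbourhoods with
  different radii can be put together.\<close>

lemma C_k_on_local:
  assumes "\<And>x. x \<in> U \<Longrightarrow> \<exists>V. open V \<and> x \<in> V \<and> C_k_on k V f"
  shows "C_k_on k U f"
  using assms
proof (induction k arbitrary: f)
  case 0
  have "isCont f x" if "x \<in> U" for x
    using 0[OF that] by (auto simp: continuous_on_eq_continuous_at)
  then show ?case by (simp add: continuous_at_imp_continuous_on)
next
  case (Suc k)
  have "C_k_on k U (partial i f)" for i
    by (rule Suc.IH) (use Suc.prems in fastforce)
  moreover have "f differentiable (at x)" if "x \<in> U" for x using Suc.prems[OF that] by auto
  ultimately show ?case by simp
qed

lemma C_k_on_const: "C_k_on k U (\<lambda>_ :: real^'n. c)"
proof (induction k arbitrary: c)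
  case (Suc k)
  have "partial i (\<lambda>_ :: real^'n. c) = (\<lambda>_. 0)" for i
    using partial_eq[OF has_derivative_const] by auto
  then show ?case using Suc by simp
qed simp

lemma partial_add:
  assumes "f differentiable (at x)" "g differentiable (at x)"
  shows "partial i (\<lambda>x. f x + g x) x = partial i f x + partial i g x"
  using partial_eq[OF has_derivative_add[OF assms[unfolded frechet_derivative_works]]] by (simp add: partial_def)

lemma partial_mult:
  fixes f g :: "real^'n \<Rightarrow> real"
  assumes "f differentiable (at x)" "g differentiable (at x)"
  shows "partial i (\<lambda>x. f x * g x) x = f x * partial i g x + partial i f x * g x"
  using partial_eq[OF has_derivative_mult[OF assms[unfolded frechet_derivative_works]]] by (simp add: partial_def)

lemma partial_chain:
  fixes f :: "real^'n \<Rightarrow> real"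
  assumes "f differentiable (at x)" "(h has_real_derivative h') (at (f x))"
  shows "partial i (\<lambda>x. h (f x)) x = h' * partial i f x" "(\<lambda>x. h (f x)) differentiable (at x)"
proof -
  have "((\<lambda>x. h (f x)) has_derivative (\<lambda>v. h' * frechet_derivative f (at x) v)) (at x)"
    using has_derivative_compose[OF assms(1)[unfolded frechet_derivative_works] assms(2)[unfolded has_field_derivative_def]] .
  then show "partial i (\<lambda>x. h (f x)) x = h' * partial i f x" "(\<lambda>x. h (f x)) differentiable (at x)"
    using partial_eq by (auto simp: partial_def differentiable_def)
qed

lemma C_k_on_add:
  assumes "open U" "C_k_on k U f" "C_k_on k U g"
  shows "C_k_on k U (\<lambda>x. f x + g x)"
  using assms(2,3)
proof (induction k arbitrary: f g)
  case 0
  then show ?case by (simp add: continuous_on_add)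
next
  case (Suc k)
  have "C_k_on k U (partial i (\<lambda>x. f x + g x))" for i
  proof (rule C_k_on_cong[OF assms(1)])
    show "C_k_on k U (\<lambda>x. partial i f x + partial i g x)" using Suc by simp
    show "partial i f x + partial i g x = partial i (\<lambda>x. f x + g x) x" if "x \<in> U" for x
      using Suc.prems that by (simp add: partial_add)
  qed
  then show ?case using Suc.prems by auto
qed

lemma C_k_on_mult:
  assumes "open U" "C_k_on k U f" "C_k_on k U g"
  shows "C_k_on k U (\<lambda>x. f x * g x)"
  using assms(2,3)
proof (induction k arbitrary: f g)
  case 0
  then show ?case by (simp add: continuous_on_mult)
next
  case (Suc k)
  have "C_k_on k U (partial i (\<lambda>x. f x * g x))" for i
  proof (rule C_k_on_cong[OF assms(1)])
    have "C_k_on k U (partial i f)" "C_k_on k U (partial i g)" using Suc.prems by auto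
    then show "C_k_on k U (\<lambda>x. f x * partial i g x + partial i f x * g x)"
      by (rule C_k_on_add[OF assms(1) Suc.IH[OF C_k_on_Suc[OF Suc.prems(1)]] Suc.IH[OF _ C_k_on_Suc[OF Suc.prems(2)]], rotated])
    show "f x * partial i g x + partial i f x * g x = partial i (\<lambda>x. f x * g x) x" if "x \<in> U" for x
      using Suc.prems that by (simp add: partial_mult)
  qed
  then show ?case using Suc.prems by auto
qed

text \<open>The induction is over all exponents at once, because differentiation lowers the
  exponent.\<close>

lemma C_k_on_powr:
  assumes "open U" "C_k_on k U f" and pos: "\<And>x. x \<in> U \<Longrightarrow> f x > 0"
  shows "C_k_on k U (\<lambda>x. f x powr a)"
  using assms(2)
proof (induction k arbitrary: a)
  case 0
  then show ?case using pos by (auto intro!: continuous_on_powr simp: less_imp_neq[THEN not_sym])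
next
  case (Suc k)
  have d: "((\<lambda>u. u powr a) has_real_derivative a * f x powr (a - 1)) (at (f x))" if "x \<in> U" for x
    using pos[OF that] by (rule has_real_derivative_powr)
  have df: "f differentiable (at x)" if "x \<in> U" for x using Suc.prems that by simp
  have "C_k_on k U (partial i (\<lambda>x. f x powr a))" for i
  proof (rule C_k_on_cong[OF assms(1)])
    have "C_k_on k U (\<lambda>x. f x powr (a - 1))" by (rule Suc.IH[OF C_k_on_Suc[OF Suc.prems]])
    then show "C_k_on k U (\<lambda>x. (a * f x powr (a - 1)) * partial i f x)"
      using Suc.prems by (intro C_k_on_mult[OF assms(1)] C_k_on_const) auto
    show "(a * f x powr (a - 1)) * partial i f x = partial i (\<lambda>x. f x powr a) x" if "x \<in> U" for x
      using partial_chain(1)[OF df[OF that] d[OF that]] by simp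
  qed
  then show ?case using partial_chain(2)[OF df d] by auto
qed

lemma partial_ln:
  assumes "f differentiable (at x)" "f x > 0"
  shows "partial i (\<lambda>x. ln (f x)) x = partial i f x * f x powr (- 1)" "(\<lambda>x. ln (f x)) differentiable (at x)"
proof -
  have d: "(ln has_real_derivative 1 / f x) (at (f x))" using assms(2) by (auto intro!: derivative_eq_intros)
  show "partial i (\<lambda>x. ln (f x)) x = partial i f x * f x powr (- 1)" "(\<lambda>x. ln (f x)) differentiable (at x)"
    using partial_chain[OF assms(1) d] assms(2) by (simp_all add: powr_minus divide_inverse mult.commute)
qed

lemma C_k_on_ln:
  assumes "open U" "C_k_on k U f" and pos: "\<And>x. x \<in> U \<Longrightarrow> f x > 0"
  shows "C_k_on k U (\<lambda>x. ln (f x))"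
proof (cases k)
  case 0
  then show ?thesis using assms by (auto intro!: continuous_on_ln simp: less_imp_neq[THEN not_sym])
next
  case (Suc m)
  have f: "C_k_on (Suc m) U f" using assms(2) Suc by simp
  have "C_k_on m U (partial i (\<lambda>x. ln (f x)))" for i
  proof (rule C_k_on_cong[OF assms(1)])
    show "C_k_on m U (\<lambda>x. partial i f x * f x powr (- 1))"
      using f by (intro C_k_on_mult[OF assms(1)] C_k_on_powr[OF assms(1) C_k_on_Suc[OF f] pos]) auto
    show "partial i f x * f x powr (- 1) = partial i (\<lambda>x. ln (f x)) x" if "x \<in> U" for x
      using f that pos by (simp add: partial_ln(1))
  qed
  moreover have "(\<lambda>x. ln (f x)) differentiable (at x)" if "x \<in> U" for x
    using f that pos by (simp add: partial_ln(2))
  ultimately show ?thesis using Suc by simp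
qed

section \<open>Interior regularity of convolutions\<close>

lemma cv_reflect:
  fixes g :: "'a::euclidean_space \<Rightarrow> real"
  assumes [measurable]: "K \<in> borel_measurable borel" "g \<in> borel_measurable borel"
  shows "cv K g x = (\<integral>z. K z * g (x - z) \<partial>lborel)"
  using lborel_integral_reflect[of "\<lambda>z. K z * g (x - z)" x] by (simp add: cv_def)

lemma indicator_mult_measurable:
  fixes g :: "real^'n \<Rightarrow> real"
  assumes "open U" "continuous_on U g"
  shows "(\<lambda>y. indicator U y * g y) \<in> borel_measurable borel"
  using borel_measurable_continuous_on_indicator[of U g] assms by simp

lemma bounded_on_precompact:
  fixes g :: "real^'n \<Rightarrow> real"
  assumes "continuous_on U' g" "closure U \<subseteq> U'" "bounded U"
  obtains B where "\<And>y. y \<in> U \<Longrightarrow> \<bar>g y\<bar> \<le> B"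
proof -
  have "compact (g ` closure U)"
    using assms by (intro compact_continuous_image[OF continuous_on_subset[OF assms(1)]]) auto
  then have "bounded (g ` closure U)" by (rule compact_imp_bounded)
  then obtain B where "\<forall>y\<in>g ` closure U. norm y \<le> B" unfolding bounded_iff by blast
  then have "\<bar>g y\<bar> \<le> B" if "y \<in> U" for y using that closure_subset[of U] by auto
  then show ?thesis by (rule that)
qed

text \<open>Here the derivative falls on \<open>g\<close>. The indicator jumps at the boundary of
  \<open>U\<close>, but the kernel has radius \<open>r\<close> and \<open>cball x r\<close> stays in
  \<open>U\<close> for \<open>x\<close> in \<open>V\<close>, so the jump is not seen.
  Differentiability is assumed, as it comes from the kernel; hence the limit along one sequence of
  difference quotients identifies the partial derivative.\<close>

lemma cv_partial:
  fixes g :: "real^'n \<Rightarrow> real"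
  assumes K: "integrable lborel K" and supp: "\<And>z. z \<notin> cball 0 r \<Longrightarrow> K z = 0"
    and U: "open U" "bounded U" "closure U \<subseteq> U'" and V: "open V" "\<And>x. x \<in> V \<Longrightarrow> cball x r \<subseteq> U"
    and g: "C_k_on 1 U' g" and x: "x \<in> V"
    and diff: "cv K (\<lambda>y. indicator U y * g y) differentiable (at x)"
  shows "partial i (cv K (\<lambda>y. indicator U y * g y)) x = cv K (\<lambda>y. indicator U y * partial i g y) x"
proof -
  let ?G = "\<lambda>y. indicator U y * g y :: real"
  have UU': "U \<subseteq> U'" using U(3) closure_subset by blast
  have gU: "continuous_on U' g" "continuous_on U' (partial i g)"
    using C_k_on_continuous[OF g] g by auto
  have [measurable]: "K \<in> borel_measurable borel" using K by auto
  have G [measurable]: "?G \<in> borel_measurable borel" "(\<lambda>y. indicator U y * partial i g y :: real) \<in> borel_measurable borel"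
    using gU UU' continuous_on_subset by (blast intro: indicator_mult_measurable[OF U(1)])+
  obtain B where B: "\<And>y. y \<in> U \<Longrightarrow> \<bar>g y\<bar> \<le> B" using bounded_on_precompact[OF gU(1) U(3,2)] by blast
  obtain B1 where B1: "\<And>y. y \<in> U \<Longrightarrow> \<bar>partial i g y\<bar> \<le> B1" using bounded_on_precompact[OF gU(2) U(3,2)] by blast
  have GB: "\<bar>?G y\<bar> \<le> \<bar>B\<bar>" for y using B[of y] by (cases "y \<in> U") auto
  have dg: "g differentiable (at y)" if "y \<in> U" for y using g that UU' by auto
  obtain d where d: "d > 0" "ball x d \<subseteq> V" using V(1) x openE by blast
  define t where "t m = (d / 2) * (1 / real (Suc m))" for m
  have t: "t m > 0" "t m < d" for m
  proof -
    show "t m > 0" using d by (simp add: t_def)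
    have "t m \<le> (d / 2) * 1" unfolding t_def using d by (intro mult_left_mono) auto
    then show "t m < d" using d by simp
  qed
  have "(\<lambda>m. (d / 2) * (1 / real (Suc m))) \<longlonglongrightarrow> (d / 2) * 0"
    by (intro tendsto_intros LIMSEQ_Suc[OF lim_1_over_n])
  then have t0: "t \<longlonglongrightarrow> 0" by (simp add: t_def[abs_def])
  have t0': "filterlim t (at 0) sequentially"
    using t0 t(1) by (auto simp: filterlim_at less_imp_neq[THEN not_sym])
  have seg: "x + s *\<^sub>R axis i 1 - z \<in> U" if "\<bar>s\<bar> < d" "z \<in> cball 0 r" for s z
  proof -
    have "x + s *\<^sub>R axis i 1 \<in> V" using that d(2) by (auto simp: dist_norm)
    then have "cball (x + s *\<^sub>R axis i 1) r \<subseteq> U" by (rule V(2))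
    then show ?thesis using that by (auto simp: dist_norm)
  qed
  have "((\<lambda>s. (cv K ?G (x + s *\<^sub>R axis i 1) - cv K ?G x) / s) \<longlongrightarrow> partial i (cv K ?G) x) (at 0)"
    using partial_line_derivative[OF diff, of i] by (simp add: DERIV_def)
  then have lim1: "(\<lambda>m. (cv K ?G (x + t m *\<^sub>R axis i 1) - cv K ?G x) / t m) \<longlonglongrightarrow> partial i (cv K ?G) x"
    by (rule filterlim_compose[OF _ t0'])
  have eq: "(cv K ?G (x + t m *\<^sub>R axis i 1) - cv K ?G x) / t m =
     (\<integral>z. K z * ((?G (x + t m *\<^sub>R axis i 1 - z) - ?G (x - z)) / t m) \<partial>lborel)" for m
  proof -
    have i: "integrable lborel (\<lambda>z. K z * ?G (y - z))" for y
      using lborel_integrable_reflect[OF cv_integrable[OF K G(1) GB, of y], of y] by simp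
    show ?thesis unfolding cv_reflect[OF \<open>K \<in> borel_measurable borel\<close> G(1)]
      using i[of "x + t m *\<^sub>R axis i 1"] i[of x] by (simp add: right_diff_distrib diff_divide_distrib)
  qed
  have line: "((\<lambda>s. g (x + s *\<^sub>R axis i 1 - z)) has_real_derivative partial i g (x + s *\<^sub>R axis i 1 - z)) (at s)"
    if "\<bar>s\<bar> < d" "z \<in> cball 0 r" for s z
    using partial_line_derivative'[of g "x - z" s i] dg[OF seg[OF that]] by (simp add: algebra_simps)
  have lim2: "(\<lambda>m. \<integral>z. K z * ((?G (x + t m *\<^sub>R axis i 1 - z) - ?G (x - z)) / t m) \<partial>lborel) \<longlonglongrightarrow>
     (\<integral>z. K z * (indicator U (x - z) * partial i g (x - z)) \<partial>lborel)"
  proof (rule integral_dominated_convergence[where w = "\<lambda>z. \<bar>B1\<bar> * \<bar>K z\<bar>"])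
    show "integrable lborel (\<lambda>z. \<bar>B1\<bar> * \<bar>K z\<bar>)"
      using K by (intro Bochner_Integration.integrable_mult_right integrable_abs)
    show "AE z in lborel. (\<lambda>m. K z * ((?G (x + t m *\<^sub>R axis i 1 - z) - ?G (x - z)) / t m)) \<longlonglongrightarrow>
        K z * (indicator U (x - z) * partial i g (x - z))"
    proof (rule AE_I2)
      fix z :: "real^'n"
      show "(\<lambda>m. K z * ((?G (x + t m *\<^sub>R axis i 1 - z) - ?G (x - z)) / t m)) \<longlonglongrightarrow>
        K z * (indicator U (x - z) * partial i g (x - z))"
      proof (cases "z \<in> cball 0 r")
        case True
        have in0: "x - z \<in> U" using seg[of 0 z] True d by simp
        have inm: "x + t m *\<^sub>R axis i 1 - z \<in> U" for m using seg[of "t m" z] True t[of m] by simp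
        have "((\<lambda>s. (g (x + s *\<^sub>R axis i 1 - z) - g (x - z)) / s) \<longlongrightarrow> partial i g (x - z)) (at 0)"
          using line[of 0 z] True d by (simp add: DERIV_def)
        then have "(\<lambda>m. (g (x + t m *\<^sub>R axis i 1 - z) - g (x - z)) / t m) \<longlonglongrightarrow> partial i g (x - z)"
          by (rule filterlim_compose[OF _ t0'])
        then show ?thesis using in0 inm by (intro tendsto_mult tendsto_const) simp
      qed (simp add: supp)
    qed
    show "AE z in lborel. norm (K z * ((?G (x + t m *\<^sub>R axis i 1 - z) - ?G (x - z)) / t m)) \<le> \<bar>B1\<bar> * \<bar>K z\<bar>" for m
    proof (rule AE_I2)
      fix z :: "real^'n"
      show "norm (K z * ((?G (x + t m *\<^sub>R axis i 1 - z) - ?G (x - z)) / t m)) \<le> \<bar>B1\<bar> * \<bar>K z\<bar>"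
      proof (cases "z \<in> cball 0 r")
        case True
        have in0: "x - z \<in> U" using seg[of 0 z] True d by simp
        have inm: "x + t m *\<^sub>R axis i 1 - z \<in> U" using seg[of "t m" z] True t[of m] by simp
        obtain s where s: "0 < s" "s < t m" "g (x + t m *\<^sub>R axis i 1 - z) - g (x + 0 *\<^sub>R axis i 1 - z) = (t m - 0) * partial i g (x + s *\<^sub>R axis i 1 - z)"
          using MVT2[of 0 "t m" "\<lambda>s. g (x + s *\<^sub>R axis i 1 - z)" "\<lambda>s. partial i g (x + s *\<^sub>R axis i 1 - z)"] line[OF _ True] t[of m] by auto
        have "(?G (x + t m *\<^sub>R axis i 1 - z) - ?G (x - z)) / t m = partial i g (x + s *\<^sub>R axis i 1 - z)"
          using s in0 inm t(1)[of m] by simp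
        moreover have "\<bar>partial i g (x + s *\<^sub>R axis i 1 - z)\<bar> \<le> \<bar>B1\<bar>"
          using B1[OF seg[of s z]] s t(2)[of m] True by simp
        ultimately show ?thesis by (simp add: abs_mult mult.commute[of "\<bar>B1\<bar>"] mult_left_mono)
      qed (simp add: supp)
    qed
  qed measurable
  have "partial i (cv K ?G) x = (\<integral>z. K z * (indicator U (x - z) * partial i g (x - z)) \<partial>lborel)"
    using LIMSEQ_unique[OF lim1[unfolded eq] lim2] .
  then show ?thesis unfolding cv_reflect[OF \<open>K \<in> borel_measurable borel\<close> G(2)] .
qed

context singular_profile
begin

lemma cv_profile_differentiable:
  fixes g :: "real^'n \<Rightarrow> real"
  assumes g: "g \<in> borel_measurable borel" "\<And>y. \<bar>g y\<bar> \<le> C" and gs: "\<And>y. y \<notin> cball 0 R \<Longrightarrow> g y = 0"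
  shows "C_k_on 1 V (cv (radial (profile \<alpha> Q) 0) g)"
proof -
  note d = cv_profile[OF g gs]
  have p: "partial i (cv (radial (profile \<alpha> Q) 0) g) = cv (\<lambda>z. 2 * z $ i * radial (profile' \<alpha> Q Q') 0 z) g" for i
  proof
    fix x
    show "partial i (cv (radial (profile \<alpha> Q) 0) g) x = cv (\<lambda>z. 2 * z $ i * radial (profile' \<alpha> Q Q') 0 z) g x"
      using partial_eq[OF d(1)[where x = x], where i = i] by (simp add: axis_def if_distrib[of "\<lambda>c. c * _"] cong: if_cong)
  qed
  have "continuous_on V (partial i (cv (radial (profile \<alpha> Q) 0) g))" for i
    unfolding p by (rule continuous_on_subset[OF d(2) subset_UNIV])
  moreover have "cv (radial (profile \<alpha> Q) 0) g differentiable (at x)" for x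
    using d(1) by (auto simp: differentiable_def)
  ultimately show ?thesis by simp
qed

lemma cv_profile_C_1:
  fixes g :: "real^'n \<Rightarrow> real"
  assumes U: "open U" "bounded U" "closure U \<subseteq> U'" and gc: "continuous_on U' g"
  shows "C_k_on 1 V (cv (radial (profile \<alpha> Q) 0) (\<lambda>y. indicator U y * g y))"
proof -
  have UU': "U \<subseteq> U'" using U(3) closure_subset by blast
  obtain B where B: "\<And>y. y \<in> U \<Longrightarrow> \<bar>g y\<bar> \<le> B" using bounded_on_precompact[OF gc U(3,2)] by blast
  obtain a where "\<forall>x\<in>U. norm x \<le> a" using U(2) unfolding bounded_iff by blast
  then have R: "U \<subseteq> cball 0 a" by auto
  show ?thesis
  proof (rule cv_profile_differentiable)
    show "(\<lambda>y. indicator U y * g y) \<in> borel_measurable borel"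
      by (rule indicator_mult_measurable[OF U(1) continuous_on_subset[OF gc UU']])
    show "\<bar>indicator U y * g y\<bar> \<le> \<bar>B\<bar>" for y using B[of y] by (cases "y \<in> U") auto
    show "indicator U y * g y = 0" if "y \<notin> cball 0 a" for y
    proof -
      have "y \<notin> U" using R that by blast
      then show ?thesis by simp
    qed
  qed
qed

text \<open>The kernel provides the first derivative, \<open>cv_partial\<close> moves it to
  \<open>g\<close>, and the induction hypothesis applies to \<open>partial i g\<close>. Altogether
  \<open>k\<close> derivatives fall on \<open>g\<close> and one on the kernel.\<close>

lemma cv_profile_C_k:
  fixes g :: "real^'n \<Rightarrow> real"
  assumes U: "open U" "bounded U" "closure U \<subseteq> U'" and V: "open V" "\<And>x. x \<in> V \<Longrightarrow> cball x r \<subseteq> U"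
    and g: "C_k_on k U' g"
  shows "C_k_on (Suc k) V (cv (radial (profile \<alpha> Q) 0) (\<lambda>y. indicator U y * g y))"
  using g
proof (induction k arbitrary: g)
  case 0
  then show ?case using cv_profile_C_1[OF U, of g V] by (simp only: C_k_on.simps(1) One_nat_def)
next
  case (Suc k)
  have gc: "continuous_on U' g" by (rule C_k_on_continuous[OF Suc.prems])
  have dif: "cv (radial (profile \<alpha> Q) 0) (\<lambda>y. indicator U y * g y) differentiable (at x)" if "x \<in> V" for x
    by (rule C_k_on_differentiable[OF cv_profile_C_1[OF U gc] _ that]) simp
  have K: "integrable lborel (radial (profile \<alpha> Q) 0 :: real^'n \<Rightarrow> real)"
  proof -
    have "kernel_limit r (\<lambda>j. radial (profile \<alpha> Q) (1 / real (Suc j)) :: real^'n \<Rightarrow> real) (radial (profile \<alpha> Q) 0)"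
      by (rule kernel_limit_profile, simp, rule LIMSEQ_Suc[OF lim_1_over_n])
    then show ?thesis unfolding kernel_limit_def by blast
  qed
  have supp: "radial (profile \<alpha> Q) 0 z = 0" if "z \<notin> cball 0 r" for z :: "real^'n"
    using supp(1)[OF sq_outside[OF r that, of 0]] by (simp add: radial_def profile_def)
  have g1: "C_k_on 1 U' g" by (rule C_k_on_le[OF Suc.prems]) simp
  have "C_k_on (Suc k) V (partial i (cv (radial (profile \<alpha> Q) 0) (\<lambda>y. indicator U y * g y)))" for i
  proof (rule C_k_on_cong[OF V(1)])
    show "C_k_on (Suc k) V (cv (radial (profile \<alpha> Q) 0) (\<lambda>y. indicator U y * partial i g y))"
      by (rule Suc.IH) (use Suc.prems in \<open>simp only: C_k_on.simps(2)\<close>)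
    show "cv (radial (profile \<alpha> Q) 0) (\<lambda>y. indicator U y * partial i g y) x =
       partial i (cv (radial (profile \<alpha> Q) 0) (\<lambda>y. indicator U y * g y)) x" if "x \<in> V" for x
      by (rule cv_partial[OF K supp U V g1 that dif[OF that], symmetric])
  qed
  then show ?case using dif unfolding C_k_on.simps(2)[of "Suc k"] by blast
qed

end

context parametrix
begin

lemma cv_restrict:
  fixes g :: "real^'n \<Rightarrow> real"
  assumes "\<And>z. z \<notin> cball 0 r \<Longrightarrow> K z = 0" "cball x r \<subseteq> U"
  shows "cv K g x = cv K (\<lambda>y. indicator U y * g y) x"
  unfolding cv_def
proof (rule Bochner_Integration.integral_cong[OF refl])
  fix y
  show "K (x - y) * g y = K (x - y) * (indicator U y * g y)"
  proof (cases "y \<in> U")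
    case False
    then have "y \<notin> cball x r" using assms(2) by blast
    then have "x - y \<notin> cball 0 r" by (simp add: dist_norm norm_minus_commute)
    then show ?thesis using assms(1) by simp
  qed simp
qed

text \<open>Entry to the bootstrap: for \<open>w\<close> and \<open>g\<close> known only to be
  bounded and measurable, both convolutions are already continuous, and division by \<kappa>
  transfers this to \<open>w\<close>.\<close>

lemma regularity_start:
  fixes w g :: "real^'n \<Rightarrow> real"
  assumes w: "w \<in> borel_measurable borel" "\<And>y. \<bar>w y\<bar> \<le> B" "\<And>y. y \<notin> cball 0 R \<Longrightarrow> w y = 0"
    and g: "g \<in> borel_measurable borel" "\<And>y. \<bar>g y\<bar> \<le> B'" "\<And>y. y \<notin> cball 0 R \<Longrightarrow> g y = 0"
    and V: "open V" and rep: "\<And>x. x \<in> V \<Longrightarrow> \<kappa> * w x = cv (radial om 0) w x - cv (radial F 0) g x"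
  shows "C_k_on 0 V w"
proof (rule C_k_on_cong[OF V])
  obtain B1 where 1: "singular_profile TYPE('n) (q 4) (\<lambda>s. - (4 * q 3 s)) \<alpha> r B1" using singular_profiles(1) by blast
  obtain B2 where 2: "singular_profile TYPE('n) Q1 Q1' \<alpha> r B2" using singular_profiles(2) by blast
  have "continuous_on V (cv (radial om 0) w)" unfolding om_def
    by (rule C_k_on_continuous[OF singular_profile.cv_profile_differentiable[OF 2 w]])
  moreover have "continuous_on V (cv (radial F 0) g)" unfolding F_def
    by (rule C_k_on_continuous[OF singular_profile.cv_profile_differentiable[OF 1 g]])
  ultimately show "C_k_on 0 V (\<lambda>x. (cv (radial om 0) w x - cv (radial F 0) g x) / \<kappa>)"
    using \<kappa>_pos by (auto intro!: continuous_intros)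
  show "(cv (radial om 0) w x - cv (radial F 0) g x) / \<kappa> = w x" if "x \<in> V" for x
    using rep[OF that] \<kappa>_pos by (simp add: field_simps)
qed

text \<open>Both convolutions gain one derivative. The data are regular only inside \<Omega>, so
  they are first restricted to \<open>U\<close>; the support of the kernels makes this invisible
  from \<open>V\<close>.\<close>

lemma regularity_step:
  fixes w g :: "real^'n \<Rightarrow> real"
  assumes V: "open V" and U: "open U" "bounded U" "closure U \<subseteq> \<Omega>" and VU: "\<And>x. x \<in> V \<Longrightarrow> cball x r \<subseteq> U"
    and rep: "\<And>x. x \<in> V \<Longrightarrow> \<kappa> * w x = cv (radial om 0) w x - cv (radial F 0) g x"
    and w: "C_k_on k \<Omega> w" and g: "C_k_on k \<Omega> g"
  shows "C_k_on (Suc k) V w"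
proof (rule C_k_on_cong[OF V])
  obtain B1 where 1: "singular_profile TYPE('n) (q 4) (\<lambda>s. - (4 * q 3 s)) \<alpha> r B1" using singular_profiles(1) by blast
  obtain B2 where 2: "singular_profile TYPE('n) Q1 Q1' \<alpha> r B2" using singular_profiles(2) by blast
  let ?cw = "cv (radial om 0) (\<lambda>y. indicator U y * w y)" and ?cg = "cv (radial F 0) (\<lambda>y. indicator U y * g y)"
  have "C_k_on (Suc k) V ?cw" unfolding om_def by (rule singular_profile.cv_profile_C_k[OF 2 U V VU w])
  moreover have "C_k_on (Suc k) V ?cg" unfolding F_def by (rule singular_profile.cv_profile_C_k[OF 1 U V VU g])
  ultimately show "C_k_on (Suc k) V (\<lambda>x. (1 / \<kappa>) * (?cw x + (- 1) * ?cg x))"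
    by (intro C_k_on_mult[OF V] C_k_on_add[OF V] C_k_on_const)
  show "(1 / \<kappa>) * (?cw x + (- 1) * ?cg x) = w x" if x: "x \<in> V" for x
  proof -
    have "radial om 0 z = 0" "radial F 0 z = 0" if "z \<notin> cball 0 r" for z :: "real^'n"
      using sq_outside[OF r that, of 0] by (simp_all add: radial_def om_def F_def profile_def Q1_def q_zero)
    then have "cv (radial om 0) w x = ?cw x" "cv (radial F 0) g x = ?cg x"
      by (intro cv_restrict VU[OF x]; simp)+
    then show ?thesis using rep[OF x] \<kappa>_pos by (simp add: field_simps)
  qed
qed

end

section \<open>Monotone iteration\<close>

lemma powr_diff_le:
  fixes a b p :: real
  assumes "0 \<le> b" "b \<le> a" "a \<le> 1" "1 \<le> p"
  shows "a powr p - b powr p \<le> p * (a - b)"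
proof (cases "b = 0 \<or> a = b")
  \<comment> \<open>The derivative rule for real powers requires a positive base and the mean value
    theorem a nontrivial interval, so these two cases are treated apart.\<close>
  case True
  then show ?thesis
  proof
    assume b: "b = 0"
    show ?thesis
    proof (cases "a = 0")
      case False
      then have a: "a > 0" using assms by simp
      have "a powr p \<le> a powr 1" using assms a by (intro powr_mono') auto
      also have "\<dots> \<le> p * a" using assms a by (simp add: mult_le_cancel_right1)
      finally show ?thesis using b by simp
    qed (use b in simp)
  qed simp
next
  case False
  then have b: "b > 0" "b < a" using assms by auto
  obtain z where z: "z > b" "z < a" "a powr p - b powr p = (a - b) * (p * z powr (p - 1))"
    using MVT2[OF b(2), of "\<lambda>x. x powr p" "\<lambda>x. p * x powr (p - 1)"] b has_real_derivative_powr by fastforce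
  have "z powr (p - 1) \<le> 1 powr (p - 1)" using z b assms by (intro powr_mono2) auto
  then have "(a - b) * (p * z powr (p - 1)) \<le> (a - b) * (p * 1)" using b assms by (intro mult_left_mono) auto
  then show ?thesis using z by (simp add: mult.commute)
qed

text \<open>\<open>exp t + exp (- t) - 2\<close> is the square of \<open>2 sinh (t / 2)\<close>, and
  \<open>2 sinh (t / 2)\<close> is at least \<open>t\<close> for nonnegative
  \<open>t\<close>.\<close>

lemma exp_sum_ge: "2 + t\<^sup>2 \<le> exp t + exp (- t)" for t :: real
proof -
  have *: "2 + t\<^sup>2 \<le> exp t + exp (- t)" if "t \<ge> 0" for t :: real
  proof -
    have "t / 2 \<le> (exp (t / 2) - inverse (exp (t / 2))) / 2" by (rule real_le_x_sinh) (use that in simp)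
    then have "t \<le> exp (t / 2) - exp (- (t / 2))" by (simp add: exp_minus)
    then have "t\<^sup>2 \<le> (exp (t / 2) - exp (- (t / 2)))\<^sup>2" using that by (intro power_mono) auto
    also have "\<dots> = exp t + exp (- t) - 2"
      by (simp add: power2_diff exp_double[symmetric] exp_minus_inverse)
    finally show ?thesis by simp
  qed
  show ?thesis using *[of t] *[of "- t"] by (cases "t \<ge> 0") auto
qed

locale semilinear =
  fixes \<Omega> :: "(real^'n) set" and V :: "real^'n \<Rightarrow> real" and m p R :: real
  assumes dim: "CARD('n) \<ge> 3" and op: "open \<Omega>" and conv: "convex \<Omega>"
    and R: "\<Omega> \<subseteq> cball 0 R" "R \<ge> 1"
    and V: "\<And>k. C_k_on k \<Omega> V" and Vm: "\<And>x. x \<in> \<Omega> \<Longrightarrow> \<bar>V x\<bar> \<le> m" and m: "m > 0" and p: "p \<ge> 1"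
begin

text \<open>
  The unknown is \<open>w = 1 - v\<close>, and the next iterate solves \<open>A w' - \<Delta>w' = \<eta> k x * H x (w x)\<close>.  The
  constant \<open>A\<close> makes \<open>H x\<close> increasing on \<open>[0,1]\<close>, and \<open>s\<close> is the subsolution for \<open>v\<close>.  The function \<open>V\<close>
  need not extend continuously to the boundary; the cutoffs \<open>\<eta> k\<close> make the sources uniformly
  continuous and increase to \<open>1\<close>.
\<close>

definition A where "A = m + m * p"
definition H where "H x t = A * t + V x * (1 - t) + m * (1 - t) powr p"
definition M where "M = A + 2 * m"
text \<open>\<open>undefined\<close> serves as an arbitrary but fixed coordinate. The shift by
  \<open>R + 1\<close> instead of \<open>R\<close> keeps \<open>s \<le> 1\<close> also at neighbours
  of points of \<Omega>, since the step size is at most \<open>1\<close>.\<close>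

definition s where "s x = exp (sqrt (2 * m) * ((x :: real^'n) $ undefined - (R + 1)))"
text \<open>Equal to \<open>0\<close> where the distance to the complement is at most
  \<open>1 / real (Suc k)\<close> and to \<open>1\<close> where it is at least
  \<open>2 / real (Suc k)\<close>. The zone of zeros is what makes the product with \<open>V\<close>
  continuous.\<close>

definition \<eta> where "\<eta> k x = max 0 (min 1 (real (Suc k) * infdist x (- \<Omega>) - 1))"
definition e where "e j = 1 / real (Suc j)"
definition S where "S h j = (SOME W. disc_sol \<Omega> A (e j) h W)"
definition rhs where "rhs k w x = \<eta> k x * H x (w x)"

lemma A: "A > 0" using m p by (simp add: A_def add_pos_pos)

lemma M: "M > 0" using A m by (simp add: M_def)

lemma e: "e j > 0" "e j \<le> 1" "e \<longlonglongrightarrow> 0"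
  unfolding e_def by (simp, simp, rule LIMSEQ_Suc[OF lim_1_over_n])

lemma H_mono:
  assumes "x \<in> \<Omega>" "0 \<le> t" "t \<le> t'" "t' \<le> 1"
  shows "H x t \<le> H x t'"
proof -
  have "(1 - t) powr p - (1 - t') powr p \<le> p * ((1 - t) - (1 - t'))"
    using assms p by (intro powr_diff_le) auto
  then have "m * ((1 - t) powr p - (1 - t') powr p) \<le> m * (p * (t' - t))" using m by (intro mult_left_mono) auto
  moreover have "V x * (t' - t) \<le> m * (t' - t)" using Vm[OF assms(1)] assms by (intro mult_right_mono) auto
  ultimately show ?thesis by (simp add: H_def A_def algebra_simps)
qed

lemma H_nonneg: "x \<in> \<Omega> \<Longrightarrow> 0 \<le> t \<Longrightarrow> t \<le> 1 \<Longrightarrow> 0 \<le> H x t"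
  using H_mono[of x 0 t] Vm[of x] by (simp add: H_def abs_le_iff)

text \<open>For \<open>a = s x\<close> the bound is \<open>A * (1 - s x)\<close> minus the Laplacian
  of \<open>1 - s\<close>, because the Laplacian of \<open>s\<close> is \<open>2 * m * s\<close>. So
  if an iterate lies below \<open>1 - s\<close>, then \<open>1 - s\<close> is a supersolution for
  the next one.\<close>

lemma H_le:
  assumes "x \<in> \<Omega>" "0 \<le> t" "t \<le> 1 - a" "0 < a" "a \<le> 1"
  shows "H x t \<le> A * (1 - a) + 2 * m * a"
proof -
  have "H x t \<le> H x (1 - a)" using assms by (intro H_mono) auto
  also have "\<dots> = A * (1 - a) + (V x * a + m * a powr p)" by (simp add: H_def)
  also have "V x * a \<le> m * a" using Vm[OF assms(1)] assms by (intro mult_right_mono) auto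
  also have "a powr p \<le> a powr 1" using assms p by (intro powr_mono') auto
  finally show ?thesis using m assms by (simp add: mult_ac)
qed

lemma H_le_M: "x \<in> \<Omega> \<Longrightarrow> 0 \<le> t \<Longrightarrow> t \<le> 1 \<Longrightarrow> H x t \<le> M"
proof -
  assume x: "x \<in> \<Omega>" and t: "0 \<le> t" "t \<le> 1"
  have "H x t \<le> H x 1" using x t by (intro H_mono) auto
  also have "\<dots> = A" using p by (simp add: H_def)
  finally show ?thesis using m by (simp add: M_def)
qed

lemma s_pos: "s x > 0" by (simp add: s_def)

lemma s_le_1:
  assumes "norm x \<le> R + 1" shows "s x \<le> 1"
proof -
  have "x $ undefined \<le> R + 1" using component_le_norm_cart[of x undefined] assms by simp
  then show ?thesis using m by (simp add: s_def mult_le_0_iff)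
qed

text \<open>\<open>exp_sum_ge\<close> at \<open>sqrt (2 * m) * d\<close> errs in the favourable
  direction for every step size, so \<open>s\<close> is a subsolution of the discrete problem as
  well. The other coordinates contribute no second difference.\<close>

lemma nb_sum_s: "nb_sum d s x \<ge> 2 * real CARD('n) * s x + d\<^sup>2 * (2 * m * s x)"
proof -
  let ?b = "sqrt (2 * m)"
  have t: "s (x + d *\<^sub>R axis i 1) + s (x - d *\<^sub>R axis i 1) \<ge> 2 * s x + (if i = undefined then d\<^sup>2 * (2 * m * s x) else 0)" for i
  proof (cases "i = undefined")
    case True
    have "s (x + d *\<^sub>R axis i 1) + s (x - d *\<^sub>R axis i 1) = s x * (exp (?b * d) + exp (- (?b * d)))"
      using True by (simp add: s_def exp_add[symmetric] algebra_simps)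
    moreover have "s x * (exp (?b * d) + exp (- (?b * d))) \<ge> s x * (2 + (?b * d)\<^sup>2)"
      by (intro mult_left_mono exp_sum_ge less_imp_le[OF s_pos])
    ultimately show ?thesis using True m by (simp add: power_mult_distrib algebra_simps)
  next
    case False
    then show ?thesis by (simp add: s_def axis_def)
  qed
  have "2 * real CARD('n) * s x + d\<^sup>2 * (2 * m * s x) = (\<Sum>i\<in>(UNIV::'n set). 2 * s x + (if i = undefined then d\<^sup>2 * (2 * m * s x) else 0))"
    by (simp add: sum.distrib sum.delta)
  also have "\<dots> \<le> nb_sum d s x" unfolding nb_sum_def by (intro sum_mono t)
  finally show ?thesis .
qed

lemma \<eta>_range: "0 \<le> \<eta> k x" "\<eta> k x \<le> 1" by (auto simp: \<eta>_def)

lemma compl_ne: "- \<Omega> \<noteq> {}"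
proof
  assume "- \<Omega> = {}"
  then have "\<Omega> = UNIV" by auto
  then have "bounded (UNIV :: (real^'n) set)" using R(1) bounded_cball bounded_subset by metis
  then show False by simp
qed

lemma \<eta>_mono: "\<eta> k x \<le> \<eta> (Suc k) x"
proof -
  have "real (Suc k) * infdist x (- \<Omega>) \<le> real (Suc (Suc k)) * infdist x (- \<Omega>)"
    by (intro mult_right_mono infdist_nonneg) simp
  then show ?thesis unfolding \<eta>_def by (intro max.mono min.mono diff_right_mono) auto
qed

lemma \<eta>_outside: "x \<notin> \<Omega> \<Longrightarrow> \<eta> k x = 0"
  by (simp add: \<eta>_def)

lemma \<eta>_continuous: "continuous_on UNIV (\<eta> k)"
  unfolding \<eta>_def[abs_def] by (intro continuous_intros)

lemma \<eta>_lim: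
  assumes "x \<in> \<Omega>" shows "(\<lambda>k. \<eta> k x) \<longlonglongrightarrow> 1"
proof (rule tendsto_eventually)
  have d: "infdist x (- \<Omega>) > 0"
    using op assms compl_ne by (intro infdist_pos_not_in_closed) auto
  obtain k0 where "2 / infdist x (- \<Omega>) < real k0" using reals_Archimedean2 by blast
  then have k0: "2 < real k0 * infdist x (- \<Omega>)" using d by (simp add: divide_less_eq)
  have "\<eta> k x = 1" if "k \<ge> k0" for k
  proof -
    have "real k0 * infdist x (- \<Omega>) \<le> real (Suc k) * infdist x (- \<Omega>)"
      using that d by (intro mult_right_mono) auto
    then show ?thesis using k0 by (simp add: \<eta>_def)
  qed
  then show "\<forall>\<^sub>F k in sequentially. \<eta> k x = 1" by (auto simp: eventually_sequentially)
qed

definition good where "good w \<longleftrightarrow> continuous_on UNIV w \<and> (\<forall>x\<in>\<Omega>. 0 \<le> w x \<and> w x \<le> 1 - s x) \<and> (\<forall>x. x \<notin> \<Omega> \<longrightarrow> w x = 0)"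

lemma good_range:
  assumes "good w" shows "0 \<le> w x" "w x \<le> 1"
  using assms s_pos[of x] unfolding good_def by (cases "x \<in> \<Omega>"; force)+

lemma norm_\<Omega>: "x \<in> \<Omega> \<Longrightarrow> norm x \<le> R" using R by auto

lemma rhs_props:
  assumes w: "good w"
  shows "continuous_on UNIV (rhs k w)" "x \<notin> \<Omega> \<Longrightarrow> rhs k w x = 0" "0 \<le> rhs k w x" "rhs k w x \<le> M"
    "x \<in> \<Omega> \<Longrightarrow> rhs k w x \<le> A * (1 - s x) + 2 * m * s x"
proof -
  show out: "x \<notin> \<Omega> \<Longrightarrow> rhs k w x = 0" for x by (simp add: rhs_def \<eta>_outside)
  have wr: "0 \<le> w x" "w x \<le> 1" for x using good_range[OF w] by auto
  show "0 \<le> rhs k w x"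
  proof (cases "x \<in> \<Omega>")
    case True
    then show ?thesis unfolding rhs_def by (intro mult_nonneg_nonneg \<eta>_range H_nonneg wr)
  qed (simp add: out)
  have le_H: "rhs k w x \<le> H x (w x)" if "x \<in> \<Omega>" for x
    using mult_right_mono[OF \<eta>_range(2)[of k x] H_nonneg[OF that wr]] by (simp add: rhs_def)
  show "rhs k w x \<le> M"
    using out[of x] order_trans[OF le_H H_le_M[OF _ wr]] M by (cases "x \<in> \<Omega>") auto
  show "rhs k w x \<le> A * (1 - s x) + 2 * m * s x" if x: "x \<in> \<Omega>"
  proof (rule order_trans[OF le_H[OF x] H_le[OF x]])
    show "0 \<le> w x" "w x \<le> 1 - s x" using w x by (auto simp: good_def)
    show "0 < s x" by (rule s_pos)
    show "s x \<le> 1" using norm_\<Omega>[OF x] by (intro s_le_1) simp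
  qed
  \<comment> \<open>Two open sets cover the space: \<Omega>, where the formula is continuous, and a
    neighbourhood of the complement, where the cutoff vanishes.\<close>
  have "continuous_on (\<Omega> \<union> {x. infdist x (- \<Omega>) < 1 / real (Suc k)}) (rhs k w)"
  proof (rule continuous_on_open_Un[OF op])
    show "open {x. infdist x (- \<Omega>) < 1 / real (Suc k)}"
      by (intro open_Collect_less continuous_intros)
    have w1: "continuous_on \<Omega> w" using w continuous_on_subset unfolding good_def by blast
    have V1: "continuous_on \<Omega> V" using V[of 0] by simp
    have \<eta>1: "continuous_on \<Omega> (\<eta> k)" by (rule continuous_on_subset[OF \<eta>_continuous]) simp
    \<comment> \<open>The continuity rule for real powers asks for a nonzero base; the lower barrier
      \<open>s\<close> provides it.\<close>
    have P1: "continuous_on \<Omega> (\<lambda>x. (1 - w x) powr p)"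
    proof (rule continuous_on_powr)
      show "\<forall>x\<in>\<Omega>. 1 - w x \<noteq> 0"
      proof
        fix x assume "x \<in> \<Omega>"
        then have "w x \<le> 1 - s x" using w by (simp add: good_def)
        then show "1 - w x \<noteq> 0" using s_pos[of x] by simp
      qed
    qed (intro continuous_intros w1)+
    show "continuous_on \<Omega> (rhs k w)"
      unfolding rhs_def[abs_def] H_def by (intro continuous_intros w1 V1 \<eta>1 P1)
    have "rhs k w x = 0" if "infdist x (- \<Omega>) < 1 / real (Suc k)" for x
    proof -
      have "real (Suc k) * infdist x (- \<Omega>) < 1" using that by (simp add: field_simps)
      then show ?thesis by (simp add: rhs_def \<eta>_def)
    qed
    then show "continuous_on {x. infdist x (- \<Omega>) < 1 / real (Suc k)} (rhs k w)"
      by (intro continuous_on_eq[OF continuous_on_const[of _ "0::real"]]) auto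
  qed
  moreover have "\<Omega> \<union> {x. infdist x (- \<Omega>) < 1 / real (Suc k)} = UNIV" by auto
  ultimately show "continuous_on UNIV (rhs k w)" by simp
qed

definition source where "source h \<longleftrightarrow> continuous_on UNIV h \<and> (\<forall>x. x \<notin> \<Omega> \<longrightarrow> h x = 0) \<and> (\<forall>x. 0 \<le> h x \<and> h x \<le> M) \<and>
   (\<forall>x\<in>\<Omega>. h x \<le> A * (1 - s x) + 2 * m * s x)"

lemma source_rhs: "good w \<Longrightarrow> source (rhs k w)"
  unfolding source_def using rhs_props by blast

lemma source_uc: "source h \<Longrightarrow> uniformly_continuous_on UNIV h"
  by (rule uniformly_continuous_of_compact_support[of _ R]) (use R in \<open>auto simp: source_def\<close>)

lemma S_sol:
  assumes "source h" shows "disc_sol \<Omega> A (e j) h (S h j)"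
proof -
  have "\<exists>W. disc_sol \<Omega> A (e j) h W"
    by (rule disc_sol_exists[OF A e(1)])
      (use assms op borel_measurable_continuous_onI in \<open>auto simp: source_def\<close>)
  then show ?thesis unfolding S_def by (rule someI_ex)
qed

text \<open>\<open>1 - s\<close> may be negative far away and is truncated at \<open>0\<close> to
  serve in \<open>disc_sol_le\<close>. The neighbours of points of \<Omega> have norm at most
  \<open>R + 1\<close>, where the truncation is inactive.\<close>

lemma S_le:
  assumes h: "source h" and x: "x \<in> \<Omega>" shows "S h j x \<le> 1 - s x"
proof -
  have "S h j x \<le> max 0 (1 - s x)"
  proof (rule disc_sol_le[OF A e(1) S_sol[OF h]])
    show "0 \<le> max 0 (1 - s x)" for x by simp
    fix z assume z: "z \<in> \<Omega>"
    have s1: "s y \<le> 1" if "dist y z \<le> \<bar>e j\<bar>" for y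
    proof (rule s_le_1)
      have "norm y \<le> norm z + dist y z" by (metis dist_norm norm_triangle_sub add.commute)
      then show "norm y \<le> R + 1" using norm_\<Omega>[OF z] that e(1,2)[of j] by simp
    qed
    have "nb_sum (e j) (\<lambda>x. max 0 (1 - s x)) z = nb_sum (e j) (\<lambda>x. 1 - s x) z"
      by (rule nb_sum_cong) (simp add: s1)
    also have "\<dots> = 2 * real CARD('n) - nb_sum (e j) s z" by (simp add: nb_sum_diff)
    also have "\<dots> \<le> 2 * real CARD('n) * (1 - s z) - (e j)\<^sup>2 * (2 * m * s z)"
      using nb_sum_s[of z "e j"] by (simp add: algebra_simps)
    finally have 1: "nb_sum (e j) (\<lambda>x. max 0 (1 - s x)) z \<le> 2 * real CARD('n) * (1 - s z) - (e j)\<^sup>2 * (2 * m * s z)" .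
    have "h z \<le> A * (1 - s z) + 2 * m * s z" using h z by (simp add: source_def)
    then have 2: "(e j)\<^sup>2 * h z \<le> (e j)\<^sup>2 * (A * (1 - s z) + 2 * m * s z)" by (rule mult_left_mono) simp
    have 3: "max 0 (1 - s z) = 1 - s z" using s1[of z] by simp
    have "2 * real CARD('n) * (1 - s z) - (e j)\<^sup>2 * (2 * m * s z) + (e j)\<^sup>2 * (A * (1 - s z) + 2 * m * s z)
        = (2 * real CARD('n) + A * (e j)\<^sup>2) * (1 - s z)" by (simp add: algebra_simps)
    then show "nb_sum (e j) (\<lambda>x. max 0 (1 - s x)) z + (e j)\<^sup>2 * h z \<le> (2 * real CARD('n) + A * (e j)\<^sup>2) * max 0 (1 - s z)"
      unfolding 3 using 1 2 by linarith
  qed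
  then show ?thesis using s_le_1[of x] norm_\<Omega>[OF x] by simp
qed

text \<open>The subsequence \<open>\<sigma>\<close> of step sizes is recorded together with the
  limit, so that later iterates can be compared at the discrete level.\<close>

definition disc_conv where "disc_conv \<sigma> h w \<longleftrightarrow> strict_mono (\<sigma> :: nat \<Rightarrow> nat) \<and> source h \<and> (\<forall>x. (\<lambda>j. S h (\<sigma> j) x) \<longlonglongrightarrow> w x)"

lemma disc_conv_limit:
  assumes "disc_conv \<sigma> h w"
  shows "discrete_limit \<Omega> A M R (\<lambda>j. e (\<sigma> j)) h w (\<lambda>j. S h (\<sigma> j))"
proof
  have h: "source h" using assms by (simp add: disc_conv_def)
  show "(\<lambda>j. e (\<sigma> j)) \<longlonglongrightarrow> 0" using LIMSEQ_subseq_LIMSEQ[OF e(3), of \<sigma>] assms by (simp add: disc_conv_def o_def)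
  show "disc_sol \<Omega> A (e (\<sigma> j)) h (S h (\<sigma> j))" for j by (rule S_sol[OF h])
  show "uniformly_continuous_on UNIV h" by (rule source_uc[OF h])
  show "0 \<le> h x" "h x \<le> M" for x using h by (auto simp: source_def)
  show "(\<lambda>j. S h (\<sigma> j) x) \<longlonglongrightarrow> w x" for x using assms by (simp add: disc_conv_def)
qed (use A e conv R in auto)

lemma disc_conv_good:
  assumes "disc_conv \<sigma> h w" shows "good w"
proof -
  interpret discrete_limit \<Omega> A M R "\<lambda>j. e (\<sigma> j)" h w "\<lambda>j. S h (\<sigma> j)" by (rule disc_conv_limit[OF assms])
  have "w x \<le> 1 - s x" if "x \<in> \<Omega>" for x
    by (rule LIMSEQ_le_const2[OF lim]) (use S_le that assms in \<open>auto simp: disc_conv_def\<close>)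
  then show ?thesis using lim_continuous lim_nonneg lim_outside by (auto simp: good_def)
qed

lemma disc_conv_step:
  assumes "disc_conv \<sigma> h w"
  shows "\<exists>\<tau> w'. strict_mono \<tau> \<and> disc_conv (\<sigma> \<circ> \<tau>) (rhs k w) w'"
proof -
  have src: "source (rhs k w)" by (rule source_rhs[OF disc_conv_good[OF assms]])
  have \<sigma>: "strict_mono \<sigma>" using assms by (simp add: disc_conv_def)
  have "(\<lambda>j. e (\<sigma> j)) \<longlonglongrightarrow> 0" using LIMSEQ_subseq_LIMSEQ[OF e(3) \<sigma>] by (simp add: o_def)
  moreover have "0 \<le> rhs k w x" "rhs k w x \<le> M" for x using src by (auto simp: source_def)
  ultimately obtain \<tau> w' where "strict_mono \<tau>" "\<And>x. (\<lambda>j. S (rhs k w) (\<sigma> (\<tau> j)) x) \<longlonglongrightarrow> w' x"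
    using disc_sol_convergent_subseq[OF A, of "\<lambda>j. e (\<sigma> j)" \<Omega> "rhs k w" "\<lambda>j. S (rhs k w) (\<sigma> j)" M R]
      e S_sol[OF src] source_uc[OF src] conv R by blast
  then show ?thesis using src \<sigma> strict_mono_o unfolding disc_conv_def comp_def by blast
qed

lemma disc_conv_start: "disc_conv (\<lambda>j. j) (\<lambda>_. 0) (\<lambda>_. 0)"
proof -
  have src: "source (\<lambda>_. 0)"
  proof -
    have "0 \<le> A * (1 - s x) + 2 * m * s x" if "x \<in> \<Omega>" for x
    proof -
      have "s x \<le> 1" using norm_\<Omega>[OF that] by (intro s_le_1) simp
      then show ?thesis using A m less_imp_le[OF s_pos[of x]] by simp
    qed
    then show ?thesis using M by (simp add: source_def)
  qed
  have "S (\<lambda>_. 0) j x = 0" for j x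
    using disc_sol_le_const[OF A e(1) S_sol[OF src], where M = 0] disc_sol_nonneg[OF A e(1) S_sol[OF src]]
    by (intro antisym) auto
  then show ?thesis using src by (simp add: disc_conv_def strict_mono_def)
qed

text \<open>
  The subsequences of step sizes are nested.  So two consecutive iterates are limits along a common
  subsequence and inherit the comparison of discrete solutions, without any uniqueness result for
  the limit problem.
\<close>

lemma iteration:
  "\<exists>h w. (\<forall>k. \<exists>\<sigma>. disc_conv \<sigma> (h k) (w k)) \<and> (\<forall>k. h (Suc k) = rhs (Suc k) (w k)) \<and> (\<forall>k x. w k x \<le> w (Suc k) x)"
proof -
  \<comment> \<open>A state consists of subsequence, source and limit. The clause for
    \<open>k = 0\<close> makes the first comparison a matter of nonnegativity of the next source;
    \<open>Q\<close> records that each subsequence refines the previous one.\<close>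
  define P where "P k t = (case t of (\<sigma>, h, w) \<Rightarrow> disc_conv \<sigma> h w \<and> (k = 0 \<longrightarrow> h = (\<lambda>_. 0) \<and> w = (\<lambda>_. 0)))" for k :: nat and t
  define Q where "Q k t t' = (case t of (\<sigma>, h, w) \<Rightarrow> case t' of (\<sigma>', h', w') \<Rightarrow> h' = rhs (Suc k) w \<and> (\<exists>\<tau>. strict_mono \<tau> \<and> \<sigma>' = \<sigma> \<circ> \<tau>))"
    for k and t t' :: "(nat \<Rightarrow> nat) \<times> (real^'n \<Rightarrow> real) \<times> (real^'n \<Rightarrow> real)"
  have "\<exists>t. \<forall>k. P k (t k) \<and> Q k (t k) (t (Suc k))"
  proof (rule dependent_nat_choice)
    show "\<exists>t. P 0 t" using disc_conv_start by (intro exI[of _ "(\<lambda>j. j, \<lambda>_. 0, \<lambda>_. 0)"]) (simp add: P_def)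
    show "\<exists>t'. P (Suc k) t' \<and> Q k t t'" if "P k t" for k t
    proof -
      obtain \<sigma> h w where t: "t = (\<sigma>, h, w)" by (cases t) auto
      have "disc_conv \<sigma> h w" using that by (simp add: P_def t)
      then obtain \<tau> w' where "strict_mono \<tau>" "disc_conv (\<sigma> \<circ> \<tau>) (rhs (Suc k) w) w'" using disc_conv_step by blast
      then show ?thesis by (intro exI[of _ "(\<sigma> \<circ> \<tau>, rhs (Suc k) w, w')"]) (auto simp: P_def Q_def t)
    qed
  qed
  then obtain t where t: "\<And>k. P k (t k)" "\<And>k. Q k (t k) (t (Suc k))" by blast
  define \<sigma> where "\<sigma> k = fst (t k)" for k
  define h where "h k = fst (snd (t k))" for k
  define w where "w k = snd (snd (t k))" for k
  have disc_conv: "disc_conv (\<sigma> k) (h k) (w k)" for k using t(1)[of k] by (simp add: P_def \<sigma>_def h_def w_def split_beta)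
  have w0: "w 0 = (\<lambda>_. 0)" "h 0 = (\<lambda>_. 0)" using t(1)[of 0] by (simp_all add: P_def h_def w_def split_beta)
  have hS: "h (Suc k) = rhs (Suc k) (w k)" and sub: "\<exists>\<tau>. strict_mono \<tau> \<and> \<sigma> (Suc k) = \<sigma> k \<circ> \<tau>" for k
    using t(2)[of k] by (simp_all add: Q_def \<sigma>_def h_def w_def split_beta)
  have src: "source (h k)" for k using disc_conv[of k] by (simp add: disc_conv_def)
  have le: "w k x \<le> w (Suc k) x" if "\<And>x. x \<in> \<Omega> \<Longrightarrow> h k x \<le> h (Suc k) x" for k x
  proof -
    obtain \<tau> where \<tau>: "strict_mono \<tau>" "\<sigma> (Suc k) = \<sigma> k \<circ> \<tau>" using sub by blast
    have "(\<lambda>j. S (h k) (\<sigma> k j) x) \<longlonglongrightarrow> w k x" using disc_conv[of k] by (simp add: disc_conv_def)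
    from LIMSEQ_subseq_LIMSEQ[OF this \<tau>(1)]
    have 1: "(\<lambda>j. S (h k) (\<sigma> (Suc k) j) x) \<longlonglongrightarrow> w k x" by (simp add: \<tau> o_def)
    have 2: "(\<lambda>j. S (h (Suc k)) (\<sigma> (Suc k) j) x) \<longlonglongrightarrow> w (Suc k) x" using disc_conv[of "Suc k"] by (simp add: disc_conv_def)
    have "S (h k) j x \<le> S (h (Suc k)) j x" for j
      by (rule disc_sol_mono[OF A e(1) S_sol[OF src] S_sol[OF src] that]) (use src[of "Suc k"] in \<open>auto simp: source_def\<close>)
    then show ?thesis by (intro LIMSEQ_le[OF 1 2]) auto
  qed
  have mono: "w k x \<le> w (Suc k) x" for k x
  proof (induction k arbitrary: x)
    case 0
    show ?case by (rule le) (use src[of "Suc 0"] in \<open>auto simp: w0 source_def\<close>)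
  next
    case (Suc k)
    show ?case
    proof (rule le)
      fix x assume x: "x \<in> \<Omega>"
      have g: "good (w k)" "good (w (Suc k))" using disc_conv_good[OF disc_conv] by auto
      have "H x (w k x) \<le> H x (w (Suc k) x)"
        by (intro H_mono x Suc.IH good_range[OF g(1)] good_range[OF g(2)])
      then show "h (Suc k) x \<le> h (Suc (Suc k)) x"
        unfolding hS rhs_def using good_range[OF g(1)] by (intro mult_mono \<eta>_mono \<eta>_range H_nonneg x)
    qed
  qed
  show ?thesis using disc_conv hS mono by (intro exI[of _ h] exI[of _ w] conjI allI) blast+
qed

end

section \<open>The solution\<close>

lemma bounded_limit_integral:
  fixes \<psi> :: "'a::euclidean_space \<Rightarrow> real"
  assumes \<psi>: "integrable lborel \<psi>" and f: "\<And>k. f k \<in> borel_measurable borel" "\<And>k y. \<bar>f k y\<bar> \<le> B"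
    and lim: "\<And>y. (\<lambda>k. f k y) \<longlonglongrightarrow> g y"
  shows "(\<lambda>k. \<integral>y. \<psi> y * f k y \<partial>lborel) \<longlonglongrightarrow> (\<integral>y. \<psi> y * g y \<partial>lborel)"
proof (rule integral_dominated_convergence[where w = "\<lambda>y. B * \<bar>\<psi> y\<bar>"])
  have [measurable]: "\<psi> \<in> borel_measurable borel" using \<psi> by auto
  have [measurable]: "g \<in> borel_measurable borel"
    using lim f(1) by (rule borel_measurable_LIMSEQ_real)
  note [measurable] = f(1)
  show "(\<lambda>y. \<psi> y * g y) \<in> borel_measurable lborel" "(\<lambda>y. \<psi> y * f k y) \<in> borel_measurable lborel" for k
    by measurable
  show "integrable lborel (\<lambda>y. B * \<bar>\<psi> y\<bar>)"
    using \<psi> by (intro Bochner_Integration.integrable_mult_right integrable_abs)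
  show "AE y in lborel. (\<lambda>k. \<psi> y * f k y) \<longlonglongrightarrow> \<psi> y * g y"
    by (intro AE_I2 tendsto_mult tendsto_const lim)
  show "AE y in lborel. norm (\<psi> y * f k y) \<le> B * \<bar>\<psi> y\<bar>" for k
  proof (rule AE_I2)
    fix y
    have "\<bar>\<psi> y\<bar> * \<bar>f k y\<bar> \<le> \<bar>\<psi> y\<bar> * B" by (intro mult_left_mono f) auto
    then show "norm (\<psi> y * f k y) \<le> B * \<bar>\<psi> y\<bar>" by (simp add: abs_mult mult.commute)
  qed
qed

lemma cv_limit:
  fixes K :: "'a::euclidean_space \<Rightarrow> real"
  assumes "integrable lborel K" "\<And>k. f k \<in> borel_measurable borel" "\<And>k y. \<bar>f k y\<bar> \<le> B"
    "\<And>y. (\<lambda>k. f k y) \<longlonglongrightarrow> g y"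
  shows "(\<lambda>k. cv K (f k) x) \<longlonglongrightarrow> cv K g x"
  unfolding cv_def using lborel_integrable_reflect[OF assms(1)] assms(2-) by (rule bounded_limit_integral)

lemma cball_subset_cball_0: "cball x r \<subseteq> cball 0 (norm x + r)" for x :: "'a::real_normed_vector"
proof
  fix y assume "y \<in> cball x r"
  then have "norm (y - x) \<le> r" by (simp add: dist_norm norm_minus_commute)
  then show "y \<in> cball 0 (norm x + r)" using norm_triangle_sub[of y x] by simp
qed

context parametrix
begin

lemma test_shift_supp: "y \<notin> cball x r \<Longrightarrow> test e (y - x) = 0"
  by (rule test_supp) (simp add: dist_norm norm_minus_commute)

lemma test_measurable: "e > 0 \<Longrightarrow> (\<lambda>y. test e (y - x)) \<in> borel_measurable borel"
proof -
  assume "e > 0"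
  then have [measurable]: "test e \<in> borel_measurable borel"
    by (intro borel_measurable_continuous_onI continuous_test)
  show ?thesis by measurable
qed

text \<open>Green's identity on one ball, by symmetry of \<open>dlap\<close> on both sides. The step
  sizes are at most \<open>d\<close>, so neighbours of points of \<open>cball x r\<close> remain in
  \<Omega>, where \<open>w\<close> is twice differentiable; outside that ball the test function
  vanishes and \<open>dlap\<close> of \<open>w\<close> is multiplied by \<open>0\<close>.\<close>

lemma laplacian_swap:
  fixes w :: "real^'n \<Rightarrow> real"
  assumes w: "w \<in> borel_measurable borel" "\<And>y. \<bar>w y\<bar> \<le> B" and op: "open \<Omega>" and c2: "C_k_on 2 \<Omega> w"
    and d: "d > 0" and sub: "cball x (r + d) \<subseteq> \<Omega>" and e: "e > 0"
  shows "(\<integral>y. w y * test_lap e (y - x) \<partial>lborel) = (\<integral>y. laplacian w y * test e (y - x) \<partial>lborel)"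
proof -
  define \<phi> where "\<phi> y = test e (y - x)" for y
  obtain C where C: "\<And>y. \<bar>\<phi> y\<bar> \<le> C" "\<And>y d. d > 0 \<Longrightarrow> \<bar>dlap d \<phi> y\<bar> \<le> C"
    and lim\<phi>: "\<And>y d. (\<And>j. d j > 0) \<Longrightarrow> d \<longlonglongrightarrow> 0 \<Longrightarrow> (\<lambda>j. dlap (d j) \<phi> y) \<longlonglongrightarrow> test_lap e (y - x)"
    using test_dlap[OF e, where a = x] unfolding \<phi>_def by blast
  have \<phi>0: "\<phi> y = 0" if "y \<notin> cball x r" for y using test_shift_supp[OF that] by (simp add: \<phi>_def)
  have [measurable]: "\<phi> \<in> borel_measurable borel" using test_measurable[OF e] by (simp add: \<phi>_def[abs_def])
  note [measurable] = w(1)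
  define dj where "dj j = d * (1 / real (Suc j))" for j
  have dj: "dj j > 0" "dj j \<le> d" for j
  proof -
    show "dj j > 0" using d by (simp add: dj_def)
    have "dj j \<le> d * 1" unfolding dj_def using d by (intro mult_left_mono) auto
    then show "dj j \<le> d" by simp
  qed
  have "dj \<longlonglongrightarrow> d * 0" unfolding dj_def[abs_def] by (intro tendsto_intros LIMSEQ_Suc[OF lim_1_over_n])
  then have dj0: "dj \<longlonglongrightarrow> 0" by simp
  have dm [measurable]: "dlap (dj j) u \<in> borel_measurable borel" if [measurable]: "u \<in> borel_measurable borel"
    for j and u :: "real^'n \<Rightarrow> real" unfolding dlap_def[abs_def] by measurable
  define R where "R = norm x + (r + d)"
  have inR: "y \<in> cball 0 R" if "y \<in> cball x (r + d)" for y
    using that cball_subset_cball_0[of x "r + d"] by (auto simp: R_def)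
  have swap: "(\<integral>y. \<phi> y * dlap (dj j) w y \<partial>lborel) = (\<integral>y. w y * dlap (dj j) \<phi> y \<partial>lborel)" for j
  proof (rule integral_dlap_swap[OF w _ C(1)])
    show "\<phi> y = 0" if "y \<notin> cball 0 R" for y
    proof (rule \<phi>0)
      have "y \<notin> cball x (r + d)" using that inR by blast
      then show "y \<notin> cball x r" using d by auto
    qed
  qed measurable
  have B: "0 \<le> B" "0 \<le> C" using w(2)[of x] C(1)[of x] by linarith+
  have lim1: "(\<lambda>j. \<integral>y. w y * dlap (dj j) \<phi> y \<partial>lborel) \<longlonglongrightarrow> (\<integral>y. w y * test_lap e (y - x) \<partial>lborel)"
  proof (rule integral_tendsto_bounded_support[where B = "B * C" and R = R])
    show "(\<lambda>y. w y * dlap (dj j) \<phi> y) \<in> borel_measurable borel" for j by measurable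
    show "(\<lambda>j. w y * dlap (dj j) \<phi> y) \<longlonglongrightarrow> w y * test_lap e (y - x)" for y
      by (intro tendsto_mult tendsto_const lim\<phi> dj dj0)
    show "\<bar>w y * dlap (dj j) \<phi> y\<bar> \<le> B * C" for j y unfolding abs_mult
      by (intro mult_mono w C dj) (use B in auto)
    show "w y * dlap (dj j) \<phi> y = 0" if "y \<notin> cball 0 R" for j y
    proof -
      have "y \<notin> cball x (r + d)" using that inR by blast
      then have "y \<notin> cball x (r + dj j)" using dj(2)[of j] by auto
      from dlap_outside[OF \<phi>0 dj(1) this] show ?thesis by simp
    qed
  qed
  define D where "D i = partial i (partial i w)" for i
  have c2': "\<And>y. y \<in> \<Omega> \<Longrightarrow> w differentiable (at y)" "\<And>i y. y \<in> \<Omega> \<Longrightarrow> partial i w differentiable (at y)"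
    "\<And>i. continuous_on \<Omega> (D i)"
    using c2 by (simp_all add: numeral_2_eq_2 D_def)
  have "\<exists>B. \<forall>y\<in>cball x (r + d). \<bar>D i y\<bar> \<le> B" for i
    using bounded_on_precompact[OF c2'(3), of "cball x (r + d)" i] sub by (metis bounded_cball closed_cball closure_closed)
  then obtain B2 where B2: "\<And>i y. y \<in> cball x (r + d) \<Longrightarrow> \<bar>D i y\<bar> \<le> B2 i" by metis
  define B3 where "B3 = (\<Sum>i\<in>UNIV. \<bar>B2 i\<bar>)"
  have "\<bar>B2 i\<bar> \<le> B3" for i unfolding B3_def by (rule member_le_sum) auto
  then have B3: "\<bar>D i y\<bar> \<le> B3" if "y \<in> cball x (r + d)" for i y
    using order_trans[OF B2[OF that, of i] abs_ge_self] order_trans by blast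
  have seg: "y + t *\<^sub>R axis i 1 \<in> cball x (r + d)" if "y \<in> cball x r" "\<bar>t\<bar> \<le> d" for y t i
  proof -
    have "dist x (y + t *\<^sub>R axis i 1) \<le> dist x y + dist y (y + t *\<^sub>R axis i 1)" by (rule dist_triangle)
    also have "dist y (y + t *\<^sub>R axis i 1) = \<bar>t\<bar>" by (simp add: dist_norm)
    finally show ?thesis using that by simp
  qed
  have line: "((\<lambda>t. w (y + t *\<^sub>R axis i 1)) has_real_derivative partial i w (y + t *\<^sub>R axis i 1)) (at t)"
    "((\<lambda>t. partial i w (y + t *\<^sub>R axis i 1)) has_real_derivative D i (y + t *\<^sub>R axis i 1)) (at t)"
    if "y \<in> cball x r" "\<bar>t\<bar> \<le> d" for y t i
  proof -
    have "y + t *\<^sub>R axis i 1 \<in> \<Omega>" using seg[OF that] sub by blast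
    then show "((\<lambda>t. w (y + t *\<^sub>R axis i 1)) has_real_derivative partial i w (y + t *\<^sub>R axis i 1)) (at t)"
      "((\<lambda>t. partial i w (y + t *\<^sub>R axis i 1)) has_real_derivative D i (y + t *\<^sub>R axis i 1)) (at t)"
      unfolding D_def by (intro partial_line_derivative' c2'; assumption)+
  qed
  have lap: "laplacian w y = (\<Sum>i\<in>UNIV. D i y)" for y by (simp add: laplacian_def D_def)
  have limw: "(\<lambda>j. dlap (dj j) w y) \<longlonglongrightarrow> laplacian w y" if y: "y \<in> cball x r" for y
    unfolding lap
  proof (rule dlap_tendsto[OF d dj(1) dj0, where G = "\<lambda>i. partial i w"])
    have "y \<in> \<Omega>" using seg[OF y, of 0] sub d by auto
    then show "isCont (D i) y" for i
      using c2'(3)[of i] op by (simp add: continuous_on_eq_continuous_at)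
  qed (use line[OF y] in auto)
  have bw: "\<bar>dlap (dj j) w y\<bar> \<le> real CARD('n) * (2 * B3) + real CARD('n) * B3" if y: "y \<in> cball x r" for y j
  proof -
    have y': "y \<in> cball x (r + d)" using y d by auto
    have "\<bar>dlap (dj j) w y - (\<Sum>i\<in>UNIV. D i y)\<bar> \<le> real CARD('n) * (2 * B3)"
    proof (rule dlap_approx[OF dj(1), where G = "\<lambda>i. partial i w"])
      show "\<bar>D i z - D i y\<bar> \<le> 2 * B3" if z: "dist z y \<le> dj j" for i z
      proof -
        have "z \<in> cball x (r + d)" using z y dj(2)[of j] dist_triangle[of x z y] by (simp add: dist_commute)
        then show ?thesis using B3[of z i] B3[OF y', of i] by linarith
      qed
    qed (use line[OF y] dj(2)[of j] in auto)
    moreover have "\<bar>\<Sum>i\<in>UNIV. D i y\<bar> \<le> real CARD('n) * B3"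
      using order_trans[OF sum_abs sum_mono[of UNIV "\<lambda>i. \<bar>D i y\<bar>" "\<lambda>_. B3"]] B3[OF y'] by simp
    moreover have "\<bar>a\<bar> \<le> u + v" if "\<bar>a - b\<bar> \<le> u" "\<bar>b\<bar> \<le> v" for a b u v :: real using that by linarith
    ultimately show ?thesis by blast
  qed
  define B4 where "B4 = real CARD('n) * (2 * B3) + real CARD('n) * B3"
  have B4: "0 \<le> B4" using bw[of x 0] r unfolding B4_def by (smt (verit) centre_in_cball)
  have lim2': "(\<lambda>j. \<phi> y * dlap (dj j) w y) \<longlonglongrightarrow> laplacian w y * \<phi> y" for y
  proof (cases "y \<in> cball x r")
    case True
    then have "(\<lambda>j. \<phi> y * dlap (dj j) w y) \<longlonglongrightarrow> \<phi> y * laplacian w y" by (intro tendsto_mult tendsto_const limw)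
    then show ?thesis by (simp add: mult.commute)
  qed (simp add: \<phi>0)
  have lim2: "(\<lambda>j. \<integral>y. \<phi> y * dlap (dj j) w y \<partial>lborel) \<longlonglongrightarrow> (\<integral>y. laplacian w y * \<phi> y \<partial>lborel)"
  proof (rule integral_tendsto_bounded_support[OF _ _ _ lim2'])
    show "(\<lambda>y. \<phi> y * dlap (dj j) w y) \<in> borel_measurable borel" for j by measurable
    show "\<bar>\<phi> y * dlap (dj j) w y\<bar> \<le> C * B4" for j y
    proof (cases "y \<in> cball x r")
      case True
      show ?thesis unfolding abs_mult by (intro mult_mono C bw[OF True, folded B4_def]) (use B in auto)
    qed (use B B4 in \<open>simp add: \<phi>0\<close>)
    show "\<phi> y * dlap (dj j) w y = 0" if "y \<notin> cball 0 R" for j y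
    proof -
      have "y \<notin> cball x r" using that inR[of y] d by auto
      then show ?thesis by (simp add: \<phi>0)
    qed
  qed
  have "(\<integral>y. w y * test_lap e (y - x) \<partial>lborel) = (\<integral>y. laplacian w y * \<phi> y \<partial>lborel)"
    using LIMSEQ_unique[OF lim1 lim2[unfolded swap]] .
  then show ?thesis by (simp add: \<phi>_def)
qed

lemma integrable_test_lap:
  assumes e: "e > 0" "e \<le> 1"
  shows "integrable lborel (test_lap e)"
proof -
  \<comment> \<open>A null sequence starting at \<open>d 0 = e\<close>: integrability at the given
    \<open>e\<close> is read off from \<open>kernel_limit\<close> at index \<open>0\<close>.\<close>
  define d where "d j = e * (1 / real (Suc j))" for j
  have d: "d j > 0" "d j \<le> 1" for j
  proof -
    show "d j > 0" using e by (simp add: d_def)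
    have "d j \<le> e * 1" unfolding d_def using e by (intro mult_left_mono) auto
    then show "d j \<le> 1" using e by simp
  qed
  have "d \<longlonglongrightarrow> e * 0" unfolding d_def[abs_def] by (intro tendsto_intros LIMSEQ_Suc[OF lim_1_over_n])
  then have d0: "d \<longlonglongrightarrow> 0" by simp
  have "d 0 = e" by (simp add: d_def)
  then have "integrable lborel (radial om e :: real^'n \<Rightarrow> real)" "integrable lborel (low_ker e)"
    using kernel_limit_integrable[OF kernel_limit_om[of d, OF d(1) d0], of 0] kernel_limit_integrable[OF kernel_limit_low[of d, OF d d0], of 0] by simp_all
  then show ?thesis using integrable_kap_ker[OF e(1)] unfolding test_lap_eq[abs_def] by simp
qed

lemma integrable_limit_kernels:
  "integrable lborel (radial om 0 :: real^'n \<Rightarrow> real)" "integrable lborel (radial F 0 :: real^'n \<Rightarrow> real)"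
proof -
  have d: "\<And>j. 1 / real (Suc j) > 0" "(\<lambda>j. 1 / real (Suc j)) \<longlonglongrightarrow> 0"
    by (simp, rule LIMSEQ_Suc[OF lim_1_over_n])
  show "integrable lborel (radial om 0 :: real^'n \<Rightarrow> real)" "integrable lborel (radial F 0 :: real^'n \<Rightarrow> real)"
    using kernel_limit_om[of "\<lambda>j. 1 / real (Suc j)", OF d] kernel_limit_F[of "\<lambda>j. 1 / real (Suc j)", OF d]
    unfolding kernel_limit_def by blast+
qed

lemma test_nonneg: "0 \<le> test e z" by (simp add: test_def radial_def F_nonneg)

lemma test_pos:
  assumes "e > 0" "(norm z)\<^sup>2 + e\<^sup>2 < r\<^sup>2" shows "0 < test e z"
proof -
  have "(norm z)\<^sup>2 + e\<^sup>2 > 0" using assms(1) by (simp add: add_nonneg_pos)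
  then have "((norm z)\<^sup>2 + e\<^sup>2) powr \<alpha> > 0" by (metis powr_gt_zero less_irrefl)
  moreover have "(r\<^sup>2 - ((norm z)\<^sup>2 + e\<^sup>2)) ^ 4 > 0" using assms(2) by (intro zero_less_power) simp
  ultimately have "0 < ((norm z)\<^sup>2 + e\<^sup>2) powr \<alpha> * (r\<^sup>2 - ((norm z)\<^sup>2 + e\<^sup>2)) ^ 4" by (rule mult_pos_pos)
  then show ?thesis using assms(2) by (simp add: test_def radial_def F_def profile_def q_def cutoff_def)
qed

end

locale semilinear_limit = semilinear \<Omega> V m p R
  for \<Omega> :: "(real^'n) set" and V :: "real^'n \<Rightarrow> real" and m p R :: real +
  fixes w h :: "nat \<Rightarrow> real^'n \<Rightarrow> real" and u :: "real^'n \<Rightarrow> real"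
  assumes disc_conv: "\<exists>\<sigma>. disc_conv \<sigma> (h k) (w k)" and h_Suc: "h (Suc k) = rhs (Suc k) (w k)"
    and u: "\<And>x. (\<lambda>k. w k x) \<longlonglongrightarrow> u x"
begin

text \<open>On \<Omega> this is \<open>A * u y - H y (u y)\<close>; the terms with \<open>A\<close>
  cancel. It is the expected Laplacian of \<open>u\<close>.\<close>

definition g where "g y = indicator \<Omega> y * (- (V y * (1 - u y)) - m * (1 - u y) powr p)"
text \<open>The weak Laplacian of the iterate \<open>w (Suc k)\<close>.\<close>

definition gk where "gk k y = A * w (Suc k) y - h (Suc k) y"

lemma good_w: "good (w k)" using disc_conv disc_conv_good by blast

lemma source_h: "source (h k)" using disc_conv[of k] by (auto simp: disc_conv_def)

lemma u_bounds:
  shows "0 \<le> u x" "u x \<le> 1" "x \<in> \<Omega> \<Longrightarrow> u x \<le> 1 - s x" "x \<notin> \<Omega> \<Longrightarrow> u x = 0"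
proof -
  show "0 \<le> u x" by (rule LIMSEQ_le_const[OF u]) (simp add: good_range[OF good_w])
  show "u x \<le> 1" by (rule LIMSEQ_le_const2[OF u]) (simp add: good_range[OF good_w])
  show "u x \<le> 1 - s x" if "x \<in> \<Omega>"
    by (rule LIMSEQ_le_const2[OF u]) (use good_w that in \<open>auto simp: good_def\<close>)
  show "u x = 0" if "x \<notin> \<Omega>"
  proof -
    have "w k x = 0" for k using good_w[of k] that by (simp add: good_def)
    then show ?thesis using u[of x] by (simp add: LIMSEQ_const_iff)
  qed
qed

text \<open>Strictness comes from the lower barrier \<open>s\<close>. It makes \<open>1 - u\<close>
  a positive base, so that real powers and later the logarithm of \<open>1 - u\<close> are
  smooth.\<close>

lemma u_less_1: "u x < 1"
  using u_bounds(3,4)[of x] s_pos[of x] by (cases "x \<in> \<Omega>") auto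

lemma w_measurable: "w k \<in> borel_measurable borel"
  using good_w[of k] by (intro borel_measurable_continuous_onI) (simp add: good_def)

lemma u_measurable: "u \<in> borel_measurable borel"
  using u w_measurable by (rule borel_measurable_LIMSEQ_real)

lemma gk_measurable: "gk k \<in> borel_measurable borel"
proof -
  have [measurable]: "h (Suc k) \<in> borel_measurable borel"
    using source_h[of "Suc k"] by (intro borel_measurable_continuous_onI) (simp add: source_def)
  note [measurable] = w_measurable
  show ?thesis unfolding gk_def[abs_def] by measurable
qed

lemma gk_bound: "\<bar>gk k y\<bar> \<le> A + M"
proof -
  have "0 \<le> A * w (Suc k) y" "A * w (Suc k) y \<le> A * 1"
    using good_range[OF good_w] A by (auto intro!: mult_left_mono)
  moreover have "0 \<le> h (Suc k) y" "h (Suc k) y \<le> M" using source_h[of "Suc k"] by (auto simp: source_def)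
  ultimately show ?thesis unfolding gk_def using A M by linarith
qed

lemma gk_lim: "(\<lambda>k. gk k y) \<longlonglongrightarrow> g y"
proof (cases "y \<in> \<Omega>")
  case True
  have "(\<lambda>k. \<eta> (Suc k) y * H y (w k y)) \<longlonglongrightarrow> 1 * H y (u y)"
  proof (rule tendsto_mult[OF LIMSEQ_Suc[OF \<eta>_lim[OF True]]])
    show "(\<lambda>k. H y (w k y)) \<longlonglongrightarrow> H y (u y)"
      unfolding H_def by (intro tendsto_intros u) (use u_less_1[of y] in simp)
  qed
  then have "(\<lambda>k. A * w (Suc k) y - \<eta> (Suc k) y * H y (w k y)) \<longlonglongrightarrow> A * u y - 1 * H y (u y)"
    by (intro tendsto_diff[OF tendsto_mult[OF tendsto_const LIMSEQ_Suc[OF u]]]) simp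
  then show ?thesis using True by (simp add: gk_def[abs_def] g_def h_Suc rhs_def H_def)
next
  case False
  then have "gk k y = 0" for k
    using good_w[of "Suc k"] source_h[of "Suc k"] by (simp add: gk_def good_def source_def)
  then show ?thesis using False by (simp add: g_def)
qed

lemma g_measurable: "g \<in> borel_measurable borel"
  using gk_lim gk_measurable by (rule borel_measurable_LIMSEQ_real)

lemma g_bound: "\<bar>g y\<bar> \<le> A + M"
  by (rule LIMSEQ_le_const2[OF tendsto_rabs[OF gk_lim]]) (simp add: gk_bound)

lemma outside: "y \<notin> cball 0 R \<Longrightarrow> u y = 0" "y \<notin> cball 0 R \<Longrightarrow> g y = 0"
proof -
  assume "y \<notin> cball 0 R"
  then have "y \<notin> \<Omega>" using R by blast
  then show "u y = 0" "g y = 0" using u_bounds(4) by (auto simp: g_def)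
qed

text \<open>The boundary estimate of the iterates has a constant independent of \<open>k\<close>, so
  it passes to the limit and yields the boundary values.\<close>

lemma u_boundary:
  assumes "y \<notin> \<Omega>" shows "u x \<le> M * (2 * R + 1) * norm (y - x)"
proof (cases "x \<in> \<Omega>")
  case True
  show ?thesis
  proof (rule LIMSEQ_le_const2[OF u], intro exI allI impI)
    fix k
    obtain \<sigma> where "disc_conv \<sigma> (h k) (w k)" using disc_conv by blast
    then show "w k x \<le> M * (2 * R + 1) * norm (y - x)"
      using discrete_limit.lim_boundary[OF disc_conv_limit True assms] by blast
  qed
next
  case False
  then show ?thesis using u_bounds(4) M R by simp
qed

end

text \<open>Couples the limit with a parametrix whose radius fits into \<Omega> around
  \<open>x\<close>, so that the test functions centred at \<open>x\<close> vanish outside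
  \<Omega>.\<close>

locale semilinear_limit_at = semilinear_limit \<Omega> V m p R w h u + par: parametrix "TYPE('n)" N \<alpha> r
  for \<Omega> :: "(real^'n) set" and V :: "real^'n \<Rightarrow> real" and m p R :: real and w h u and N \<alpha> r :: real +
  fixes x :: "real^'n"
  assumes ball: "cball x r \<subseteq> \<Omega>"
begin

lemma weak_iterate:
  assumes d: "d > 0"
  shows "(\<integral>y. w (Suc k) y * par.test_lap d (y - x) \<partial>lborel) = (\<integral>y. gk k y * par.test d (y - x) \<partial>lborel)"
proof -
  obtain \<sigma> where i: "disc_conv \<sigma> (h (Suc k)) (w (Suc k))" using disc_conv by blast
  interpret dl: discrete_limit \<Omega> A M R "\<lambda>j. e (\<sigma> j)" "h (Suc k)" "w (Suc k)" "\<lambda>j. S (h (Suc k)) (\<sigma> j)"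
    by (rule disc_conv_limit[OF i])
  obtain B where B: "\<And>y. \<bar>par.test d (y - x)\<bar> \<le> B" "\<And>y d'. d' > 0 \<Longrightarrow> \<bar>dlap d' (\<lambda>y. par.test d (y - x)) y\<bar> \<le> B"
    and lim: "\<And>y d'. (\<And>j. d' j > 0) \<Longrightarrow> d' \<longlonglongrightarrow> 0 \<Longrightarrow> (\<lambda>j. dlap (d' j) (\<lambda>y. par.test d (y - x)) y) \<longlonglongrightarrow> par.test_lap d (y - x)"
    using par.test_dlap[OF d, where a = x] by blast
  have "(\<integral>y. w (Suc k) y * par.test_lap d (y - x) \<partial>lborel) = (\<integral>y. (A * w (Suc k) y - h (Suc k) y) * par.test d (y - x) \<partial>lborel)"
  proof (rule dl.lim_weak[OF par.test_measurable[OF d] _ B(1)])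
    show "par.test d (y - x) = 0" if "y \<notin> \<Omega>" for y
      by (rule par.test_shift_supp) (use that ball in blast)
    show "\<bar>dlap (e (\<sigma> j)) (\<lambda>y. par.test d (y - x)) y\<bar> \<le> B" for y j by (rule B(2)[OF e(1)])
    show "(\<lambda>j. dlap (e (\<sigma> j)) (\<lambda>y. par.test d (y - x)) y) \<longlonglongrightarrow> par.test_lap d (y - x)" for y
      by (rule lim[OF e(1) dl.e0])
  qed
  then show ?thesis by (simp add: gk_def)
qed

lemma weak_limit:
  assumes d: "d > 0" "d \<le> 1"
  shows "(\<integral>y. u y * par.test_lap d (y - x) \<partial>lborel) = (\<integral>y. g y * par.test d (y - x) \<partial>lborel)"
proof -
  have tr: "integrable lborel (\<lambda>y. f (y - x))" if "integrable lborel f" for f :: "real^'n \<Rightarrow> real"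
  proof -
    have "integrable lborel (\<lambda>y. f (- y))" using lborel_integrable_reflect[OF that, of 0] by simp
    from lborel_integrable_reflect[OF this, of x] show ?thesis by simp
  qed
  have i: "integrable lborel (\<lambda>y. par.test_lap d (y - x))" "integrable lborel (\<lambda>y. par.test d (y - x))"
    by (intro tr par.integrable_test_lap d)
      (intro tr continuous_compact_support_integrable[OF par.continuous_test[OF d(1)] par.test_supp])
  have "(\<lambda>k. \<integral>y. par.test_lap d (y - x) * w (Suc k) y \<partial>lborel) \<longlonglongrightarrow> (\<integral>y. par.test_lap d (y - x) * u y \<partial>lborel)"
    by (rule bounded_limit_integral[OF i(1) w_measurable, of _ 1]) (use good_range[OF good_w] LIMSEQ_Suc[OF u] in auto)
  moreover have "(\<lambda>k. \<integral>y. par.test d (y - x) * gk k y \<partial>lborel) \<longlonglongrightarrow> (\<integral>y. par.test d (y - x) * g y \<partial>lborel)"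
    by (rule bounded_limit_integral[OF i(2) gk_measurable gk_bound gk_lim])
  ultimately have "(\<integral>y. par.test_lap d (y - x) * u y \<partial>lborel) = (\<integral>y. par.test d (y - x) * g y \<partial>lborel)"
    using weak_iterate[OF d(1)] LIMSEQ_unique by (simp add: mult.commute)
  then show ?thesis by (simp add: mult.commute)
qed

text \<open>\<open>representation\<close> asks for continuity at \<open>x\<close>, which is not yet
  known for \<open>u\<close>. It is therefore applied to the continuous iterates, and the limit in
  \<open>k\<close> is taken afterwards in the convolutions.\<close>

lemma limit_representation: "par.\<kappa> * u x = cv (radial par.om 0) u x - cv (radial par.F 0) g x"
proof -
  have "par.\<kappa> * w (Suc k) x = cv (radial par.om 0) (w (Suc k)) x - cv (radial par.F 0) (gk k) x" for k
  proof (rule par.representation[OF w_measurable _ _ gk_measurable gk_bound weak_iterate])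
    show "\<bar>w (Suc k) y\<bar> \<le> 1" for y using good_range[OF good_w, of "Suc k" y] by simp
    show "isCont (w (Suc k)) x" using good_w[of "Suc k"] by (simp add: good_def continuous_on_eq_continuous_at)
  qed
  moreover have "(\<lambda>k. cv (radial par.om 0) (w (Suc k)) x - cv (radial par.F 0) (gk k) x) \<longlonglongrightarrow>
      cv (radial par.om 0) u x - cv (radial par.F 0) g x"
  proof (rule tendsto_diff)
    show "(\<lambda>k. cv (radial par.om 0) (w (Suc k)) x) \<longlonglongrightarrow> cv (radial par.om 0) u x"
      by (rule cv_limit[OF par.integrable_limit_kernels(1) w_measurable, of _ 1]) (use good_range[OF good_w] LIMSEQ_Suc[OF u] in auto)
    show "(\<lambda>k. cv (radial par.F 0) (gk k) x) \<longlonglongrightarrow> cv (radial par.F 0) g x"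
      by (rule cv_limit[OF par.integrable_limit_kernels(2) gk_measurable gk_bound gk_lim])
  qed
  moreover have "(\<lambda>k. par.\<kappa> * w (Suc k) x) \<longlonglongrightarrow> par.\<kappa> * u x" by (intro tendsto_intros LIMSEQ_Suc[OF u])
  ultimately show ?thesis using LIMSEQ_unique by simp
qed

end

section \<open>Smoothness of the limit and the pointwise equation\<close>

context semilinear_limit
begin

lemma parametrix_at: "r > 0 \<Longrightarrow> parametrix TYPE('n) (real CARD('n)) (1 - real CARD('n) / 2) r"
  by standard (use dim in auto)

text \<open>The factor \<open>4\<close> leaves room for three nested balls: points of
  \<open>ball x r\<close>, their neighbourhoods of radius \<open>r\<close> inside
  \<open>ball x (3 * r)\<close>, and its closure inside \<Omega>.\<close>

lemma local_radius:
  assumes "x \<in> \<Omega>" obtains r where "r > 0" "cball x (4 * r) \<subseteq> \<Omega>"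
proof -
  obtain d where "d > 0" "cball x d \<subseteq> \<Omega>" using op assms open_contains_cball by blast
  then show ?thesis using that[of "d / 4"] by simp
qed

lemma C_k_on_g:
  assumes "C_k_on k \<Omega> u" shows "C_k_on k \<Omega> g"
proof (rule C_k_on_cong[OF op])
  have 1: "C_k_on k \<Omega> (\<lambda>y. 1 + (- 1) * u y)"
    by (intro C_k_on_add[OF op] C_k_on_mult[OF op] C_k_on_const assms)
  have 2: "C_k_on k \<Omega> (\<lambda>y. (1 + (- 1) * u y) powr p)"
    by (rule C_k_on_powr[OF op 1]) (simp add: u_less_1)
  show "C_k_on k \<Omega> (\<lambda>y. (- 1) * (V y * (1 + (- 1) * u y)) + (- m) * (1 + (- 1) * u y) powr p)"
    by (intro C_k_on_add[OF op] C_k_on_mult[OF op] C_k_on_const 1 2 V)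
  show "(- 1) * (V y * (1 + (- 1) * u y)) + (- m) * (1 + (- 1) * u y) powr p = g y" if "y \<in> \<Omega>" for y
    using that by (simp add: g_def)
qed

text \<open>Bootstrap: \<open>g\<close> is as regular as \<open>u\<close> because
  \<open>1 - u\<close> is positive, and the representation then makes \<open>u\<close> better by one
  derivative on a ball around each point.\<close>

lemma C_k_on_u: "C_k_on k \<Omega> u"
proof (induction k)
  case 0
  show ?case
  proof (rule C_k_on_local)
    fix x assume "x \<in> \<Omega>"
    then obtain r where r: "r > 0" "cball x (4 * r) \<subseteq> \<Omega>" by (rule local_radius)
    interpret par: parametrix "TYPE('n)" "real CARD('n)" "1 - real CARD('n) / 2" r by (rule parametrix_at[OF r(1)])
    have "C_k_on 0 (ball x r) u"
    proof (rule par.regularity_start[OF u_measurable _ outside(1) g_measurable g_bound outside(2) open_ball])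
      show "\<bar>u y\<bar> \<le> 1" for y using u_bounds(1,2)[of y] by simp
      fix y assume y: "y \<in> ball x r"
      have "cball y r \<subseteq> cball x (4 * r)"
      proof
        fix z assume "z \<in> cball y r"
        then show "z \<in> cball x (4 * r)" using y r(1) dist_triangle[of x z y] by simp
      qed
      then interpret at: semilinear_limit_at \<Omega> V m p R w h u "real CARD('n)" "1 - real CARD('n) / 2" r y
        by unfold_locales (use r in auto)
      show "par.\<kappa> * u y = cv (radial par.om 0) u y - cv (radial par.F 0) g y" by (rule at.limit_representation)
    qed
    then show "\<exists>V. open V \<and> x \<in> V \<and> C_k_on 0 V u" using r by (intro exI[of _ "ball x r"]) auto
  qed
next
  case (Suc k)
  show ?case
  proof (rule C_k_on_local)
    fix x assume "x \<in> \<Omega>"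
    then obtain r where r: "r > 0" "cball x (4 * r) \<subseteq> \<Omega>" by (rule local_radius)
    interpret par: parametrix "TYPE('n)" "real CARD('n)" "1 - real CARD('n) / 2" r by (rule parametrix_at[OF r(1)])
    have "C_k_on (Suc k) (ball x r) u"
    proof (rule par.regularity_step[OF open_ball open_ball bounded_ball _ _ _ Suc.IH C_k_on_g[OF Suc.IH]])
      show "closure (ball x (3 * r)) \<subseteq> \<Omega>"
      proof -
        have "cball x (3 * r) \<subseteq> cball x (4 * r)" using r(1) by (intro subset_cball) simp
        then show ?thesis using r by (simp add: closure_ball)
      qed
      fix y assume y: "y \<in> ball x r"
      have sub: "cball y r \<subseteq> ball x (3 * r)"
      proof
        fix z assume "z \<in> cball y r"
        then show "z \<in> ball x (3 * r)" using y r(1) dist_triangle[of x z y] by simp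
      qed
      then show "cball y r \<subseteq> ball x (3 * r)" .
      have "ball x (3 * r) \<subseteq> cball x (4 * r)" using r(1) by (auto simp: subset_eq)
      with sub interpret at: semilinear_limit_at \<Omega> V m p R w h u "real CARD('n)" "1 - real CARD('n) / 2" r y
        by unfold_locales (use r in auto)
      show "par.\<kappa> * u y = cv (radial par.om 0) u y - cv (radial par.F 0) g y" by (rule at.limit_representation)
    qed
    then show "\<exists>V. open V \<and> x \<in> V \<and> C_k_on (Suc k) V u" using r by (intro exI[of _ "ball x r"]) auto
  qed
qed

lemma continuous_on_laplacian: "continuous_on \<Omega> (laplacian u)"
proof -
  have "continuous_on \<Omega> (partial i (partial i u))" for i
    using C_k_on_u[of 2] by (simp add: numeral_2_eq_2)
  then show ?thesis unfolding laplacian_def[abs_def] by (intro continuous_on_sum)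
qed

text \<open>A local form of the fundamental lemma of the calculus of variations;
  \<open>\<sigma>\<close> treats both signs. If \<open>D\<close> were positive at \<open>x\<close>,
  it would be positive on a ball, and a nonnegative test function supported there and positive near
  the centre would have a positive integral against \<open>D\<close>, contrary to the weak
  equation.\<close>

lemma laplacian_le:
  assumes x: "x \<in> \<Omega>" and \<sigma>: "\<sigma> = 1 \<or> \<sigma> = (- 1 :: real)"
  shows "\<sigma> * (laplacian u x - g x) \<le> 0"
proof (rule ccontr)
  assume neg: "\<not> ?thesis"
  define D where "D y = \<sigma> * (laplacian u y - g y)" for y
  have Dx: "D x > 0" using neg by (simp add: D_def)
  have gc: "continuous_on \<Omega> g" by (rule C_k_on_continuous[OF C_k_on_g[OF C_k_on_u[of 0]]])
  have Dc: "continuous_on \<Omega> D" unfolding D_def[abs_def] by (intro continuous_intros continuous_on_laplacian gc)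
  then have "isCont D x" using x op by (simp add: continuous_on_eq_continuous_at)
  then obtain \<rho> where \<rho>: "\<rho> > 0" "\<And>y. dist y x < \<rho> \<Longrightarrow> dist (D y) (D x) < D x"
    using Dx unfolding continuous_at_eps_delta dist_real_def by blast
  obtain r0 where r0: "r0 > 0" "cball x (4 * r0) \<subseteq> \<Omega>" using x by (rule local_radius)
  \<comment> \<open>Small enough for \<open>D\<close> to be positive on the whole support of the
    test function, and for the margin that \<open>laplacian_swap\<close> takes around it.\<close>
  define r where "r = min r0 (\<rho> / 2)"
  have r: "r > 0" "r < \<rho>" using r0 \<rho> by (auto simp: r_def)
  have sub: "cball x (r + r) \<subseteq> \<Omega>"
  proof -
    have "cball x (r + r) \<subseteq> cball x (4 * r0)" using r0(1) by (intro subset_cball) (simp add: r_def)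
    then show ?thesis using r0(2) by blast
  qed
  have sub1: "cball x r \<subseteq> \<Omega>" using sub r(1) by (auto simp: subset_eq)
  interpret at: semilinear_limit_at \<Omega> V m p R w h u "real CARD('n)" "1 - real CARD('n) / 2" r x
    by (unfold_locales) (use dim r sub1 in auto)
  \<comment> \<open>\<open>d \<le> r / 2\<close> keeps \<open>(norm z)\<^sup>2 + d\<^sup>2\<close>
    below \<open>r\<^sup>2\<close> for \<open>norm z < r / 2\<close>, so the test function is
    positive there; \<open>d \<le> 1\<close> is the range of \<open>weak_limit\<close>.\<close>
  define d where "d = min 1 (r / 2)"
  have d: "d > 0" "d \<le> 1" "d \<le> r / 2" using r by (auto simp: d_def)
  let ?t = "\<lambda>y. at.par.test d (y - x)"
  have t0: "?t y = 0" if "y \<notin> cball x r" for y by (rule at.par.test_shift_supp[OF that])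
  have Dpos: "D y > 0" if "y \<in> cball x r" for y
    using \<rho>(2)[of y] that r by (auto simp: dist_real_def dist_commute abs_less_iff)
  have [measurable]: "?t \<in> borel_measurable borel" by (rule at.par.test_measurable[OF d(1)])
  have eq: "(\<integral>y. laplacian u y * ?t y \<partial>lborel) = (\<integral>y. g y * ?t y \<partial>lborel)"
    using at.weak_limit[OF d(1,2)] at.par.laplacian_swap[OF u_measurable _ op C_k_on_u[of 2] r(1) sub d(1), of 1] u_bounds(1,2) by simp
  obtain B where B: "\<And>y. y \<in> cball x r \<Longrightarrow> \<bar>laplacian u y\<bar> \<le> B"
    using bounded_on_precompact[OF continuous_on_laplacian, of "cball x r"] sub1 by (metis bounded_cball closed_cball closure_closed)
  obtain C where C: "\<And>y. \<bar>?t y\<bar> \<le> C"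
    using bounded_of_compact_support[OF at.par.continuous_test[OF d(1)] at.par.test_supp] by metis
  have Cnn: "0 \<le> C" using C[of x] by linarith
  have BC: "0 \<le> \<bar>B\<bar> * C" using Cnn by simp
  have sup: "cball x r \<subseteq> cball 0 (norm x + r)" by (rule cball_subset_cball_0)
  have lm: "(\<lambda>y. laplacian u y * ?t y) \<in> borel_measurable borel"
  proof -
    have [measurable]: "(\<lambda>y. indicator \<Omega> y * laplacian u y) \<in> borel_measurable borel"
      by (rule indicator_mult_measurable[OF op continuous_on_laplacian])
    have "(\<lambda>y. laplacian u y * ?t y) = (\<lambda>y. (indicator \<Omega> y * laplacian u y) * ?t y)"
    proof
      fix y show "laplacian u y * ?t y = (indicator \<Omega> y * laplacian u y) * ?t y"
      proof (cases "y \<in> \<Omega>")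
        case False
        then have "y \<notin> cball x r" using sub1 by blast
        then show ?thesis by (simp add: t0)
      qed simp
    qed
    then show ?thesis by simp
  qed
  have il: "integrable lborel (\<lambda>y. laplacian u y * ?t y)"
  proof (rule integrable_bounded_support[OF lm, of "\<bar>B\<bar> * C" "norm x + r"])
    show "\<bar>laplacian u y * ?t y\<bar> \<le> \<bar>B\<bar> * C" for y
    proof (cases "y \<in> cball x r")
      case True
      have "\<bar>laplacian u y\<bar> \<le> \<bar>B\<bar>" using B[OF True] by simp
      then show ?thesis unfolding abs_mult by (intro mult_mono C) auto
    qed (simp add: t0 BC)
    show "laplacian u y * ?t y = 0" if "y \<notin> cball 0 (norm x + r)" for y
    proof -
      have "y \<notin> cball x r" using sup that by blast
      from t0[OF this] show ?thesis by (simp only: mult_zero_right)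
    qed
  qed
  have AMC: "0 \<le> (A + M) * C" using A M Cnn by simp
  have ig: "integrable lborel (\<lambda>y. g y * ?t y)"
  proof (rule integrable_bounded_support[of _ "(A + M) * C" "norm x + r"])
    show "(\<lambda>y. g y * ?t y) \<in> borel_measurable borel" using g_measurable by measurable
    show "\<bar>g y * ?t y\<bar> \<le> (A + M) * C" for y unfolding abs_mult by (intro mult_mono g_bound C) (use A M in auto)
    show "g y * ?t y = 0" if "y \<notin> cball 0 (norm x + r)" for y
    proof -
      have "y \<notin> cball x r" using sup that by blast
      from t0[OF this] show ?thesis by (simp only: mult_zero_right)
    qed
  qed
  have Dt: "D y * ?t y = \<sigma> * (laplacian u y * ?t y - g y * ?t y)" for y
    by (simp add: D_def algebra_simps)
  have iD: "integrable lborel (\<lambda>y. D y * ?t y)" unfolding Dt using il ig by simp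
  have "(\<integral>y. D y * ?t y \<partial>lborel) = 0" unfolding Dt using il ig eq by simp
  moreover have "0 \<le> D y * ?t y" for y
    using Dpos[of y] t0[of y] at.par.test_nonneg[of d "y - x"] by (cases "y \<in> cball x r") auto
  ultimately have "AE y in lborel. D y * ?t y = 0"
    using integral_nonneg_eq_0_iff_AE[OF iD] by simp
  moreover have pos: "D y * ?t y > 0" if y: "y \<in> ball x (r / 2)" for y
  proof (rule mult_pos_pos)
    show "D y > 0" using y r by (intro Dpos) auto
    have ny: "norm (y - x) < r / 2" using y by (simp add: dist_norm norm_minus_commute)
    have "(norm (y - x))\<^sup>2 < (r / 2)\<^sup>2" using ny by (intro power_strict_mono) auto
    moreover have "d\<^sup>2 \<le> (r / 2)\<^sup>2" using d by (intro power_mono) auto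
    moreover have "(r / 2)\<^sup>2 + (r / 2)\<^sup>2 \<le> r\<^sup>2" by (simp add: power_divide)
    ultimately show "?t y > 0" by (intro at.par.test_pos d(1)) linarith
  qed
  ultimately have "AE y in lborel. y \<notin> ball x (r / 2)"
  proof (elim AE_mp, intro AE_I2 impI)
    fix y assume "D y * ?t y = 0"
    then show "y \<notin> ball x (r / 2)" using pos[of y] by auto
  qed
  then have "ball x (r / 2) \<in> null_sets lborel" using AE_iff_null_sets[of "ball x (r / 2)" lborel] by simp
  then have "measure lborel (ball x (r / 2)) = 0" by (simp add: null_sets_def measure_def)
  then show False using content_ball_pos[of "r / 2" x] r by simp
qed

lemma laplacian_u: "x \<in> \<Omega> \<Longrightarrow> laplacian u x = g x"
  using laplacian_le[of x 1] laplacian_le[of x "- 1"] by simp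

text \<open>Inside \<Omega> this is interior regularity; at every other point the linear bound
  \<open>u_boundary\<close> squeezes \<open>u\<close> to \<open>0\<close>.\<close>

lemma continuous_u_closure: "continuous_on UNIV u"
proof -
  have "isCont u y" for y
  proof (cases "y \<in> \<Omega>")
    case True
    then show ?thesis using C_k_on_u[of 0] op by (simp add: continuous_on_eq_continuous_at)
  next
    case False
    have "(u \<longlongrightarrow> 0) (at y)"
    proof (rule Lim_null_comparison)
      show "\<forall>\<^sub>F x in at y. norm (u x) \<le> M * (2 * R + 1) * norm (y - x)"
        using u_boundary[OF False] u_bounds(1) by (intro always_eventually) simp
      have "((\<lambda>x. M * (2 * R + 1) * norm (y - x)) \<longlongrightarrow> M * (2 * R + 1) * norm (y - y)) (at y)"
        by (intro tendsto_intros)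
      then show "((\<lambda>x. M * (2 * R + 1) * norm (y - x)) \<longlongrightarrow> 0) (at y)" by simp
    qed
    then show ?thesis using u_bounds(4)[OF False] by (simp add: isCont_def)
  qed
  then show ?thesis by (simp add: continuous_on_eq_continuous_at)
qed

end

lemma (in semilinear) solution_exists:
  obtains u where "\<And>k. C_k_on k \<Omega> u" "continuous_on UNIV u" "\<And>x. u x < 1" "\<And>x. x \<notin> \<Omega> \<Longrightarrow> u x = 0"
    "\<And>x. x \<in> \<Omega> \<Longrightarrow> laplacian u x = - (V x * (1 - u x)) - m * (1 - u x) powr p"
proof -
  obtain h w where it: "\<forall>k. \<exists>\<sigma>. disc_conv \<sigma> (h k) (w k)" "\<forall>k. h (Suc k) = rhs (Suc k) (w k)" "\<forall>k x. w k x \<le> w (Suc k) x"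
    using iteration by (elim exE conjE)
  have wh: "\<exists>\<sigma>. disc_conv \<sigma> (h k) (w k)" "h (Suc k) = rhs (Suc k) (w k)" and mono: "w k x \<le> w (Suc k) x" for k x
    using it by auto
  have good: "good (w k)" for k using wh(1) disc_conv_good by blast
  have "\<exists>l. (\<lambda>k. w k x) \<longlonglongrightarrow> l" for x
  proof -
    have "incseq (\<lambda>k. w k x)" by (rule incseq_SucI) (rule mono)
    moreover have "\<forall>k. w k x \<le> 1" using good_range[OF good] by simp
    ultimately obtain l where "(\<lambda>k. w k x) \<longlonglongrightarrow> l" by (rule incseq_convergent)
    then show ?thesis by blast
  qed
  then obtain u where u: "\<And>x. (\<lambda>k. w k x) \<longlonglongrightarrow> u x" by metis
  interpret semilinear_limit \<Omega> V m p R w h u by unfold_locales (use wh u in auto)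
  have "laplacian u x = - (V x * (1 - u x)) - m * (1 - u x) powr p" if "x \<in> \<Omega>" for x
    using laplacian_u[OF that] that by (simp add: g_def)
  from that[OF C_k_on_u continuous_u_closure u_less_1 u_bounds(4) this] show ?thesis .
qed

section \<open>Undoing the substitution\<close>

lemma partial_const [simp]: "partial i (\<lambda>_ :: real^'n. c) x = 0"
  using partial_eq[OF has_derivative_const] .

text \<open>The reciprocal is written as \<open>v powr (- 1)\<close> to reuse the rules for real
  powers. Differentiating it produces the negative quadratic gradient term that has to match the one
  in the equation.\<close>

lemma laplacian_log:
  fixes v :: "real^'n \<Rightarrow> real"
  assumes op: "open \<Omega>" and v: "C_k_on 2 \<Omega> v" and pos: "\<And>x. x \<in> \<Omega> \<Longrightarrow> v x > 0" and x: "x \<in> \<Omega>"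
  shows "laplacian (\<lambda>x. c + b * ln (v x)) x = b * (laplacian v x / v x - (norm (grad v x))\<^sup>2 / (v x)\<^sup>2)"
    and "(norm (grad (\<lambda>x. c + b * ln (v x)) x))\<^sup>2 = b\<^sup>2 * (norm (grad v x))\<^sup>2 / (v x)\<^sup>2"
proof -
  have dv: "v differentiable (at y)" "partial i v differentiable (at y)" if "y \<in> \<Omega>" for y i
    using v that by (simp_all add: numeral_2_eq_2)
  have p1: "partial i (\<lambda>x. c + b * ln (v x)) y = b * (partial i v y * v y powr (- 1))"
    and d1: "(\<lambda>x. b * ln (v x)) differentiable (at y)" if y: "y \<in> \<Omega>" for y i
  proof -
    note l = partial_ln[OF dv(1)[OF y] pos[OF y]]
    show "(\<lambda>x. b * ln (v x)) differentiable (at y)" using l(2) by (intro differentiable_mult) simp_all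
    then have "partial i (\<lambda>x. c + b * ln (v x)) y = partial i (\<lambda>x. c) y + partial i (\<lambda>x. b * ln (v x)) y"
      by (intro partial_add) simp_all
    also have "partial i (\<lambda>x. b * ln (v x)) y = b * partial i (\<lambda>x. ln (v x)) y + partial i (\<lambda>x. b) y * ln (v y)"
      using l(2) by (intro partial_mult) simp_all
    finally show "partial i (\<lambda>x. c + b * ln (v x)) y = b * (partial i v y * v y powr (- 1))"
      using partial_const l(1) by simp
  qed
  have p2: "partial i (partial i (\<lambda>x. c + b * ln (v x))) x = b * (partial i (partial i v) x / v x - (partial i v x)\<^sup>2 / (v x)\<^sup>2)" for i
  proof -
    have dp: "(\<lambda>y. v y powr (- 1)) differentiable (at x)"
      and pp: "partial i (\<lambda>y. v y powr (- 1)) x = (- 1 * v x powr (- 1 - 1)) * partial i v x"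
      using partial_chain[OF dv(1)[OF x] has_real_derivative_powr[OF pos[OF x], of "- 1"]] by auto
    have dm: "(\<lambda>y. partial i v y * v y powr (- 1)) differentiable (at x)"
      using dv(2)[OF x] dp by (rule differentiable_mult)
    have db: "(\<lambda>y. b * (partial i v y * v y powr (- 1))) differentiable (at x)"
      by (rule differentiable_mult[OF differentiable_const dm])
    have "partial i (partial i (\<lambda>x. c + b * ln (v x))) x = partial i (\<lambda>y. b * (partial i v y * v y powr (- 1))) x"
      by (rule differentiable_transform_open(2)[OF op x _ db]) (simp add: p1)
    also have "\<dots> = b * partial i (\<lambda>y. partial i v y * v y powr (- 1)) x + partial i (\<lambda>y. b) x * (partial i v x * v x powr (- 1))"
      using dm by (intro partial_mult) simp_all
    also have "\<dots> = b * (partial i v x * partial i (\<lambda>y. v y powr (- 1)) x + partial i (partial i v) x * v x powr (- 1))"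
      using partial_const partial_mult[OF dv(2)[OF x] dp, of i] by simp
    also have "\<dots> = b * (partial i (partial i v) x / v x - (partial i v x)\<^sup>2 / (v x)\<^sup>2)"
    proof -
      have "v x powr (- 1) = 1 / v x" "v x powr (- 1 - 1) = 1 / (v x)\<^sup>2"
        using pos[OF x] by (simp_all add: powr_minus powr_realpow divide_inverse)
      then show ?thesis unfolding pp by (simp add: power2_eq_square algebra_simps)
    qed
    finally show ?thesis .
  qed
  have n: "(norm (grad f x))\<^sup>2 = (\<Sum>i\<in>UNIV. (partial i f x)\<^sup>2)" for f :: "real^'n \<Rightarrow> real"
    by (simp add: norm_vec_def L2_set_def grad_def sum_nonneg)
  show "laplacian (\<lambda>x. c + b * ln (v x)) x = b * (laplacian v x / v x - (norm (grad v x))\<^sup>2 / (v x)\<^sup>2)"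
    unfolding laplacian_def p2 n by (simp add: sum_subtractf sum_divide_distrib sum_distrib_left[symmetric])
  show "(norm (grad (\<lambda>x. c + b * ln (v x)) x))\<^sup>2 = b\<^sup>2 * (norm (grad v x))\<^sup>2 / (v x)\<^sup>2"
    unfolding n p1[OF x] using pos[OF x]
    by (simp add: power_mult_distrib powr_minus sum_distrib_left sum_divide_distrib divide_inverse power_inverse mult_ac)
qed

lemma laplacian_one_minus:
  fixes u :: "real^'n \<Rightarrow> real"
  assumes op: "open \<Omega>" and u: "C_k_on 2 \<Omega> u" and x: "x \<in> \<Omega>"
  shows "laplacian (\<lambda>x. 1 + (- 1) * u x) x = - laplacian u x"
proof -
  have du: "u differentiable (at y)" "partial i u differentiable (at y)" if "y \<in> \<Omega>" for y i
    using u that by (simp_all add: numeral_2_eq_2)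
  have m: "partial i (\<lambda>x. (- 1) * f x) y = - partial i f y" if "f differentiable (at y)" for f :: "real^'n \<Rightarrow> real" and i y
    using partial_mult[of "\<lambda>_. - 1" y f i] that partial_const by simp
  have p1: "partial i (\<lambda>x. 1 + (- 1) * u x) y = (- 1) * partial i u y" if y: "y \<in> \<Omega>" for y i
  proof -
    have d: "(\<lambda>x. (- 1) * u x) differentiable (at y)" using du(1)[OF y] by (intro differentiable_mult) simp_all
    have "partial i (\<lambda>x. 1 + (- 1) * u x) y = partial i (\<lambda>x. 1) y + partial i (\<lambda>x. (- 1) * u x) y"
      by (rule partial_add[OF _ d]) simp
    then show ?thesis using partial_const m[OF du(1)[OF y]] by simp
  qed
  have "partial i (partial i (\<lambda>x. 1 + (- 1) * u x)) x = - partial i (partial i u) x" for i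
  proof -
    have d: "(\<lambda>x. (- 1) * partial i u x) differentiable (at x)" using du(2)[OF x] by (intro differentiable_mult) simp_all
    have "partial i (partial i (\<lambda>x. 1 + (- 1) * u x)) x = partial i (\<lambda>y. (- 1) * partial i u y) x"
      by (rule differentiable_transform_open(2)[OF op x _ d]) (simp only: p1)
    then show ?thesis using m[OF du(2)[OF x]] by simp
  qed
  then show ?thesis by (simp add: laplacian_def sum_negf)
qed

theorem convex_domain_solvable:
  fixes \<Omega> :: "(real^'n) set" and S :: "real^'n \<Rightarrow> real"
  assumes dim: "CARD('n) \<ge> 3" and op: "open \<Omega>" and conv: "convex \<Omega>" and bdd: "bounded \<Omega>"
    and S: "smooth_on \<Omega> S" and \<gamma>: "\<And>x. x \<in> \<Omega> \<Longrightarrow> \<bar>S x\<bar> \<le> \<gamma>" "\<gamma> > 0"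
  defines "n \<equiv> real CARD('n)"
  shows "\<exists>l f. smooth_on \<Omega> f \<and> continuous_on (closure \<Omega>) f \<and>
    (\<forall>x\<in>\<Omega>. laplacian f x = - (1 / (2 * (n - 1))) * (l * exp (2 * f x) + (n - 1) * (n - 2) * (norm (grad f x))\<^sup>2) + S x) \<and>
    (\<forall>x\<in>frontier \<Omega>. f x = c)"
proof -
  \<comment> \<open>The gradient term is \<open>- 1 / a\<close> times
    \<open>(norm (grad v x))\<^sup>2 / (v x)\<^sup>2\<close> in the Laplacian of \<open>f\<close>
    and \<open>- (n - 2) / (2 * a\<^sup>2)\<close> times it in the equation; they agree for this
    \<open>a\<close>.\<close>
  define a where "a = (n - 2) / 2"
  have n3: "n \<ge> 3" using dim by (simp add: n_def)
  have a: "a > 0" using n3 by (simp add: a_def)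
  \<comment> \<open>The bound for \<open>\<bar>a * S x\<bar>\<close>; this choice fixes
    \<open>l\<close> below.\<close>
  define m where "m = a * \<gamma>"
  have m: "m > 0" using a \<gamma> by (simp add: m_def)
  \<comment> \<open>Equal to \<open>(n + 2) / (n - 2)\<close>: the exponential contributes
    \<open>v powr (2 / a)\<close>, and multiplying the equation by \<open>v\<close> adds one to the
    exponent.\<close>
  define p where "p = 1 + 2 / a"
  obtain R0 where R0: "\<forall>x\<in>\<Omega>. norm x \<le> R0" using bdd unfolding bounded_iff by blast
  define R where "R = max R0 1"
  have sl: "semilinear \<Omega> (\<lambda>x. a * S x) m p R"
  proof
    show "\<Omega> \<subseteq> cball 0 R" using R0 by (auto simp: R_def)
    show "C_k_on k \<Omega> (\<lambda>x. a * S x)" for k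
      using S by (intro C_k_on_mult[OF op] C_k_on_const) (simp add: smooth_on_def)
    show "\<bar>a * S x\<bar> \<le> m" if "x \<in> \<Omega>" for x
      using \<gamma>(1)[OF that] a by (simp add: m_def abs_mult)
  qed (use dim op conv m a in \<open>auto simp: R_def p_def\<close>)
  obtain u where u: "\<And>k. C_k_on k \<Omega> u" "continuous_on UNIV u" "\<And>x. u x < 1" "\<And>x. x \<notin> \<Omega> \<Longrightarrow> u x = 0"
    and lap: "\<And>x. x \<in> \<Omega> \<Longrightarrow> laplacian u x = - (a * S x * (1 - u x)) - m * (1 - u x) powr p"
    using semilinear.solution_exists[OF sl] by blast
  define v where "v x = 1 + (- 1) * u x" for x
  have vpos: "v x > 0" for x using u(3)[of x] by (simp add: v_def)
  have vC: "C_k_on k \<Omega> v" for k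
    unfolding v_def[abs_def] by (intro C_k_on_add[OF op] C_k_on_mult[OF op] C_k_on_const u)
  have lapv: "laplacian v x = a * S x * v x + m * v x powr p" if "x \<in> \<Omega>" for x
    using laplacian_one_minus[OF op u(1) that] lap[OF that] by (simp add: v_def[abs_def])
  define f where "f x = c + (1 / a) * ln (v x)" for x
  \<comment> \<open>Chosen so that \<open>- l * exp (2 * c) / (2 * (n - 1)) = m / a\<close>.\<close>
  define l where "l = - (2 * (n - 1) * m / (a * exp (2 * c)))"
  have "smooth_on \<Omega> f"
    unfolding smooth_on_def f_def[abs_def]
    by (intro allI C_k_on_add[OF op] C_k_on_mult[OF op] C_k_on_const C_k_on_ln[OF op vC vpos])
  moreover have "continuous_on (closure \<Omega>) f"
  proof -
    have "continuous_on UNIV v" unfolding v_def[abs_def] by (intro continuous_intros u(2))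
    then have "continuous_on UNIV f" unfolding f_def[abs_def]
      by (intro continuous_intros) (use vpos less_imp_neq in \<open>auto simp: less_le\<close>)
    then show ?thesis by (rule continuous_on_subset) simp
  qed
  moreover have "laplacian f x = - (1 / (2 * (n - 1))) * (l * exp (2 * f x) + (n - 1) * (n - 2) * (norm (grad f x))\<^sup>2) + S x"
    if x: "x \<in> \<Omega>" for x
  proof -
    define G where "G = (norm (grad v x))\<^sup>2 / (v x)\<^sup>2"
    have vx: "v x > 0" by (rule vpos)
    have lf: "laplacian f x = (1 / a) * (laplacian v x / v x - G)"
      unfolding f_def[abs_def] G_def by (rule laplacian_log(1)[OF op vC _ x]) (rule vpos)
    have gf: "(norm (grad f x))\<^sup>2 = (1 / a)\<^sup>2 * G"
      using laplacian_log(2)[OF op vC vpos x, of c "1 / a"] unfolding f_def[abs_def] G_def by simp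
    have "exp (2 * f x) = exp (2 * c) * exp ((2 / a) * ln (v x))"
      unfolding f_def by (simp add: exp_add[symmetric] algebra_simps)
    also have "exp ((2 / a) * ln (v x)) = v x powr (2 / a)" using vx by (simp add: powr_def)
    finally have ef: "exp (2 * f x) = exp (2 * c) * v x powr (2 / a)" .
    have "v x powr p / v x = v x powr (2 / a)" using vx by (simp add: p_def powr_add)
    moreover have "laplacian v x / v x = a * S x + m * (v x powr p / v x)"
      unfolding lapv[OF x] using vx by (simp add: add_divide_distrib)
    ultimately have "laplacian v x / v x = a * S x + m * v x powr (2 / a)" by (simp only:)
    then have L: "laplacian f x = S x + (m / a) * v x powr (2 / a) - G / a"
      unfolding lf using a by (simp add: field_simps)
    have r1: "- (1 / (2 * (n - 1))) * (l * exp (2 * f x)) = (m / a) * v x powr (2 / a)"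
      unfolding ef l_def using n3 by simp
    have r2: "- (1 / (2 * (n - 1))) * ((n - 1) * (n - 2) * (norm (grad f x))\<^sup>2) = - (G / a)"
    proof -
      have "- (1 / (2 * (n - 1))) * ((n - 1) * (n - 2) * X) = - (a * X)" for X
        using n3 by (simp add: a_def divide_simps)
      then show ?thesis unfolding gf using a by (simp add: power2_eq_square)
    qed
    show ?thesis unfolding distrib_left r1 r2 L by simp
  qed
  moreover have "f x = c" if "x \<in> frontier \<Omega>" for x
  proof -
    have "x \<notin> \<Omega>" using that op by (simp add: frontier_def interior_open)
    then show ?thesis using u(4) by (simp add: f_def v_def)
  qed
  ultimately show ?thesis by blast
qed

theorem theorem2:
  fixes \<Omega> :: "(real^'n) set" and S :: "real^'n \<Rightarrow> real" and \<gamma> :: real and n :: nat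
  assumes n: "n = CARD('n)"
    and \<gamma>: "\<gamma> > 0"
    and S_smooth: "smooth_on \<Omega> S"
    and S_bound: "sup_norm_on \<Omega> S \<le> ereal \<gamma>"
    and cases:
      "(n = 3 \<and> open \<Omega> \<and> \<Omega> \<noteq> {} \<and> bounded \<Omega> \<and> convex \<Omega> \<and> smooth_boundary \<Omega> \<and>
         ((measure lebesgue \<Omega> \<le> (8 / (4.76 * pi powr (2/3) * (1 + \<gamma>))) ^ 3 \<and>
           slab_diameter \<Omega> \<le> min 1 (1.25 * measure lebesgue \<Omega> powr (1/3)))
          \<or> diameter \<Omega> \<le> min 1 (4 / (4.76 * pi powr (2/3) * (0.625 + \<gamma>)))))
       \<or> (n \<ge> 4 \<and>
          (\<exists>a d. d > 0 \<and> \<Omega> = ball a d \<and>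
             d \<le> min (1/2) ((real n - 1) / (green_const TYPE('n) * (0.625 + \<gamma>)))))"
  shows "\<forall>c::real. \<exists>(l::real) f.
           smooth_on \<Omega> f \<and> continuous_on (closure \<Omega>) f \<and>
           (\<forall>x\<in>\<Omega>. laplacian f x =
              - (1 / (2 * (real n - 1))) *
                (l * exp (2 * f x) + (real n - 1) * (real n - 2) * (norm (grad f x))\<^sup>2) + S x) \<and>
           (\<forall>x\<in>frontier \<Omega>. f x = c)"
proof
  fix c
  \<comment> \<open>Either alternative describes a bounded, convex, open set in dimension at least
    \<open>3\<close>, which is the setting of \<open>convex_domain_solvable\<close>.\<close>
  have dim: "CARD('n) \<ge> 3" and dom: "open \<Omega>" "convex \<Omega>" "bounded \<Omega>"
    using cases unfolding n by auto
  have "\<bar>S x\<bar> \<le> \<gamma>" if "x \<in> \<Omega>" for x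
  proof -
    have "ereal \<bar>S x\<bar> \<le> ereal \<gamma>"
      using SUP_upper[OF that, of "\<lambda>x. ereal \<bar>S x\<bar>"] S_bound unfolding sup_norm_on_def by (rule order_trans)
    then show ?thesis by simp
  qed
  then show "\<exists>l f. smooth_on \<Omega> f \<and> continuous_on (closure \<Omega>) f \<and>
      (\<forall>x\<in>\<Omega>. laplacian f x =
         - (1 / (2 * (real n - 1))) *
           (l * exp (2 * f x) + (real n - 1) * (real n - 2) * (norm (grad f x))\<^sup>2) + S x) \<and>
      (\<forall>x\<in>frontier \<Omega>. f x = c)"
    unfolding n by (rule convex_domain_solvable[OF dim dom S_smooth _ \<gamma>])
qed

end
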